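(* For any $h\in L_1(\mathcal E)$ the semigroup $\widehat S_{th}$ on $\mathcal H_{\mathcal E}$ is unitary and strongly continuous. In addition, for any $T>0$ and $f\in\mathcal H_{\mathcal E}$ $$\lim_{m\to\infty}\ \sup_{t\in[0,T]}\big\|\widehat S_{th}f-\widehat S_{tP_mh}f\big\|_{\mathcal H_{\mathcal E}}=0.$$
   Context: $E$ is an infinite-dimensional real separable Hilbert space with orthonormal basis $\mathcal E=\{e_k\}_{k\in\mathbb N}$; $x_k=(x,e_k)$. A block is a set $\Pi_{a,b}=\{x\in E: x_j\in[a_j,b_j)\ \forall j\}$ with $a,b\in\ell_\infty$, $a_j<b_j$; it is absolutely measurable if it is empty or $\sum_j\max\{0,\ln(b_j-a_j)\}<\infty$. Put $\lambda_{\mathcal E}(\Pi_{a,b})=\prod_j(b_j-a_j)$ if $\Pi_{a,b}\ne\emptyset$ (value $0$ if the product diverges to $0$), and $\lambda_{\mathcal E}(\emptyset)=0$. It is known that $\lambda_{\mathcal E}$ extends uniquely to a finitely additive shift-invariant measure on the ring generated by absolutely measurable blocks, and then to the completion $\mathcal R_{\mathcal E}$ of this ring. $\mathcal H_{\mathcal E}$ is the complex Hilbert space obtained by completing (modulo the null space) the space of finite sums $\sum c_k\chi_{B_k}$, $c_k\in\mathbb C$, $B_k\in\mathcal R_{\mathcal E}$ pairwise disjoint, in the norm $(\sum|c_k|^2\lambda_{\mathcal E}(B_k))^{1/2}$. $L_1(\mathcal E)=\{h\in E:\sum_k|(h,e_k)|<\infty\}$; $P_n$ is the orthogonal projection onto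 $\mathrm{span}(e_1,\dots,e_n)$. If $h\in\mathrm{span}(e_1,\dots,e_n)$ for some $n$, $\widehat S_h$ is multiplication by $e^{i(h,x)}$ on $\mathcal H_{\mathcal E}$. For $h\in L_1(\mathcal E)$, $\widehat S_hf(x)=e^{i(h,x)}f(x)$ is defined as the limit of $\widehat S_{P_nh}f$ in $\mathcal H_{\mathcal E}$ as $n\to\infty$. *)

theory Defs
  imports "HOL-Analysis.Analysis"
begin

section \<open>Orthonormal bases, projections, summable vectors\<close>

text \<open>
  The space \<open>E\<close> is the type \<open>'a::{real_inner, complete_space}\<close>. An orthonormal basis indexed by
  \<open>nat\<close> makes it infinite-dimensional and separable. Indices start at 0, so
  \<open>e\<^sub>1, \<dots>, e\<^sub>n\<close> are \<open>e 0, \<dots>, e (n - 1)\<close>.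
\<close>

definition orthonormal_basis :: "(nat \<Rightarrow> 'a::{real_inner, complete_space}) \<Rightarrow> bool" where
  "orthonormal_basis e \<longleftrightarrow>
     (\<forall>i j. e i \<bullet> e j = (if i = j then 1 else 0)) \<and> closure (span (range e)) = UNIV"

definition proj :: "(nat \<Rightarrow> 'a::{real_inner, complete_space}) \<Rightarrow> nat \<Rightarrow> 'a \<Rightarrow> 'a" where
  "proj e n h = (THE y. y \<in> span (e ` {..<n}) \<and> (\<forall>z \<in> span (e ` {..<n}). orthogonal (h - y) z))"

definition L1 :: "(nat \<Rightarrow> 'a::{real_inner, complete_space}) \<Rightarrow> 'a set" where
  "L1 e = {h. summable (\<lambda>k. \<bar>h \<bullet> e k\<bar>)}"


section \<open>The measure\<close>

definition block ::
  "(nat \<Rightarrow> 'a::{real_inner, complete_space}) \<Rightarrow> (nat \<Rightarrow> real) \<Rightarrow> (nat \<Rightarrow> real) \<Rightarrow> 'a set" where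
  "block e a b = {x. \<forall>j. x \<bullet> e j \<in> {a j..<b j}}"

definition block_bounds :: "(nat \<Rightarrow> real) \<Rightarrow> (nat \<Rightarrow> real) \<Rightarrow> bool" where
  "block_bounds a b \<longleftrightarrow> bounded (range a) \<and> bounded (range b) \<and> (\<forall>j. a j < b j)"

definition abs_measurable ::
  "(nat \<Rightarrow> 'a::{real_inner, complete_space}) \<Rightarrow> (nat \<Rightarrow> real) \<Rightarrow> (nat \<Rightarrow> real) \<Rightarrow> bool" where
  "abs_measurable e a b \<longleftrightarrow>
     block_bounds a b \<and> (block e a b = {} \<or> summable (\<lambda>j. max 0 (ln (b j - a j))))"

text \<open>
  The product is the limit of the partial products, because \<^const>\<open>prodinf\<close> does not
  cover products of positive factors that diverge to 0.
\<close>

definition block_measure ::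
  "(nat \<Rightarrow> 'a::{real_inner, complete_space}) \<Rightarrow> (nat \<Rightarrow> real) \<Rightarrow> (nat \<Rightarrow> real) \<Rightarrow> real" where
  "block_measure e a b = (if block e a b = {} then 0 else lim (\<lambda>n. \<Prod>j<n. b j - a j))"

definition block_ring :: "(nat \<Rightarrow> 'a::{real_inner, complete_space}) \<Rightarrow> 'a set set" where
  "block_ring e = ring_of_sets UNIV hull {block e a b | a b. abs_measurable e a b}"

text \<open>
  The membership in \<^const>\<open>extensional\<close> fixes the value outside the ring, so that the extension
  is unique as a total function.
\<close>

definition ring_measure :: "(nat \<Rightarrow> 'a::{real_inner, complete_space}) \<Rightarrow> 'a set \<Rightarrow> real" where
  "ring_measure e = (THE m. m \<in> extensional (block_ring e) \<and>
     (\<forall>A \<in> block_ring e. 0 \<le> m A) \<and>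
     (\<forall>A \<in> block_ring e. \<forall>B \<in> block_ring e. A \<inter> B = {} \<longrightarrow> m (A \<union> B) = m A + m B) \<and>
     (\<forall>A \<in> block_ring e. \<forall>v. m ((+) v ` A) = m A) \<and>
     (\<forall>a b. abs_measurable e a b \<longrightarrow> m (block e a b) = block_measure e a b))"

text \<open>
  Completion of a ring with a finitely additive measure: the sets whose inner and outer measures
  with respect to the ring are finite and agree.
\<close>

definition outer_lambda :: "(nat \<Rightarrow> 'a::{real_inner, complete_space}) \<Rightarrow> 'a set \<Rightarrow> real" where
  "outer_lambda e A = Inf (ring_measure e ` {C \<in> block_ring e. A \<subseteq> C})"

definition inner_lambda :: "(nat \<Rightarrow> 'a::{real_inner, complete_space}) \<Rightarrow> 'a set \<Rightarrow> real" where
  "inner_lambda e A = Sup (ring_measure e ` {B \<in> block_ring e. B \<subseteq> A})"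

definition complete_ring :: "(nat \<Rightarrow> 'a::{real_inner, complete_space}) \<Rightarrow> 'a set set" where
  "complete_ring e = {A. (\<exists>C \<in> block_ring e. A \<subseteq> C) \<and> inner_lambda e A = outer_lambda e A}"

definition lambda :: "(nat \<Rightarrow> 'a::{real_inner, complete_space}) \<Rightarrow> 'a set \<Rightarrow> real" where
  "lambda e A = outer_lambda e A"


section \<open>The Hilbert space\<close>

definition simple :: "(nat \<Rightarrow> 'a::{real_inner, complete_space}) \<Rightarrow> ('a \<Rightarrow> complex) set" where
  "simple e = {f. \<exists>(n::nat) c B. (\<forall>k<n. B k \<in> complete_ring e) \<and> disjoint_family_on B {..<n} \<and>
     f = (\<lambda>x. \<Sum>k<n. c k * indicator (B k) x)}"

text \<open>
  Seminorm and inner product of simple functions, computed from the representation by the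
  level sets of the nonzero values; other representations give the same numbers by finite
  additivity.
\<close>

definition simple_norm ::
  "(nat \<Rightarrow> 'a::{real_inner, complete_space}) \<Rightarrow> ('a \<Rightarrow> complex) \<Rightarrow> real" where
  "simple_norm e f = sqrt (\<Sum>c \<in> range f - {0}. (cmod c)\<^sup>2 * lambda e (f -` {c}))"

definition simple_inner ::
  "(nat \<Rightarrow> 'a::{real_inner, complete_space}) \<Rightarrow> ('a \<Rightarrow> complex) \<Rightarrow> ('a \<Rightarrow> complex) \<Rightarrow> complex" where
  "simple_inner e f g = (\<Sum>c \<in> range f - {0}. \<Sum>d \<in> range g - {0}.
     c * cnj d * of_real (lambda e (f -` {c} \<inter> g -` {d})))"

definition cauchy_simple ::
  "(nat \<Rightarrow> 'a::{real_inner, complete_space}) \<Rightarrow> (nat \<Rightarrow> 'a \<Rightarrow> complex) set" where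
  "cauchy_simple e = {s. (\<forall>n. s n \<in> simple e) \<and>
     (\<forall>\<epsilon>>0. \<exists>N. \<forall>m\<ge>N. \<forall>n\<ge>N. simple_norm e (\<lambda>x. s m x - s n x) < \<epsilon>)}"

definition null_rel ::
  "(nat \<Rightarrow> 'a::{real_inner, complete_space}) \<Rightarrow> (nat \<Rightarrow> 'a \<Rightarrow> complex) rel" where
  "null_rel e = {(s, r). s \<in> cauchy_simple e \<and> r \<in> cauchy_simple e \<and>
     (\<lambda>n. simple_norm e (\<lambda>x. s n x - r n x)) \<longlonglongrightarrow> 0}"

text \<open>
  The completion: Cauchy sequences of simple functions modulo sequences of seminorm tending
  to 0. Constant null sequences are identified with 0, so this also divides out the null space.
\<close>

definition HE ::
  "(nat \<Rightarrow> 'a::{real_inner, complete_space}) \<Rightarrow> (nat \<Rightarrow> 'a \<Rightarrow> complex) set set" where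
  "HE e = cauchy_simple e // null_rel e"

definition rep :: "(nat \<Rightarrow> 'a \<Rightarrow> complex) set \<Rightarrow> nat \<Rightarrow> 'a \<Rightarrow> complex" where
  "rep F = (SOME s. s \<in> F)"

definition h_add ::
  "(nat \<Rightarrow> 'a::{real_inner, complete_space}) \<Rightarrow> (nat \<Rightarrow> 'a \<Rightarrow> complex) set \<Rightarrow>
   (nat \<Rightarrow> 'a \<Rightarrow> complex) set \<Rightarrow> (nat \<Rightarrow> 'a \<Rightarrow> complex) set" where
  "h_add e F G = null_rel e `` {\<lambda>n x. rep F n x + rep G n x}"

definition h_scale ::
  "(nat \<Rightarrow> 'a::{real_inner, complete_space}) \<Rightarrow> complex \<Rightarrow>
   (nat \<Rightarrow> 'a \<Rightarrow> complex) set \<Rightarrow> (nat \<Rightarrow> 'a \<Rightarrow> complex) set" where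
  "h_scale e c F = null_rel e `` {\<lambda>n x. c * rep F n x}"

definition h_diff ::
  "(nat \<Rightarrow> 'a::{real_inner, complete_space}) \<Rightarrow> (nat \<Rightarrow> 'a \<Rightarrow> complex) set \<Rightarrow>
   (nat \<Rightarrow> 'a \<Rightarrow> complex) set \<Rightarrow> (nat \<Rightarrow> 'a \<Rightarrow> complex) set" where
  "h_diff e F G = h_add e F (h_scale e (- 1) G)"

definition h_norm ::
  "(nat \<Rightarrow> 'a::{real_inner, complete_space}) \<Rightarrow> (nat \<Rightarrow> 'a \<Rightarrow> complex) set \<Rightarrow> real" where
  "h_norm e F = lim (\<lambda>n. simple_norm e (rep F n))"

definition h_inner ::
  "(nat \<Rightarrow> 'a::{real_inner, complete_space}) \<Rightarrow> (nat \<Rightarrow> 'a \<Rightarrow> complex) set \<Rightarrow>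
   (nat \<Rightarrow> 'a \<Rightarrow> complex) set \<Rightarrow> complex" where
  "h_inner e F G = lim (\<lambda>n. simple_inner e (rep F n) (rep G n))"


section \<open>Multiplication operators and the operators S\<close>

text \<open>
  The product of a simple function with \<open>x \<mapsto> cis (h \<bullet> x)\<close> is in general not simple, so
  multiplication needs the upper seminorm of arbitrary functions (\<open>\<infinity>\<close> if there is no simple
  dominating function). The product of \<open>F\<close>, represented by simple functions \<open>s n\<close>, with the
  function \<open>u\<close> is the element represented by simple functions \<open>r n\<close> such that \<open>r n - u * s n\<close>
  tends to 0 in this seminorm.
\<close>

definition upper_norm ::
  "(nat \<Rightarrow> 'a::{real_inner, complete_space}) \<Rightarrow> ('a \<Rightarrow> complex) \<Rightarrow> ennreal" where
  "upper_norm e g =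
     (INF s \<in> {s \<in> simple e. \<forall>x. cmod (g x) \<le> cmod (s x)}. ennreal (simple_norm e s))"

definition mult_op ::
  "(nat \<Rightarrow> 'a::{real_inner, complete_space}) \<Rightarrow> ('a \<Rightarrow> complex) \<Rightarrow>
   (nat \<Rightarrow> 'a \<Rightarrow> complex) set \<Rightarrow> (nat \<Rightarrow> 'a \<Rightarrow> complex) set" where
  "mult_op e u F = (THE G. G \<in> HE e \<and>
     (\<exists>s \<in> F. \<exists>r \<in> G. (\<lambda>n. upper_norm e (\<lambda>x. r n x - u x * s n x)) \<longlonglongrightarrow> 0))"

definition S_fin ::
  "(nat \<Rightarrow> 'a::{real_inner, complete_space}) \<Rightarrow> 'a \<Rightarrow>
   (nat \<Rightarrow> 'a \<Rightarrow> complex) set \<Rightarrow> (nat \<Rightarrow> 'a \<Rightarrow> complex) set" where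
  "S_fin e h = mult_op e (\<lambda>x. exp (\<i> * of_real (h \<bullet> x)))"

text \<open>
  For \<open>h\<close> in the span of finitely many basis vectors the sequence below is eventually constant,
  so \<open>S_hat\<close> agrees with \<^const>\<open>S_fin\<close> there.
\<close>

definition S_hat ::
  "(nat \<Rightarrow> 'a::{real_inner, complete_space}) \<Rightarrow> 'a \<Rightarrow>
   (nat \<Rightarrow> 'a \<Rightarrow> complex) set \<Rightarrow> (nat \<Rightarrow> 'a \<Rightarrow> complex) set" where
  "S_hat e h F = (THE G. G \<in> HE e \<and>
     (\<lambda>n. h_norm e (h_diff e (S_fin e (proj e n h) F) G)) \<longlonglongrightarrow> 0)"


section \<open>Unitary, strongly continuous semigroups on the Hilbert space\<close>

definition h_unitary ::
  "(nat \<Rightarrow> 'a::{real_inner, complete_space}) \<Rightarrow>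
   ((nat \<Rightarrow> 'a \<Rightarrow> complex) set \<Rightarrow> (nat \<Rightarrow> 'a \<Rightarrow> complex) set) \<Rightarrow> bool" where
  "h_unitary e U \<longleftrightarrow>
     bij_betw U (HE e) (HE e) \<and>
     (\<forall>F \<in> HE e. \<forall>G \<in> HE e. U (h_add e F G) = h_add e (U F) (U G)) \<and>
     (\<forall>c. \<forall>F \<in> HE e. U (h_scale e c F) = h_scale e c (U F)) \<and>
     (\<forall>F \<in> HE e. \<forall>G \<in> HE e. h_inner e (U F) (U G) = h_inner e F G)"

definition unitary_semigroup ::
  "(nat \<Rightarrow> 'a::{real_inner, complete_space}) \<Rightarrow>
   (real \<Rightarrow> (nat \<Rightarrow> 'a \<Rightarrow> complex) set \<Rightarrow> (nat \<Rightarrow> 'a \<Rightarrow> complex) set) \<Rightarrow> bool" where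
  "unitary_semigroup e U \<longleftrightarrow>
     (\<forall>t\<ge>0. h_unitary e (U t)) \<and>
     (\<forall>F \<in> HE e. U 0 F = F) \<and>
     (\<forall>s\<ge>0. \<forall>t\<ge>0. \<forall>F \<in> HE e. U (s + t) F = U s (U t F))"

definition strongly_continuous ::
  "(nat \<Rightarrow> 'a::{real_inner, complete_space}) \<Rightarrow>
   (real \<Rightarrow> (nat \<Rightarrow> 'a \<Rightarrow> complex) set \<Rightarrow> (nat \<Rightarrow> 'a \<Rightarrow> complex) set) \<Rightarrow> bool" where
  "strongly_continuous e U \<longleftrightarrow>
     (\<forall>F \<in> HE e. \<forall>t\<ge>0. ((\<lambda>s. h_norm e (h_diff e (U s F) (U t F))) \<longlongrightarrow> 0) (at t within {0..}))"

end

theory Submission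
  imports Defs
begin

text \<open>
  A nonempty absolutely measurable block of positive measure has side lengths \<open>1 + r\<^sub>j\<close> with
  \<open>r\<close> absolutely summable. Call two such blocks equivalent if their corners differ by an absolutely
  summable sequence. The blocks of one class have a common tail in \<open>E\<close>, while the overlap of
  inequivalent blocks has product \<open>0\<close>. So if a combination of indicators of blocks is nonnegative on
  \<open>E\<close>, integrating the first \<open>M\<close> coordinates over the hull of one class, with the others frozen at
  the common tail, and letting \<open>M \<rightarrow> \<infinity>\<close> shows that the corresponding combination of
  measures over that class is nonnegative. Summing over the classes gives a positive functional,
  hence the finitely additive measure on the ring.

  For \<open>h\<close> with absolutely summable coordinates, \<open>(h, x)\<close> is a uniform limit of finite sums
  on sets with uniformly bounded coordinates, and each coordinate is uniformly close to a step
  function there. As every simple function lives on such a set, its product with \<open>cis (h, x)\<close>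
  is approximated by simple functions, with an error controlled by \<open>\<Sum>\<^sub>k \<bar>(h, e\<^sub>k)\<bar>\<close>. All the
  assertions follow from this estimate and from \<open>\<bar>cis (h, x)\<bar> = 1\<close>.
\<close>

section \<open>Finitely additive measures on rings of sets\<close>

text \<open>The definite description in \<open>ring_measure\<close> says nothing until existence and
  uniqueness of the extension are established. The obstacle to existence is that one set of the ring
  can be cut into blocks in many ways, while there is neither countable additivity nor a product
  measure on \<open>E\<close> to fall back on. Positivity removes it: applied in both directions to
  the zero function, it makes the value independent of the cutting. Inequivalent blocks of positive
  measure need not share any tail in \<open>E\<close>, so no single frozen point can see all blocks
  at once; this is why each class needs a limit of its own.

  On the operator side, a character times a simple function is usually not simple. Products are
  therefore handled as relations between representing sequences, up to errors dominated by simple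
  functions of small seminorm. Multipliers of modulus 1 preserve such dominations, which is all that
  well-definedness, composition and isometry require.\<close>

locale fin_add = ring_of_sets UNIV R for R :: "'a set set" +
  fixes m :: "'a set \<Rightarrow> real"
  assumes m_nonneg: "A \<in> R \<Longrightarrow> 0 \<le> m A"
    and m_Un: "A \<in> R \<Longrightarrow> B \<in> R \<Longrightarrow> A \<inter> B = {} \<Longrightarrow> m (A \<union> B) = m A + m B"
begin

lemma m_empty: "m {} = 0"
  using m_Un[of "{}" "{}"] by simp

lemma m_Diff:
  assumes "A \<in> R" "B \<in> R" "B \<subseteq> A"
  shows "m (A - B) = m A - m B"
proof -
  have "(A - B) \<inter> B = {}" "(A - B) \<union> B = A" using assms by auto
  then show ?thesis using m_Un[OF Diff[OF assms(1,2)] assms(2)] by simp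
qed

lemma m_mono: "A \<in> R \<Longrightarrow> B \<in> R \<Longrightarrow> A \<subseteq> B \<Longrightarrow> m A \<le> m B"
  using m_Diff[of B A] m_nonneg[of "B - A"] by auto

lemma m_subadd:
  assumes "A \<in> R" "B \<in> R"
  shows "m (A \<union> B) \<le> m A + m B"
proof -
  have "m (A \<union> B) = m (A \<union> (B - A))" by (simp add: Un_Diff_cancel)
  also have "\<dots> = m A + m (B - A)" using assms by (intro m_Un) auto
  also have "\<dots> \<le> m A + m B" using assms m_mono[of "B - A" B] by auto
  finally show ?thesis .
qed

lemma m_UN:
  assumes "finite I" "disjoint_family_on A I" "\<And>i. i \<in> I \<Longrightarrow> A i \<in> R"
  shows "m (\<Union>i\<in>I. A i) = (\<Sum>i\<in>I. m (A i))"
  using assms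
proof (induction I)
  case empty
  then show ?case by (simp add: m_empty)
next
  case (insert i I)
  have "m (A i \<union> (\<Union>i\<in>I. A i)) = m (A i) + m (\<Union>i\<in>I. A i)"
    using insert by (intro m_Un finite_UN) (auto simp: disjoint_family_on_def)
  moreover have "disjoint_family_on A I"
    using insert.prems(1) by (auto simp: disjoint_family_on_def)
  ultimately show ?case using insert by simp
qed

subsection \<open>Integration of simple functions\<close>

text \<open>A ring need not contain the whole space, so the level set of 0, the complement of the
  support, cannot be required to lie in \<open>R\<close>. Values range over an arbitrary real vector
  space in order that a pair of simple functions is again a simple function.\<close>

definition smp :: "('a \<Rightarrow> 'b::real_vector) \<Rightarrow> bool" where
  "smp f \<longleftrightarrow> finite (range f) \<and> (\<forall>c. c \<noteq> 0 \<longrightarrow> f -` {c} \<in> R)"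

definition intg :: "('a \<Rightarrow> 'b::real_vector) \<Rightarrow> 'b" where
  "intg f = (\<Sum>c \<in> range f - {0}. m (f -` {c}) *\<^sub>R c)"

lemma smp_support: "smp f \<Longrightarrow> {x. f x \<noteq> 0} \<in> R"
proof -
  assume f: "smp f"
  have "{x. f x \<noteq> 0} = (\<Union>c\<in>range f - {0}. f -` {c})" by auto
  also have "\<dots> \<in> R" using f by (intro finite_UN) (auto simp: smp_def)
  finally show ?thesis .
qed

lemma vimage_comp_eq_UN:
  "(\<lambda>x. \<phi> (h x)) -` {d} = (\<Union>c\<in>{c \<in> range h. \<phi> c = d}. h -` {c})"
  by auto

lemma smp_comp:
  fixes h :: "'a \<Rightarrow> 'b::real_vector" and \<phi> :: "'b \<Rightarrow> 'c::real_vector"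
  assumes "smp h" "\<phi> 0 = 0"
  shows "smp (\<lambda>x. \<phi> (h x))"
  unfolding smp_def
proof (intro conjI allI impI)
  have "range (\<lambda>x. \<phi> (h x)) = \<phi> ` range h" by auto
  then show "finite (range (\<lambda>x. \<phi> (h x)))" using assms by (simp add: smp_def)
  fix d :: 'c assume "d \<noteq> 0"
  then show "(\<lambda>x. \<phi> (h x)) -` {d} \<in> R"
    unfolding vimage_comp_eq_UN using assms
    by (intro finite_UN) (auto simp: smp_def, metis)
qed

text \<open>The level sets of \<open>h\<close> refine those of the composite, so finite additivity
  lets the sum be regrouped along \<open>\<phi>\<close>. Every later change of representation of an
  integral goes through this identity.\<close>

lemma intg_comp:
  fixes h :: "'a \<Rightarrow> 'b::real_vector" and \<phi> :: "'b \<Rightarrow> 'c::real_vector"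
  assumes "smp h" "\<phi> 0 = 0"
  shows "intg (\<lambda>x. \<phi> (h x)) = (\<Sum>c \<in> range h - {0}. m (h -` {c}) *\<^sub>R \<phi> c)"
proof -
  define S where "S = {c \<in> range h. \<phi> c \<noteq> 0}"
  have fin: "finite S" "finite (range h)" using assms by (auto simp: smp_def S_def)
  have S0: "c \<in> S \<Longrightarrow> c \<noteq> 0" for c using assms by (auto simp: S_def)
  have "intg (\<lambda>x. \<phi> (h x))
      = (\<Sum>d \<in> range (\<lambda>x. \<phi> (h x)) - {0}. \<Sum>c\<in>{c \<in> S. \<phi> c = d}. m (h -` {c}) *\<^sub>R \<phi> c)"
    unfolding intg_def
  proof (rule sum.cong[OF refl])
    fix d assume d: "d \<in> range (\<lambda>x. \<phi> (h x)) - {0}"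
    then have eq: "{c \<in> range h. \<phi> c = d} = {c \<in> S. \<phi> c = d}" by (auto simp: S_def)
    have "m ((\<lambda>x. \<phi> (h x)) -` {d}) = (\<Sum>c\<in>{c \<in> S. \<phi> c = d}. m (h -` {c}))"
      unfolding vimage_comp_eq_UN eq
      using assms fin S0 by (intro m_UN) (auto simp: disjoint_family_on_def smp_def)
    then show "m ((\<lambda>x. \<phi> (h x)) -` {d}) *\<^sub>R d = (\<Sum>c\<in>{c \<in> S. \<phi> c = d}. m (h -` {c}) *\<^sub>R \<phi> c)"
      by (simp add: scaleR_sum_left)
  qed
  also have "\<dots> = (\<Sum>c\<in>S. m (h -` {c}) *\<^sub>R \<phi> c)"
  proof (rule sum.group)
    show "finite (range (\<lambda>x. \<phi> (h x)) - {0})"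
      using smp_comp[of h \<phi>] assms by (auto simp: smp_def)
  qed (use fin in \<open>auto simp: S_def\<close>)
  also have "\<dots> = (\<Sum>c \<in> range h - {0}. m (h -` {c}) *\<^sub>R \<phi> c)"
    using fin S0 by (intro sum.mono_neutral_left) (auto simp: S_def)
  finally show ?thesis .
qed

lemma smp_Pair:
  fixes f :: "'a \<Rightarrow> 'b::real_vector" and g :: "'a \<Rightarrow> 'c::real_vector"
  assumes f: "smp f" and g: "smp g"
  shows "smp (\<lambda>x. (f x, g x))"
  unfolding smp_def
proof (intro conjI allI impI)
  have "range (\<lambda>x. (f x, g x)) \<subseteq> range f \<times> range g" by auto
  then show "finite (range (\<lambda>x. (f x, g x)))"
    using f g by (meson finite_SigmaI finite_subset smp_def)
  fix z :: "'b \<times> 'c" assume z: "z \<noteq> 0"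
  obtain c d where [simp]: "z = (c, d)" by fastforce
  consider "c \<noteq> 0" "d \<noteq> 0" | "c = 0" "d \<noteq> 0" | "c \<noteq> 0" "d = 0"
    using z by (auto simp: zero_prod_def)
  then show "(\<lambda>x. (f x, g x)) -` {z} \<in> R"
  proof cases
    case 1
    have "(\<lambda>x. (f x, g x)) -` {z} = f -` {c} \<inter> g -` {d}" by auto
    then show ?thesis using f g 1 by (auto simp: smp_def)
  next
    case 2
    have "(\<lambda>x. (f x, g x)) -` {z} = g -` {d} - {x. f x \<noteq> 0}" using 2 by auto
    then show ?thesis using smp_support[OF f] g 2 by (auto simp: smp_def)
  next
    case 3
    have "(\<lambda>x. (f x, g x)) -` {z} = f -` {c} - {x. g x \<noteq> 0}" using 3 by auto
    then show ?thesis using smp_support[OF g] f 3 by (auto simp: smp_def)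
  qed
qed

lemma smp_comp2:
  assumes "smp f" "smp g" "\<phi> 0 0 = 0"
  shows "smp (\<lambda>x. \<phi> (f x) (g x))"
  using smp_comp[OF smp_Pair[OF assms(1,2)], of "\<lambda>z. \<phi> (fst z) (snd z)"] assms(3) by simp

lemma smp_zero: "smp (\<lambda>x. 0)"
  by (simp add: smp_def)

lemma smp_add: "smp f \<Longrightarrow> smp g \<Longrightarrow> smp (\<lambda>x. f x + g x)"
  by (rule smp_comp2) auto

lemma smp_sum: "finite I \<Longrightarrow> (\<And>i. i \<in> I \<Longrightarrow> smp (f i)) \<Longrightarrow> smp (\<lambda>x. \<Sum>i\<in>I. f i x)"
  by (induction I rule: finite_induct) (auto intro: smp_zero smp_add)

lemma intg_add:
  fixes f g :: "'a \<Rightarrow> 'b::real_vector"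
  assumes "smp f" "smp g"
  shows "intg (\<lambda>x. f x + g x) = intg f + intg g"
proof -
  note h = smp_Pair[OF assms]
  show ?thesis
    using intg_comp[OF h, of "\<lambda>z. fst z + snd z"] intg_comp[OF h, of fst] intg_comp[OF h, of snd]
    by (simp add: scaleR_add_right sum.distrib)
qed

lemma intg_linear:
  fixes f :: "'a \<Rightarrow> 'b::real_vector" and \<phi> :: "'b \<Rightarrow> 'c::real_vector"
  assumes "smp f" "linear \<phi>"
  shows "intg (\<lambda>x. \<phi> (f x)) = \<phi> (intg f)"
  using assms intg_comp[of f \<phi>]
  by (simp add: intg_def linear_0 linear_sum linear_cmul)

lemma intg_nonneg:
  fixes f :: "'a \<Rightarrow> real"
  assumes "smp f" "\<And>x. 0 \<le> f x"
  shows "0 \<le> intg f"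
  using assms unfolding intg_def smp_def
  by (intro sum_nonneg) (auto intro!: mult_nonneg_nonneg m_nonneg)

lemma intg_mono:
  fixes f g :: "'a \<Rightarrow> real"
  assumes f: "smp f" and g: "smp g" and "\<And>x. f x \<le> g x"
  shows "intg f \<le> intg g"
proof -
  have d: "smp (\<lambda>x. g x - f x)" using smp_comp2[OF g f, of "(-)"] by simp
  have "0 \<le> intg (\<lambda>x. g x - f x)" using d assms(3) by (intro intg_nonneg) auto
  then show ?thesis using intg_add[OF f d] by simp
qed

lemma smp_indicator: "A \<in> R \<Longrightarrow> smp (\<lambda>x. indicator A x *\<^sub>R c)"
  unfolding smp_def
proof (intro conjI allI impI)
  assume A: "A \<in> R"
  show "finite (range (\<lambda>x. indicat_real A x *\<^sub>R c))"
    by (rule finite_subset[of _ "{0, c}"]) (auto simp: indicator_def)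
  fix d :: 'b assume "d \<noteq> 0"
  then have "(\<lambda>x. indicat_real A x *\<^sub>R c) -` {d} = (if d = c then A else {})"
    by (auto simp: indicator_def of_bool_def split: if_splits)
  then show "(\<lambda>x. indicat_real A x *\<^sub>R c) -` {d} \<in> R" using A by simp
qed

lemma smp_indicat_real: "A \<in> R \<Longrightarrow> smp (indicat_real A)"
  using smp_indicator[of A "1::real"] by simp

lemma intg_indicat_real:
  assumes "A \<in> R"
  shows "intg (indicat_real A) = m A"
proof (cases "A = {}")
  case True
  then have "range (indicat_real A) - {0} = {}" by auto
  then show ?thesis unfolding intg_def using True by (simp add: m_empty)
next
  case False
  then have "range (indicat_real A) - {0} = {1}" by (auto simp: indicator_def split: if_splits)
  moreover have "indicat_real A -` {1} = A" by (auto simp: indicator_def split: if_splits)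
  ultimately show ?thesis unfolding intg_def by simp
qed

section \<open>Seminorm and inner product of simple functions\<close>

definition nrm :: "('a \<Rightarrow> complex) \<Rightarrow> real" where
  "nrm f = sqrt (\<Sum>c \<in> range f - {0}. (cmod c)\<^sup>2 * m (f -` {c}))"

definition inn :: "('a \<Rightarrow> complex) \<Rightarrow> ('a \<Rightarrow> complex) \<Rightarrow> complex" where
  "inn f g = (\<Sum>c \<in> range f - {0}. \<Sum>d \<in> range g - {0}.
     c * cnj d * of_real (m (f -` {c} \<inter> g -` {d})))"

lemma smp_cmod2: "smp f \<Longrightarrow> smp (\<lambda>x. (cmod (f x))\<^sup>2)"
  by (rule smp_comp) auto

lemma nrm_eq: "smp f \<Longrightarrow> nrm f = sqrt (intg (\<lambda>x. (cmod (f x))\<^sup>2))"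
  unfolding nrm_def by (subst intg_comp) (auto simp: mult.commute)

lemma nrm_nonneg: "smp f \<Longrightarrow> 0 \<le> nrm f"
  by (simp add: nrm_eq intg_nonneg smp_cmod2)

lemma nrm_power2: "smp f \<Longrightarrow> (nrm f)\<^sup>2 = intg (\<lambda>x. (cmod (f x))\<^sup>2)"
  by (simp add: nrm_eq intg_nonneg smp_cmod2)

lemma nrm_mono:
  assumes "smp f" "smp g" "\<And>x. cmod (f x) \<le> cmod (g x)"
  shows "nrm f \<le> nrm g"
  using assms by (simp add: nrm_eq intg_mono smp_cmod2)

lemma nrm_zero: "nrm (\<lambda>x. 0) = 0"
  by (simp add: nrm_def)

lemma smp_mult_left: "smp f \<Longrightarrow> smp (\<lambda>x. (c::complex) * f x)"
  by (rule smp_comp) auto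

lemma nrm_mult_left:
  assumes "smp f"
  shows "nrm (\<lambda>x. c * f x) = cmod c * nrm f"
proof -
  have "intg (\<lambda>x. (cmod (c * f x))\<^sup>2) = (cmod c)\<^sup>2 * intg (\<lambda>x. (cmod (f x))\<^sup>2)"
    using intg_linear[OF smp_cmod2[OF assms], of "\<lambda>x. (cmod c)\<^sup>2 * x"]
    by (simp add: norm_mult power_mult_distrib)
  then show ?thesis using assms by (simp add: nrm_eq smp_mult_left real_sqrt_mult)
qed

text \<open>
  Minkowski's inequality: for \<open>0 < a\<close>, \<open>0 < b\<close> one has
  \<open>(u + v)\<^sup>2 \<le> (a + b) / a * u\<^sup>2 + (a + b) / b * v\<^sup>2\<close>; take \<open>a\<close> and \<open>b\<close> slightly above the two norms.
\<close>

lemma nrm_triangle: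
  assumes f: "smp f" and g: "smp g"
  shows "nrm (\<lambda>x. f x + g x) \<le> nrm f + nrm g"
proof (rule field_le_epsilon)
  fix \<epsilon> :: real assume "0 < \<epsilon>"
  define a b where "a = nrm f + \<epsilon> / 2" and "b = nrm g + \<epsilon> / 2"
  have ab: "0 < a" "0 < b" "nrm f \<le> a" "nrm g \<le> b"
    using \<open>0 < \<epsilon>\<close> nrm_nonneg[OF f] nrm_nonneg[OF g] by (auto simp: a_def b_def)
  note f2 = smp_cmod2[OF f] and g2 = smp_cmod2[OF g]
  have af: "smp (\<lambda>x. (a + b) / a * (cmod (f x))\<^sup>2)" and bg: "smp (\<lambda>x. (a + b) / b * (cmod (g x))\<^sup>2)"
    by (auto intro!: smp_comp[OF f2] smp_comp[OF g2])
  have young: "(cmod (z + w))\<^sup>2 \<le> (a + b) / a * (cmod z)\<^sup>2 + (a + b) / b * (cmod w)\<^sup>2" for z w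
  proof -
    have "(cmod (z + w))\<^sup>2 \<le> (cmod z + cmod w)\<^sup>2"
      by (intro power_mono norm_triangle_ineq) auto
    also have "\<dots> \<le> (a + b) / a * (cmod z)\<^sup>2 + (a + b) / b * (cmod w)\<^sup>2"
    proof -
      have "(a + b) / a * (cmod z)\<^sup>2 + (a + b) / b * (cmod w)\<^sup>2 - (cmod z + cmod w)\<^sup>2
        = (b * cmod z - a * cmod w)\<^sup>2 / (a * b)"
        using ab by (simp add: field_simps power2_eq_square)
      also have "\<dots> \<ge> 0" using ab by simp
      finally show ?thesis by linarith
    qed
    finally show ?thesis .
  qed
  have "(nrm (\<lambda>x. f x + g x))\<^sup>2 = intg (\<lambda>x. (cmod (f x + g x))\<^sup>2)"
    using f g by (simp add: nrm_power2 smp_add)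
  also have "\<dots> \<le> intg (\<lambda>x. (a + b) / a * (cmod (f x))\<^sup>2 + (a + b) / b * (cmod (g x))\<^sup>2)"
    using f g af bg young by (intro intg_mono smp_cmod2 smp_add)
  also have "\<dots> = (a + b) / a * (nrm f)\<^sup>2 + (a + b) / b * (nrm g)\<^sup>2"
    using intg_add[OF af bg] intg_linear[OF f2 linear_times, of "(a + b) / a"]
      intg_linear[OF g2 linear_times, of "(a + b) / b"] f g
    by (simp only: nrm_power2)
  also have "\<dots> \<le> (a + b) / a * a\<^sup>2 + (a + b) / b * b\<^sup>2"
    using ab nrm_nonneg[OF f] nrm_nonneg[OF g] by (intro add_mono mult_left_mono power_mono) auto
  also have "\<dots> = (a + b)\<^sup>2" using ab by (simp add: field_simps power2_eq_square)
  finally have "nrm (\<lambda>x. f x + g x) \<le> a + b" using ab by (auto intro: power2_le_imp_le)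
  then show "nrm (\<lambda>x. f x + g x) \<le> nrm f + nrm g + \<epsilon>" by (simp add: a_def b_def)
qed

lemma smp_mult_cnj: "smp f \<Longrightarrow> smp g \<Longrightarrow> smp (\<lambda>x. f x * cnj (g x))"
  by (rule smp_comp2) auto

lemma inn_eq:
  assumes f: "smp f" and g: "smp g"
  shows "inn f g = intg (\<lambda>x. f x * cnj (g x))"
proof -
  let ?h = "\<lambda>x. (f x, g x)"
  have fin: "finite (range f)" "finite (range g)" "finite (range ?h)"
    using f g smp_Pair[OF f g] by (auto simp: smp_def)
  have lev: "?h -` {(c, d)} = f -` {c} \<inter> g -` {d}" for c d by auto
  have "inn f g = (\<Sum>z\<in>(range f - {0}) \<times> (range g - {0}).
      m (?h -` {z}) *\<^sub>R (fst z * cnj (snd z)))"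
    unfolding inn_def sum.cartesian_product
    by (intro sum.cong refl) (auto simp: scaleR_conv_of_real lev)
  \<comment> \<open>Neither index set contains the other, so the sums are compared through the
    union. Pairs with a zero component contribute a zero product; pairs that are never attained have
    an empty level set.\<close>
  also have "\<dots> = (\<Sum>z\<in>(range f - {0}) \<times> (range g - {0}) \<union> (range ?h - {0}).
      m (?h -` {z}) *\<^sub>R (fst z * cnj (snd z)))"
    using fin by (intro sum.mono_neutral_left) (auto simp: zero_prod_def)
  also have "\<dots> = (\<Sum>z\<in>range ?h - {0}. m (?h -` {z}) *\<^sub>R (fst z * cnj (snd z)))"
  proof (intro sum.mono_neutral_right ballI)
    fix z assume z: "z \<in> (range f - {0}) \<times> (range g - {0}) \<union> (range ?h - {0}) - (range ?h - {0})"
    then have "z \<notin> range ?h" by (auto simp: zero_prod_def)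
    then have "?h -` {z} = {}" by auto
    then show "m (?h -` {z}) *\<^sub>R (fst z * cnj (snd z)) = 0" by (simp add: m_empty)
  qed (use fin in \<open>auto simp: zero_prod_def\<close>)
  also have "\<dots> = intg (\<lambda>x. f x * cnj (g x))"
    using intg_comp[OF smp_Pair[OF f g], of "\<lambda>z. fst z * cnj (snd z)"] by simp
  finally show ?thesis .
qed

text \<open>Inner products are determined by four seminorms, so convergence of
  \<open>h_inner\<close> and its invariance under unimodular multipliers reduce to statements about
  \<open>nrm\<close>.\<close>

lemma inn_polarization:
  assumes f: "smp f" and g: "smp g"
  shows "4 * inn f g = of_real ((nrm (\<lambda>x. f x + g x))\<^sup>2) - of_real ((nrm (\<lambda>x. f x + (- 1) * g x))\<^sup>2)
    + \<i> * of_real ((nrm (\<lambda>x. f x + \<i> * g x))\<^sup>2) - \<i> * of_real ((nrm (\<lambda>x. f x + (- \<i>) * g x))\<^sup>2)"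
proof -
  have sq: "(of_real ((nrm (\<lambda>x. f x + c * g x))\<^sup>2) :: complex)
     = intg (\<lambda>x. (of_real ((cmod (f x + c * g x))\<^sup>2) :: complex))" for c
    using f g smp_add[OF f smp_mult_left[OF g, of c]]
      intg_linear[of "\<lambda>x. (cmod (f x + c * g x))\<^sup>2" "of_real :: real \<Rightarrow> complex"]
    by (simp add: nrm_power2 smp_cmod2 linear_iff scaleR_conv_of_real)
  have S: "smp (\<lambda>x. (of_real ((cmod (f x + c * g x))\<^sup>2) :: complex))" for c
    by (rule smp_comp2[OF f g]) auto
  have lin: "c * intg (\<lambda>x. (of_real ((cmod (f x + d * g x))\<^sup>2) :: complex))
     = intg (\<lambda>x. c * of_real ((cmod (f x + d * g x))\<^sup>2))"
     and S': "smp (\<lambda>x. c * of_real ((cmod (f x + d * g x))\<^sup>2))" for c d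
    using intg_linear[OF S, of "\<lambda>x. c * x" d] smp_mult_left[OF S, of c d]
    by (auto simp: linear_times)
  have pol: "4 * (z * cnj w) = 1 * of_real ((cmod (z + 1 * w))\<^sup>2) + (- 1) * of_real ((cmod (z + (- 1) * w))\<^sup>2)
    + \<i> * of_real ((cmod (z + \<i> * w))\<^sup>2) + (- \<i>) * of_real ((cmod (z + (- \<i>) * w))\<^sup>2)" for z w
    unfolding complex_norm_square by (simp add: algebra_simps)
  have "4 * inn f g = intg (\<lambda>x. 4 * (f x * cnj (g x)))"
    using intg_linear[OF smp_mult_cnj[OF f g], of "\<lambda>x. 4 * x"] inn_eq[OF f g]
    by (simp add: linear_times)
  also have "\<dots> = 1 * intg (\<lambda>x. (of_real ((cmod (f x + 1 * g x))\<^sup>2) :: complex))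
      + (- 1) * intg (\<lambda>x. (of_real ((cmod (f x + (- 1) * g x))\<^sup>2) :: complex))
      + \<i> * intg (\<lambda>x. (of_real ((cmod (f x + \<i> * g x))\<^sup>2) :: complex))
      + (- \<i>) * intg (\<lambda>x. (of_real ((cmod (f x + (- \<i>) * g x))\<^sup>2) :: complex))"
    unfolding pol lin by (simp only: intg_add smp_add S')
  finally show ?thesis unfolding sq[symmetric] by simp
qed

text \<open>\<open>H\<close> acts on the ring by intersection instead of belonging to it. The
  intended case is a strip in one coordinate, which is unbounded in all other coordinates and hence
  in general outside the ring.\<close>

lemma smp_restrict:
  assumes f: "smp f" and H: "\<And>A. A \<in> R \<Longrightarrow> A \<inter> H \<in> R"
  shows "smp (\<lambda>x. of_bool (x \<in> H) * (f x :: complex))"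
  unfolding smp_def
proof (intro conjI allI impI)
  have "range (\<lambda>x. of_bool (x \<in> H) * f x) \<subseteq> insert 0 (range f)" by auto
  then show "finite (range (\<lambda>x. of_bool (x \<in> H) * f x))"
    by (rule finite_subset) (use f in \<open>simp add: smp_def\<close>)
  fix c :: complex assume "c \<noteq> 0"
  then have "(\<lambda>x. of_bool (x \<in> H) * f x) -` {c} = f -` {c} \<inter> H" by auto
  then show "(\<lambda>x. of_bool (x \<in> H) * f x) -` {c} \<in> R"
    using f H \<open>c \<noteq> 0\<close> by (simp add: smp_def)
qed

lemma smp_diff: "smp f \<Longrightarrow> smp g \<Longrightarrow> smp (\<lambda>x. f x - g x)"
  by (rule smp_comp2) auto

lemma nrm_minus_commute: "smp f \<Longrightarrow> smp g \<Longrightarrow> nrm (\<lambda>x. f x - g x) = nrm (\<lambda>x. g x - f x)"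
  by (intro antisym nrm_mono smp_diff) (simp_all add: norm_minus_commute)

lemma nrm_triangle_diff:
  assumes "smp f" "smp g" "smp h"
  shows "nrm (\<lambda>x. f x - h x) \<le> nrm (\<lambda>x. f x - g x) + nrm (\<lambda>x. g x - h x)"
  using nrm_triangle[OF smp_diff[OF assms(1,2)] smp_diff[OF assms(2,3)]] by simp

lemma nrm_diff_le:
  assumes "smp f" "smp g"
  shows "\<bar>nrm f - nrm g\<bar> \<le> nrm (\<lambda>x. f x - g x)"
  using nrm_triangle[OF smp_diff[OF assms] assms(2)] nrm_triangle[OF smp_diff[OF assms(2,1)] assms(1)]
    nrm_minus_commute[OF assms] by simp

text \<open>Passing to moduli excludes cancellation and leaves the seminorm unchanged. This is how
  several pointwise error bounds are merged into one dominating simple function.\<close>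

lemma majorant_add:
  assumes "smp f" "smp g"
  obtains q where "smp q" "\<And>x. cmod (q x) = cmod (f x) + cmod (g x)" "nrm q \<le> nrm f + nrm g"
proof -
  let ?a = "\<lambda>f x. complex_of_real (cmod (f x))"
  have a: "smp (?a f)" if "smp f" for f :: "'a \<Rightarrow> complex" using that by (rule smp_comp) simp
  have na: "nrm (?a f) = nrm f" if "smp f" for f :: "'a \<Rightarrow> complex"
    using that a by (intro antisym nrm_mono) auto
  show ?thesis
  proof (rule that)
    show "smp (\<lambda>x. ?a f x + ?a g x)" by (intro smp_add a assms)
    show "cmod (?a f x + ?a g x) = cmod (f x) + cmod (g x)" for x
      by (simp flip: of_real_add)
    show "nrm (\<lambda>x. ?a f x + ?a g x) \<le> nrm f + nrm g"
      using nrm_triangle[OF a[OF assms(1)] a[OF assms(2)]] na assms by simp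
  qed
qed

subsection \<open>Completion\<close>

definition outer :: "'a set \<Rightarrow> real" where
  "outer A = Inf (m ` {C \<in> R. A \<subseteq> C})"

definition inner_m :: "'a set \<Rightarrow> real" where
  "inner_m A = Sup (m ` {B \<in> R. B \<subseteq> A})"

definition completion :: "'a set set" where
  "completion = {A. (\<exists>C \<in> R. A \<subseteq> C) \<and> inner_m A = outer A}"

lemma outer_le: "C \<in> R \<Longrightarrow> A \<subseteq> C \<Longrightarrow> outer A \<le> m C"
  unfolding outer_def by (rule cInf_lower) (auto intro!: bdd_belowI[of _ 0] m_nonneg)

lemma le_inner:
  assumes "B \<in> R" "B \<subseteq> A" "C \<in> R" "A \<subseteq> C"
  shows "m B \<le> inner_m A"
  unfolding inner_m_def
  using assms by (intro cSup_upper bdd_aboveI[of _ "m C"]) (auto intro: m_mono)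

lemma outer_ge:
  assumes "B \<in> R" "B \<subseteq> A" "C \<in> R" "A \<subseteq> C"
  shows "m B \<le> outer A"
  unfolding outer_def
  using assms by (intro cInf_greatest) (auto intro: m_mono)

text \<open>A covering set in the ring bounds all measures involved, so \<open>Sup\<close> and
  \<open>Inf\<close> are genuine extrema and can be approached from inside and outside. From here on
  the completion is used only through this sandwich.\<close>

lemma completion_iff:
  "A \<in> completion \<longleftrightarrow> (\<forall>\<epsilon>>0. \<exists>B\<in>R. \<exists>C\<in>R. B \<subseteq> A \<and> A \<subseteq> C \<and> m C - m B < \<epsilon>)"
proof
  assume A: "A \<in> completion"
  then obtain C0 where C0: "C0 \<in> R" "A \<subseteq> C0" by (auto simp: completion_def)
  show "\<forall>\<epsilon>>0. \<exists>B\<in>R. \<exists>C\<in>R. B \<subseteq> A \<and> A \<subseteq> C \<and> m C - m B < \<epsilon>"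
  proof (intro allI impI)
    fix \<epsilon> :: real assume "0 < \<epsilon>"
    have "outer A < outer A + \<epsilon> / 2" using \<open>0 < \<epsilon>\<close> by simp
    then obtain C where C: "C \<in> R" "A \<subseteq> C" "m C < outer A + \<epsilon> / 2"
      unfolding outer_def using C0
      by (subst (asm) cInf_less_iff) (auto intro!: bdd_belowI[of _ 0] m_nonneg)
    have "inner_m A - \<epsilon> / 2 < inner_m A" using \<open>0 < \<epsilon>\<close> by simp
    then obtain B where B: "B \<in> R" "B \<subseteq> A" "inner_m A - \<epsilon> / 2 < m B"
      unfolding inner_m_def using C0
      by (subst (asm) less_cSup_iff) (auto intro!: bdd_aboveI[of _ "m C0"] m_mono)
    have "m C - m B < \<epsilon>" using A B C by (auto simp: completion_def)
    then show "\<exists>B\<in>R. \<exists>C\<in>R. B \<subseteq> A \<and> A \<subseteq> C \<and> m C - m B < \<epsilon>" using B C by blast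
  qed
next
  assume *: "\<forall>\<epsilon>>0. \<exists>B\<in>R. \<exists>C\<in>R. B \<subseteq> A \<and> A \<subseteq> C \<and> m C - m B < \<epsilon>"
  obtain C0 where C0: "C0 \<in> R" "A \<subseteq> C0" using *[rule_format, OF zero_less_one] by blast
  have "outer A \<le> inner_m A"
  proof (rule field_le_epsilon)
    fix \<epsilon> :: real assume "0 < \<epsilon>"
    obtain B C where "B \<in> R" "C \<in> R" "B \<subseteq> A" "A \<subseteq> C" "m C - m B < \<epsilon>"
      using *[rule_format, OF \<open>0 < \<epsilon>\<close>] by blast
    then show "outer A \<le> inner_m A + \<epsilon>" using outer_le[of C A] le_inner[of B A C] by linarith
  qed
  moreover have "inner_m A \<le> outer A"
    unfolding inner_m_def using C0 by (intro cSup_least) (auto intro: outer_ge)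
  ultimately show "A \<in> completion" using C0 by (auto simp: completion_def)
qed

lemma completionD:
  assumes "A \<in> completion" "0 < \<epsilon>"
  obtains B C where "B \<in> R" "C \<in> R" "B \<subseteq> A" "A \<subseteq> C" "m C - m B < \<epsilon>"
  using assms(1)[unfolded completion_iff, rule_format, OF assms(2)] that by blast

text \<open>The gap \<open>C - B\<close> need only be contained in a small set \<open>D\<close>
  because for a union or difference of two sets the natural bound is the union of the two individual
  gaps.\<close>

lemma completion_sandwich:
  assumes "\<And>\<epsilon>. 0 < \<epsilon> \<Longrightarrow> \<exists>B C D. B \<in> R \<and> C \<in> R \<and> D \<in> R \<and> B \<subseteq> A \<and> A \<subseteq> C \<and> C - B \<subseteq> D \<and> m D < \<epsilon>"
  shows "A \<in> completion"
  unfolding completion_iff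
proof (intro allI impI)
  fix \<epsilon> :: real assume "0 < \<epsilon>"
  from assms[OF this] obtain B C D
    where *: "B \<in> R" "C \<in> R" "B \<subseteq> A" "A \<subseteq> C" "D \<in> R" "C - B \<subseteq> D" "m D < \<epsilon>" by blast
  then have "m C - m B = m (C - B)" by (subst m_Diff) auto
  also have "\<dots> \<le> m D" using * by (intro m_mono) auto
  finally have "m C - m B < \<epsilon>" using * by simp
  then show "\<exists>B\<in>R. \<exists>C\<in>R. B \<subseteq> A \<and> A \<subseteq> C \<and> m C - m B < \<epsilon>" using * by blast
qed

lemma subset_completion: "A \<in> R \<Longrightarrow> A \<in> completion"
  unfolding completion_iff
proof (intro allI impI)
  fix \<epsilon> :: real assume "A \<in> R" "0 < \<epsilon>"
  then have "m A - m A < \<epsilon>" by simp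
  then show "\<exists>B\<in>R. \<exists>C\<in>R. B \<subseteq> A \<and> A \<subseteq> C \<and> m C - m B < \<epsilon>"
    using \<open>A \<in> R\<close> by blast
qed

lemma completion_Int:
  assumes "A \<in> completion" and H: "\<And>A. A \<in> R \<Longrightarrow> A \<inter> H \<in> R"
  shows "A \<inter> H \<in> completion"
proof (rule completion_sandwich)
  fix \<epsilon> :: real assume "0 < \<epsilon>"
  obtain B C where *: "B \<in> R" "C \<in> R" "B \<subseteq> A" "A \<subseteq> C" "m C - m B < \<epsilon>"
    by (rule completionD[OF assms(1) \<open>0 < \<epsilon>\<close>])
  have "m (C - B) < \<epsilon>" using * by (subst m_Diff) auto
  moreover have "C \<inter> H - B \<inter> H \<subseteq> C - B" by auto
  ultimately show "\<exists>B C D. B \<in> R \<and> C \<in> R \<and> D \<in> R \<and>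
        B \<subseteq> A \<inter> H \<and> A \<inter> H \<subseteq> C \<and> C - B \<subseteq> D \<and> m D < \<epsilon>"
    using * H by (intro exI[of _ "B \<inter> H"] exI[of _ "C \<inter> H"] exI[of _ "C - B"] conjI) auto
qed

lemma completion_binary:
  assumes "A \<in> completion" "A' \<in> completion"
  shows "A \<union> A' \<in> completion" "A - A' \<in> completion"
proof -
  have *: "\<exists>B\<in>R. \<exists>C\<in>R. \<exists>B'\<in>R. \<exists>C'\<in>R. B \<subseteq> A \<and> A \<subseteq> C \<and> B' \<subseteq> A' \<and> A' \<subseteq> C' \<and>
     m ((C - B) \<union> (C' - B')) < \<epsilon>" if "0 < \<epsilon>" for \<epsilon>
  proof -
    obtain B C where 1: "B \<in> R" "C \<in> R" "B \<subseteq> A" "A \<subseteq> C" "m C - m B < \<epsilon> / 2"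
      using completionD[OF assms(1), of "\<epsilon> / 2"] \<open>0 < \<epsilon>\<close> by auto
    obtain B' C' where 2: "B' \<in> R" "C' \<in> R" "B' \<subseteq> A'" "A' \<subseteq> C'" "m C' - m B' < \<epsilon> / 2"
      using completionD[OF assms(2), of "\<epsilon> / 2"] \<open>0 < \<epsilon>\<close> by auto
    have "m ((C - B) \<union> (C' - B')) \<le> m (C - B) + m (C' - B')" using 1 2 by (intro m_subadd) auto
    also have "m (C - B) = m C - m B" using 1 by (intro m_Diff) auto
    also have "m (C' - B') = m C' - m B'" using 2 by (intro m_Diff) auto
    finally have "m ((C - B) \<union> (C' - B')) < \<epsilon>" using 1 2 by simp
    then show ?thesis using 1 2 by blast
  qed
  show "A \<union> A' \<in> completion"
  proof (rule completion_sandwich)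
    fix \<epsilon> :: real assume "0 < \<epsilon>"
    from *[OF this] obtain B C B' C' where "B \<in> R" "C \<in> R" "B' \<in> R" "C' \<in> R"
      "B \<subseteq> A" "A \<subseteq> C" "B' \<subseteq> A'" "A' \<subseteq> C'" "m ((C - B) \<union> (C' - B')) < \<epsilon>" by blast
    then show "\<exists>B C D. B \<in> R \<and> C \<in> R \<and> D \<in> R \<and>
        B \<subseteq> A \<union> A' \<and> A \<union> A' \<subseteq> C \<and> C - B \<subseteq> D \<and> m D < \<epsilon>"
      by (intro exI[of _ "B \<union> B'"] exI[of _ "C \<union> C'"] exI[of _ "(C - B) \<union> (C' - B')"] conjI) auto
  qed
  show "A - A' \<in> completion"
  proof (rule completion_sandwich)
    fix \<epsilon> :: real assume "0 < \<epsilon>"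
    from *[OF this] obtain B C B' C' where "B \<in> R" "C \<in> R" "B' \<in> R" "C' \<in> R"
      "B \<subseteq> A" "A \<subseteq> C" "B' \<subseteq> A'" "A' \<subseteq> C'" "m ((C - B) \<union> (C' - B')) < \<epsilon>" by blast
    then show "\<exists>B C D. B \<in> R \<and> C \<in> R \<and> D \<in> R \<and>
        B \<subseteq> A - A' \<and> A - A' \<subseteq> C \<and> C - B \<subseteq> D \<and> m D < \<epsilon>"
      by (intro exI[of _ "B - C'"] exI[of _ "C - B'"] exI[of _ "(C - B) \<union> (C' - B')"] conjI) auto
  qed
qed

lemma fin_add_completion: "fin_add completion outer"
proof -
  interpret C: ring_of_sets UNIV completion
    using completion_binary by (intro ring_of_setsI) (auto intro: subset_completion)
  show ?thesis
  proof
    fix A assume "A \<in> completion"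
    then show "0 \<le> outer A" using outer_ge[of "{}" A] by (auto simp: m_empty completion_def)
  next
    fix A A' assume A: "A \<in> completion" and A': "A' \<in> completion" and disj: "A \<inter> A' = {}"
    \<comment> \<open>Both numbers lie between \<open>m B + m B'\<close> and
      \<open>m C + m C'\<close>, which differ by less than \<open>\<epsilon>\<close>. Disjointness
      of \<open>A\<close> and \<open>A'\<close> enters through the inner sets.\<close>
    have "\<bar>outer (A \<union> A') - (outer A + outer A')\<bar> \<le> \<epsilon>" if "0 < \<epsilon>" for \<epsilon>
    proof -
      obtain B C where 1: "B \<in> R" "C \<in> R" "B \<subseteq> A" "A \<subseteq> C" "m C - m B < \<epsilon> / 2"
        using completionD[OF A, of "\<epsilon> / 2"] \<open>0 < \<epsilon>\<close> by auto
      obtain B' C' where 2: "B' \<in> R" "C' \<in> R" "B' \<subseteq> A'" "A' \<subseteq> C'" "m C' - m B' < \<epsilon> / 2"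
        using completionD[OF A', of "\<epsilon> / 2"] \<open>0 < \<epsilon>\<close> by auto
      have "m (B \<union> B') \<le> outer (A \<union> A')"
        using 1 2 by (intro outer_ge[of _ _ "C \<union> C'"]) auto
      moreover have "m (B \<union> B') = m B + m B'" using 1 2 disj by (intro m_Un) auto
      moreover have "outer (A \<union> A') \<le> m (C \<union> C')" using 1 2 by (intro outer_le) auto
      moreover have "m (C \<union> C') \<le> m C + m C'" using 1 2 by (intro m_subadd) auto
      moreover have "m B \<le> outer A" "outer A \<le> m C" "m B' \<le> outer A'" "outer A' \<le> m C'"
        using 1 2 outer_ge outer_le by blast+
      ultimately show ?thesis using 1 2 by linarith
    qed
    then have "\<bar>outer (A \<union> A') - (outer A + outer A')\<bar> \<le> 0" by (rule field_le_epsilon) simp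
    then show "outer (A \<union> A') = outer A + outer A'" by simp
  qed
qed

end

section \<open>Infinite products of side lengths\<close>

lemma tendsto_zero_le:
  fixes f g :: "nat \<Rightarrow> real"
  assumes "\<And>n. 0 \<le> f n" "\<And>n. f n \<le> g n" "g \<longlonglongrightarrow> 0"
  shows "f \<longlonglongrightarrow> 0"
  by (rule tendsto_sandwich[OF _ _ tendsto_const assms(3)]) (use assms in auto)

lemma not_summable_sum_at_top:
  fixes f :: "nat \<Rightarrow> real"
  assumes "\<not> summable f" "\<And>j. 0 \<le> f j"
  shows "filterlim (\<lambda>n. \<Sum>j<n. f j) at_top sequentially"
  unfolding filterlim_at_top eventually_sequentially
proof
  fix Z
  obtain N where N: "Z < (\<Sum>j<N. f j)"
    using assms summableI_nonneg_bounded[of f Z] by (meson not_le)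
  have "Z \<le> (\<Sum>j<n. f j)" if "N \<le> n" for n
    using N sum_mono2[of "{..<n}" "{..<N}" f] assms(2) that by fastforce
  then show "\<exists>N. \<forall>n\<ge>N. Z \<le> (\<Sum>j<n. f j)" by blast
qed

text \<open>Each factor is \<open>max 1 (p j) * min 1 (p j)\<close>. The first factors multiply to
  the exponential of a convergent series, the second give a decreasing product, so the limit exists
  even when it is 0.\<close>

lemma prod_pos_split:
  fixes p :: "nat \<Rightarrow> real"
  assumes "\<And>j. 0 < p j"
  shows "(\<Prod>j<n. p j) = exp (\<Sum>j<n. max 0 (ln (p j))) * (\<Prod>j<n. min 1 (p j))"
proof -
  have "p j = exp (max 0 (ln (p j))) * min 1 (p j)" for j
    using assms[of j] by (cases "1 \<le> p j") (auto simp: max_def min_def ln_ge_zero_iff)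
  then have "(\<Prod>j<n. p j) = (\<Prod>j<n. exp (max 0 (ln (p j))) * min 1 (p j))"
    by (intro prod.cong) auto
  then show ?thesis by (simp add: prod.distrib exp_sum)
qed

lemma prod_min_one_convergent:
  fixes p :: "nat \<Rightarrow> real"
  assumes "\<And>j. 0 < p j"
  obtains M where "(\<lambda>n. \<Prod>j<n. min 1 (p j)) \<longlonglongrightarrow> M" "\<And>n. M \<le> (\<Prod>j<n. min 1 (p j))" "0 \<le> M"
proof -
  let ?Q = "\<lambda>n. \<Prod>j<n. min 1 (p j)"
  have pos: "0 \<le> ?Q n" for n using assms by (intro prod_nonneg) (auto intro: less_imp_le)
  have dec: "decseq ?Q"
  proof (rule decseq_SucI)
    fix n
    have "?Q n * min 1 (p n) \<le> ?Q n * 1" by (intro mult_left_mono pos) auto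
    then show "?Q (Suc n) \<le> ?Q n" by simp
  qed
  obtain M where M: "?Q \<longlonglongrightarrow> M" "\<forall>n. M \<le> ?Q n"
    using decseq_convergent[OF dec, of 0] pos by auto
  then have "0 \<le> M" using LIMSEQ_le_const[OF M(1)] pos by blast
  then show ?thesis using that M by blast
qed

text \<open>When the limit is positive, both deviations from 1 are summable. For the factors below
  1, the inequality \<open>1 + x \<le> exp x\<close> with \<open>x = min 1 (p j) - 1\<close> bounds
  the sum of the deficits by \<open>- ln M\<close>; the excess of the factors above 1 is controlled
  by their logarithms and the upper bound \<open>B\<close>.\<close>

lemma prod_pos_tendsto:
  fixes p :: "nat \<Rightarrow> real"
  assumes pos: "\<And>j. 0 < p j" and sm: "summable (\<lambda>j. max 0 (ln (p j)))"
  obtains L where "(\<lambda>n. \<Prod>j<n. p j) \<longlonglongrightarrow> L" "0 \<le> L"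
    "\<And>B. 0 < L \<Longrightarrow> (\<And>j. p j \<le> B) \<Longrightarrow> summable (\<lambda>j. \<bar>p j - 1\<bar>)"
proof -
  let ?S = "suminf (\<lambda>j. max 0 (ln (p j)))"
  obtain M where M: "(\<lambda>n. \<Prod>j<n. min 1 (p j)) \<longlonglongrightarrow> M" "\<And>n. M \<le> (\<Prod>j<n. min 1 (p j))" "0 \<le> M"
    using prod_min_one_convergent[of p] pos by blast
  have lim: "(\<lambda>n. \<Prod>j<n. p j) \<longlonglongrightarrow> exp ?S * M"
    unfolding prod_pos_split[of p, OF pos]
    by (intro tendsto_mult tendsto_exp M summable_LIMSEQ sm)
  have summ: "summable (\<lambda>j. \<bar>p j - 1\<bar>)" if L: "0 < exp ?S * M" and B: "\<And>j. p j \<le> B" for B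
  proof -
    have "0 < M" using L by (simp add: zero_less_mult_iff)
    have "summable (\<lambda>j. 1 - min 1 (p j))"
    proof (rule summableI_nonneg_bounded)
      fix n
      have "M \<le> (\<Prod>j<n. min 1 (p j))" by (rule M)
      also have "\<dots> \<le> (\<Prod>j<n. exp (min 1 (p j) - 1))"
        using pos exp_ge_add_one_self[of "min 1 (p j) - 1" for j]
        by (intro prod_mono) (auto intro: less_imp_le)
      also have "\<dots> = exp (- (\<Sum>j<n. 1 - min 1 (p j)))"
        by (simp add: exp_sum[symmetric] sum_negf[symmetric])
      finally have "ln M \<le> - (\<Sum>j<n. 1 - min 1 (p j))"
        using \<open>0 < M\<close> by (metis ln_exp ln_le_cancel_iff exp_gt_zero)
      then show "(\<Sum>j<n. 1 - min 1 (p j)) \<le> - ln M" by simp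
    qed auto
    moreover have "summable (\<lambda>j. B * max 0 (ln (p j)))" by (intro summable_mult sm)
    ultimately have "summable (\<lambda>j. (1 - min 1 (p j)) + B * max 0 (ln (p j)))" by (rule summable_add)
    then show ?thesis
    proof (rule summable_comparison_test'[where N = 0], goal_cases)
      case (1 j)
      have "0 \<le> B" using pos[of 0] B[of 0] by simp
      show ?case
      proof (cases "1 \<le> p j")
        case True
        \<comment> \<open>Multiplied by \<open>p j\<close>, this gives
          \<open>p j - 1 \<le> p j * ln (p j) \<le> B * ln (p j)\<close>, which turns the summable
          logarithms into summable excesses.\<close>
        have "1 - 1 / p j \<le> ln (p j)"
          using ln_le_minus_one[of "1 / p j"] pos[of j] by (simp add: ln_div)
        then have "p j * (1 - 1 / p j) \<le> p j * ln (p j)" using pos[of j] by (intro mult_left_mono) auto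
        also have "\<dots> \<le> B * ln (p j)" using True B by (intro mult_right_mono) auto
        finally show ?thesis using True pos[of j] by (simp add: algebra_simps)
      next
        case False
        then show ?thesis using \<open>0 \<le> B\<close> by (auto simp: min_def)
      qed
    qed
  qed
  show ?thesis by (rule that[OF lim _ summ]) (use M(3) in auto)
qed

lemma cmod_exp_i_diff_le: "cmod (exp (\<i> * of_real a) - exp (\<i> * of_real b)) \<le> \<bar>a - b\<bar>"
proof -
  have "exp (\<i> * of_real a) - exp (\<i> * of_real b)
      = exp (\<i> * of_real b) * (exp (\<i> * of_real (a - b)) - 1)"
    by (simp add: algebra_simps flip: exp_add)
  then have "cmod (exp (\<i> * of_real a) - exp (\<i> * of_real b)) = 2 * \<bar>sin ((a - b) / 2)\<bar>"
    by (simp only: norm_mult norm_exp_i_times dist_exp_i_1)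
  also have "\<dots> \<le> 2 * \<bar>(a - b) / 2\<bar>" using abs_sin_x_le_abs_x[of "(a - b) / 2"] by simp
  finally show ?thesis by simp
qed

section \<open>Coordinates\<close>

locale onb =
  fixes e :: "nat \<Rightarrow> 'a::{real_inner, complete_space}"
  assumes onb: "orthonormal_basis e"
begin

lemma e_inner: "e i \<bullet> e j = (if i = j then 1 else 0)"
  using onb by (simp add: orthonormal_basis_def)

lemma norm_sum_e: "finite I \<Longrightarrow> (norm (\<Sum>j\<in>I. c j *\<^sub>R e j))\<^sup>2 = (\<Sum>j\<in>I. (c j)\<^sup>2)"
  unfolding power2_norm_eq_inner
  by (simp add: inner_sum_left inner_sum_right e_inner if_distrib power2_eq_square
      cong: if_cong)

lemma inner_sum_e: "finite I \<Longrightarrow> (\<Sum>j\<in>I. c j *\<^sub>R e j) \<bullet> e k = (if k \<in> I then c k else 0)"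
  by (simp add: inner_sum_left e_inner if_distrib cong: if_cong)

lemma Bessel: "summable (\<lambda>j. (x \<bullet> e j)\<^sup>2)"
proof (rule summableI_nonneg_bounded)
  fix n
  let ?P = "\<Sum>j<n. (x \<bullet> e j) *\<^sub>R e j"
  have xP: "x \<bullet> ?P = (\<Sum>j<n. (x \<bullet> e j)\<^sup>2)" by (simp add: inner_sum_right power2_eq_square)
  have PP: "?P \<bullet> ?P = (\<Sum>j<n. (x \<bullet> e j)\<^sup>2)"
    using norm_sum_e[of "{..<n}"] by (simp add: power2_norm_eq_inner)
  have "0 \<le> (x - ?P) \<bullet> (x - ?P)" by simp
  also have "\<dots> = x \<bullet> x - 2 * (x \<bullet> ?P) + ?P \<bullet> ?P"
    by (simp only: inner_diff_left inner_diff_right inner_commute[of ?P x])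
  finally show "(\<Sum>j<n. (x \<bullet> e j)\<^sup>2) \<le> x \<bullet> x" unfolding xP PP by simp
qed simp

lemma Riesz_Fischer:
  assumes "summable (\<lambda>j. (c j)\<^sup>2)"
  obtains y where "(\<lambda>n. \<Sum>j<n. c j *\<^sub>R e j) \<longlonglongrightarrow> y" "\<And>j. y \<bullet> e j = c j"
proof -
  let ?X = "\<lambda>n. \<Sum>j<n. c j *\<^sub>R e j"
  have diff: "?X n - ?X m = (\<Sum>j\<in>{m..<n}. c j *\<^sub>R e j)" if "m \<le> n" for m n
    using that sum_diff[of "{..<n}" "{..<m}" "\<lambda>j. c j *\<^sub>R e j"]
    by (simp add: lessThan_minus_lessThan)
  have "Cauchy ?X"
  proof (rule CauchyI')
    fix \<epsilon> :: real assume "0 < \<epsilon>"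
    then obtain N where N: "\<And>m n. m \<ge> N \<Longrightarrow> norm (\<Sum>j\<in>{m..<n}. (c j)\<^sup>2) < \<epsilon>\<^sup>2"
      using assms[unfolded summable_Cauchy, rule_format, of "\<epsilon>\<^sup>2"] by auto
    show "\<exists>M. \<forall>m\<ge>M. \<forall>n>m. dist (?X m) (?X n) < \<epsilon>"
      unfolding dist_norm
    proof (intro exI allI impI)
      fix m n assume mn: "N \<le> m" "m < n"
      have "(norm (?X m - ?X n))\<^sup>2 = (norm (\<Sum>j\<in>{m..<n}. c j *\<^sub>R e j))\<^sup>2"
        using diff[OF less_imp_le[OF mn(2)]] by (metis norm_minus_commute)
      also have "\<dots> = (\<Sum>j\<in>{m..<n}. (c j)\<^sup>2)" by (simp add: norm_sum_e)
      also have "\<dots> < \<epsilon>\<^sup>2" using N[OF mn(1), of n] by (simp add: sum_nonneg)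
      finally show "norm (?X m - ?X n) < \<epsilon>" using \<open>0 < \<epsilon>\<close> by (simp add: power_less_imp_less_base)
    qed
  qed
  then obtain y where y: "?X \<longlonglongrightarrow> y" using Cauchy_convergent_iff convergent_def by blast
  have "y \<bullet> e j = c j" for j
  proof -
    have "(\<lambda>n. ?X n \<bullet> e j) \<longlonglongrightarrow> y \<bullet> e j" by (intro tendsto_intros y)
    moreover have "(\<lambda>n. ?X n \<bullet> e j) \<longlonglongrightarrow> c j"
      by (rule tendsto_eventually) (auto simp: inner_sum_e eventually_at_top_linorder intro!: exI[of _ "Suc j"])
    ultimately show ?thesis by (rule LIMSEQ_unique)
  qed
  then show ?thesis using that y by blast
qed

text \<open>This turns one coordinate into a free variable while all others stay frozen; it replaces
  a decomposition of \<open>E\<close> as a product.\<close>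

lemma inner_update: "(z + (t - z \<bullet> e k) *\<^sub>R e k) \<bullet> e j = (if j = k then t else z \<bullet> e j)"
  by (simp add: inner_add_left e_inner)

section \<open>Absolutely measurable blocks\<close>

text \<open>A point of the intersection certifies that the new lower corners lie below the new upper
  ones and squeezes both between \<open>a\<close> and \<open>b\<close>, which keeps them bounded.
  Side lengths only shrink, so the positive parts of the logarithms stay summable. Since the second
  pair of corners is arbitrary, the lemma also covers cutting a block by a strip.\<close>

lemma block_Int:
  assumes "abs_measurable e a b"
  shows "block e a b \<inter> block e a' b' = {} \<or>
    abs_measurable e (\<lambda>j. max (a j) (a' j)) (\<lambda>j. min (b j) (b' j)) \<and>
    block e a b \<inter> block e a' b' = block e (\<lambda>j. max (a j) (a' j)) (\<lambda>j. min (b j) (b' j))"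
proof (cases "block e a b \<inter> block e a' b' = {}")
  case False
  let ?a = "\<lambda>j. max (a j) (a' j)" and ?b = "\<lambda>j. min (b j) (b' j)"
  have eq: "block e a b \<inter> block e a' b' = block e ?a ?b" by (auto simp: block_def)
  obtain x where x: "\<And>j. a j \<le> x \<bullet> e j" "\<And>j. a' j \<le> x \<bullet> e j" "\<And>j. x \<bullet> e j < b j" "\<And>j. x \<bullet> e j < b' j"
    using False by (auto simp: block_def)
  from assms have "bounded (range a)" "bounded (range b)"
    by (auto simp: abs_measurable_def block_bounds_def)
  then obtain K L where K: "\<And>j. \<bar>a j\<bar> \<le> K" and L: "\<And>j. \<bar>b j\<bar> \<le> L"
    unfolding bounded_iff by auto
  have ab: "?a j < ?b j" for j
    using x(1,2)[of j] x(3,4)[of j] by (auto simp: max_def min_def)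
  have bd: "\<bar>?a j\<bar> \<le> K + L \<and> \<bar>?b j\<bar> \<le> K + L" for j
    using K[of j] L[of j] x(1,2)[of j] x(3,4)[of j] by (auto simp: max_def min_def)
  have "summable (\<lambda>j. max 0 (ln (b j - a j)))"
    using assms False by (auto simp: abs_measurable_def)
  then have "summable (\<lambda>j. max 0 (ln (?b j - ?a j)))"
  proof (rule summable_comparison_test'[where N = 0], goal_cases)
    case (1 j)
    have "ln (?b j - ?a j) \<le> ln (b j - a j)"
      using ab[of j] by (subst ln_le_cancel_iff) (auto simp: max_def min_def split: if_splits)
    then show ?case by (auto simp: max_def)
  qed
  moreover have "bounded (range ?a)"
    by (rule boundedI[of _ "K + L"]) (use bd in \<open>unfold real_norm_def, blast\<close>)
  moreover have "bounded (range ?b)"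
    by (rule boundedI[of _ "K + L"]) (use bd in \<open>unfold real_norm_def, blast\<close>)
  ultimately have "abs_measurable e ?a ?b"
    using ab by (simp add: abs_measurable_def block_bounds_def)
  then show ?thesis using eq by blast
qed simp

lemma block_measure_tendsto:
  assumes "abs_measurable e a b" "block e a b \<noteq> {}"
  shows "(\<lambda>n. \<Prod>j<n. b j - a j) \<longlonglongrightarrow> block_measure e a b"
    and "0 \<le> block_measure e a b"
    and "0 < block_measure e a b \<Longrightarrow> summable (\<lambda>j. \<bar>b j - a j - 1\<bar>)"
proof -
  have bb: "bounded (range a)" "bounded (range b)" and pos: "\<And>j. 0 < b j - a j"
    and sm: "summable (\<lambda>j. max 0 (ln (b j - a j)))"
    using assms by (auto simp: abs_measurable_def block_bounds_def)
  from bb obtain K L where "\<And>j. \<bar>a j\<bar> \<le> K" "\<And>j. \<bar>b j\<bar> \<le> L"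
    unfolding bounded_iff by auto
  then have bd: "b j - a j \<le> K + L" for j by (smt (verit))
  obtain l where l: "(\<lambda>n. \<Prod>j<n. b j - a j) \<longlonglongrightarrow> l" "0 \<le> l"
    "\<And>B. 0 < l \<Longrightarrow> (\<And>j. b j - a j \<le> B) \<Longrightarrow> summable (\<lambda>j. \<bar>b j - a j - 1\<bar>)"
    using prod_pos_tendsto[of "\<lambda>j. b j - a j", OF pos sm] by metis
  have "block_measure e a b = l"
    using assms limI[OF l(1)] by (simp add: block_measure_def)
  then show "(\<lambda>n. \<Prod>j<n. b j - a j) \<longlonglongrightarrow> block_measure e a b" "0 \<le> block_measure e a b"
    "0 < block_measure e a b \<Longrightarrow> summable (\<lambda>j. \<bar>b j - a j - 1\<bar>)"
    using l bd by blast+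
qed

lemma block_shift: "(+) v ` block e a b = block e (\<lambda>j. a j + v \<bullet> e j) (\<lambda>j. b j + v \<bullet> e j)"
proof
  show "block e (\<lambda>j. a j + v \<bullet> e j) (\<lambda>j. b j + v \<bullet> e j) \<subseteq> (+) v ` block e a b"
  proof
    fix x assume x: "x \<in> block e (\<lambda>j. a j + v \<bullet> e j) (\<lambda>j. b j + v \<bullet> e j)"
    have "x - v \<in> block e a b" using x by (auto simp: block_def inner_diff_left algebra_simps)
    then show "x \<in> (+) v ` block e a b" by (intro image_eqI[of _ _ "x - v"]) auto
  qed
qed (auto simp: block_def inner_add_left)

lemma norm_e: "norm (e j) = 1"
  using e_inner[of j j] by (simp add: norm_eq_sqrt_inner)

lemma inner_e_le: "\<bar>v \<bullet> e j\<bar> \<le> norm v"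
  using Cauchy_Schwarz_ineq2[of v "e j"] by (simp add: norm_e)

lemma bounded_range_shift: "bounded (range a) \<Longrightarrow> bounded (range (\<lambda>j. a j + v \<bullet> e j))"
  unfolding bounded_iff
proof (elim exE)
  fix K assume K: "\<forall>x\<in>range a. norm x \<le> K"
  have "norm (a j + v \<bullet> e j) \<le> K + norm v" for j
    using K[rule_format, of "a j"] inner_e_le[of v j] by auto
  then show "\<exists>K. \<forall>x\<in>range (\<lambda>j. a j + v \<bullet> e j). norm x \<le> K" by blast
qed

lemma abs_measurable_shift:
  assumes "abs_measurable e a b"
  shows "abs_measurable e (\<lambda>j. a j + v \<bullet> e j) (\<lambda>j. b j + v \<bullet> e j)"
    and "block_measure e (\<lambda>j. a j + v \<bullet> e j) (\<lambda>j. b j + v \<bullet> e j) = block_measure e a b"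
  using assms bounded_range_shift
  unfolding abs_measurable_def block_measure_def block_shift[symmetric] block_bounds_def
  by auto

section \<open>Positivity of the measure on combinations of blocks\<close>

lemma measure_Ico_Int:
  "measure lborel ({a..<b} \<inter> {p..<q}) = max 0 (min b q - max a p)" for a b p q :: real
proof -
  have "{a..<b} \<inter> {p..<q} = {max a p..<min b q}" by auto
  then show ?thesis
    using measure_lborel_Ico[of "max a p" "min b q"]
    by (cases "max a p \<le> min b q") auto
qed

text \<open>One coordinate is integrated per step: the induction hypothesis is taken at
  \<open>z\<close> with coordinate \<open>M\<close> replaced by \<open>t\<close>, then integrated
  over \<open>t\<close> in the window from \<open>p M\<close> to \<open>q M\<close>. This is why
  \<open>z\<close> must be arbitrary in the induction. The windows are left free here; their choice
  decides which blocks keep their full side lengths.\<close>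

lemma integrate_coordinates:
  fixes n :: nat and a b :: "nat \<Rightarrow> nat \<Rightarrow> real" and c p q :: "nat \<Rightarrow> real"
  assumes nonneg: "\<And>x. 0 \<le> (\<Sum>i<n. c i * indicator (block e (a i) (b i)) x)"
  defines "l \<equiv> \<lambda>i j. measure lborel ({a i j..<b i j} \<inter> {p j..<q j})"
  shows "0 \<le> (\<Sum>i<n. c i * (\<Prod>j<M. l i j) * of_bool (\<forall>j\<ge>M. z \<bullet> e j \<in> {a i j..<b i j}))"
proof (induction M arbitrary: z)
  case 0
  then show ?case using nonneg[of z] by (simp add: indicator_def block_def)
next
  case (Suc M)
  define k where "k i = c i * (\<Prod>j<M. l i j) * of_bool (\<forall>j\<ge>Suc M. z \<bullet> e j \<in> {a i j..<b i j})" for i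
  let ?I = "\<lambda>i. {a i M..<b i M} \<inter> {p M..<q M}"
  have g: "0 \<le> (\<Sum>i<n. k i * indicat_real (?I i) t)" for t
  proof (cases "t \<in> {p M..<q M}")
    case True
    let ?z = "z + (t - z \<bullet> e M) *\<^sub>R e M"
    have "(\<forall>j\<ge>M. ?z \<bullet> e j \<in> {a i j..<b i j}) \<longleftrightarrow>
       t \<in> {a i M..<b i M} \<and> (\<forall>j\<ge>Suc M. z \<bullet> e j \<in> {a i j..<b i j})" for i
    proof -
      have "(\<forall>j\<ge>M. P j) \<longleftrightarrow> P M \<and> (\<forall>j\<ge>Suc M. P j)" for P
        by (metis Suc_leD Suc_leI le_eq_less_or_eq)
      then show ?thesis unfolding inner_update by auto
    qed
    moreover have "of_bool (t \<in> {a i M..<b i M} \<and> T) = of_bool T * indicat_real (?I i) t" for i T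
      using True by (auto simp: indicator_def)
    ultimately have "c i * (\<Prod>j<M. l i j) * of_bool (\<forall>j\<ge>M. ?z \<bullet> e j \<in> {a i j..<b i j})
        = k i * indicat_real (?I i) t" for i
      by (simp only: k_def mult.assoc)
    then show ?thesis using Suc.IH[of ?z] by simp
  qed simp
  have fin: "emeasure lborel (?I i) < \<infinity>" for i
    by (rule emeasure_bounded_finite, rule bounded_subset[of "{a i M..b i M}"]) auto
  have "0 \<le> (\<integral>t. (\<Sum>i<n. k i * indicat_real (?I i) t) \<partial>lborel)"
    using g by (intro integral_nonneg_AE) auto
  also have "\<dots> = (\<Sum>i<n. k i * l i M)"
    unfolding l_def using fin by (subst Bochner_Integration.integral_sum) auto
  also have "\<dots> = (\<Sum>i<n. c i * (\<Prod>j<Suc M. l i j) * of_bool (\<forall>j\<ge>Suc M. z \<bullet> e j \<in> {a i j..<b i j}))"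
    by (intro sum.cong) (auto simp: k_def)
  finally show ?case .
qed

text \<open>Finitely many coordinates may have no common value, so only a tail can be asked for.
  Each coordinate is chosen as close to 0 as the blocks allow; comparison with points of the
  individual blocks then makes the sequence square summable, hence the coordinate sequence of an
  element of \<open>E\<close>.\<close>

lemma common_tail:
  assumes C: "finite C" "C \<noteq> {}"
    and ne: "\<And>i. i \<in> C \<Longrightarrow> block e (a i) (b i) \<noteq> {}"
    and far: "\<And>i k. i \<in> C \<Longrightarrow> k \<in> C \<Longrightarrow> \<forall>\<^sub>F j in sequentially. a i j + 1 / 2 < b k j"
  obtains y where "\<forall>\<^sub>F M in sequentially. \<forall>i\<in>C. \<forall>j\<ge>M. y \<bullet> e j \<in> {a i j..<b i j}"
proof -
  have "\<forall>i\<in>C. \<exists>x. x \<in> block e (a i) (b i)" using ne by auto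
  then obtain x where x: "\<And>i. i \<in> C \<Longrightarrow> x i \<in> block e (a i) (b i)" by metis
  define L where "L j = Max ((\<lambda>i. a i j) ` C)" for j
  define U where "U j = Min ((\<lambda>i. b i j) ` C)" for j
  \<comment> \<open>Once \<open>L j \<le> U j - (1/2)^j\<close>, this is the point of that interval
    nearest to 0. The shift by \<open>(1/2)^j\<close> is needed because blocks are open on the
    right; being square summable, it does no harm.\<close>
  define y where "y j = max (L j) (min 0 (U j - (1/2)^j))" for j
  have "\<exists>i\<in>C. L j = a i j" for j
    unfolding L_def using C
    by (metis (no_types, lifting) Max_in finite_imageI imageE image_is_empty)
  then obtain iL where iL: "\<And>j. iL j \<in> C" "\<And>j. L j = a (iL j) j" by metis
  have "\<exists>i\<in>C. U j = b i j" for j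
    unfolding U_def using C
    by (metis (no_types, lifting) Min_in finite_imageI imageE image_is_empty)
  then obtain iU where iU: "\<And>j. iU j \<in> C" "\<And>j. U j = b (iU j) j" by metis
  have LU: "a i j \<le> L j" "U j \<le> b i j" if "i \<in> C" for i j
    using that C by (auto simp: L_def U_def)
  have bnd: "(y j)\<^sup>2 \<le> (\<Sum>i\<in>C. 2 * (x i \<bullet> e j)\<^sup>2) + 2 * (1/4)^j" for j
  proof -
    have xL: "L j \<le> x (iL j) \<bullet> e j" and xU: "x (iU j) \<bullet> e j < U j"
      using x[OF iL(1)[of j]] x[OF iU(1)[of j]] iL(2) iU(2) by (auto simp: block_def)
    \<comment> \<open>A positive \<open>y j\<close> equals \<open>L j\<close>, which is at most the
      coordinate of \<open>x (iL j)\<close>. A negative one is at least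
      \<open>U j - (1/2)^j\<close>, which exceeds the coordinate of \<open>x (iU j)\<close> minus
      \<open>(1/2)^j\<close>.\<close>
    have "0 < (1/2::real)^j" by simp
    then have "\<bar>y j\<bar> \<le> \<bar>x (iL j) \<bullet> e j\<bar> + (1/2)^j \<or> \<bar>y j\<bar> \<le> \<bar>x (iU j) \<bullet> e j\<bar> + (1/2)^j"
      using xL xU unfolding y_def max_def min_def by (smt (verit))
    then obtain i where i: "i \<in> C" "\<bar>y j\<bar> \<le> \<bar>x i \<bullet> e j\<bar> + (1/2)^j"
      using iL(1) iU(1) by blast
    have "(y j)\<^sup>2 \<le> (\<bar>x i \<bullet> e j\<bar> + (1/2)^j)\<^sup>2" using power_mono[OF i(2), of 2] by simp
    also have "\<dots> \<le> 2 * (x i \<bullet> e j)\<^sup>2 + 2 * ((1/2)^j)\<^sup>2"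
      using sum_squares_bound[of "\<bar>x i \<bullet> e j\<bar>" "(1/2)^j"] by (simp add: power2_sum)
    also have "((1/2::real)^j)\<^sup>2 = (1/4)^j" by (simp add: power_even_eq power_one_over power2_eq_square
      flip: power_mult_distrib)
    also have "2 * (x i \<bullet> e j)\<^sup>2 \<le> (\<Sum>i\<in>C. 2 * (x i \<bullet> e j)\<^sup>2)"
      using C i(1) by (intro member_le_sum) auto
    finally show ?thesis by simp
  qed
  have "summable (\<lambda>j. (\<Sum>i\<in>C. 2 * (x i \<bullet> e j)\<^sup>2) + 2 * (1/4)^j)"
    by (intro summable_add summable_sum summable_mult Bessel summable_geometric) auto
  then have "summable (\<lambda>j. (y j)\<^sup>2)"
    by (rule summable_comparison_test'[where N = 0]) (use bnd in auto)
  then obtain z where z: "\<And>j. z \<bullet> e j = y j" using Riesz_Fischer by blast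
  have "(\<lambda>j. (1/2::real)^j) \<longlonglongrightarrow> 0" by (rule LIMSEQ_power_zero) simp
  then have "\<forall>\<^sub>F j in sequentially. (1/2::real)^j < 1/2" by (rule order_tendstoD) simp
  moreover have "\<forall>\<^sub>F j in sequentially. \<forall>i\<in>C. \<forall>k\<in>C. a i j + 1 / 2 < b k j"
    using C far by (simp add: eventually_ball_finite)
  ultimately have "\<forall>\<^sub>F j in sequentially. \<forall>i\<in>C. z \<bullet> e j \<in> {a i j..<b i j}"
  proof eventually_elim
    case (elim j)
    have 1: "L j < U j - (1/2)^j" using elim iL[of j] iU[of j] by force
    have "0 < (1/2::real)^j" by simp
    with 1 have "y j < U j" unfolding y_def max_def min_def by (smt (verit))
    moreover have "L j \<le> y j" by (simp add: y_def)
    ultimately show ?case unfolding z atLeastLessThan_iff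
      using order_trans[OF LU(1)] less_le_trans[OF _ LU(2)] by blast
  qed
  then have "\<forall>\<^sub>F M in sequentially. \<forall>i\<in>C. \<forall>j\<ge>M. z \<bullet> e j \<in> {a i j..<b i j}"
    unfolding eventually_sequentially by (meson order_trans)
  then show ?thesis using that by blast
qed

lemma class_nonneg:
  fixes n :: nat and a b :: "nat \<Rightarrow> nat \<Rightarrow> real" and c :: "nat \<Rightarrow> real"
  assumes meas: "\<And>i. i < n \<Longrightarrow> abs_measurable e (a i) (b i)"
    and ne: "\<And>i. i < n \<Longrightarrow> block e (a i) (b i) \<noteq> {}"
    and nonneg: "\<And>x. 0 \<le> (\<Sum>i<n. c i * indicator (block e (a i) (b i)) x)"
    and k: "k < n" "0 < block_measure e (a k) (b k)"
  defines "C \<equiv> {i. i < n \<and> 0 < block_measure e (a i) (b i) \<and> summable (\<lambda>j. \<bar>a i j - a k j\<bar>)}"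
  shows "0 \<le> (\<Sum>i\<in>C. c i * block_measure e (a i) (b i))"
proof -
  have C: "finite C" "C \<noteq> {}" "k \<in> C" using k by (auto simp: C_def)
  have ab: "a i j < b i j" if "i < n" for i j
    using meas[OF that] by (auto simp: abs_measurable_def block_bounds_def)
  have r: "summable (\<lambda>j. \<bar>b i j - a i j - 1\<bar>)" if "i < n" "0 < block_measure e (a i) (b i)" for i
    using block_measure_tendsto(3)[OF meas ne] that by blast
  have aC: "summable (\<lambda>j. \<bar>a i j - a k j\<bar>)" if "i \<in> C" for i using that by (auto simp: C_def)
  have bC: "summable (\<lambda>j. \<bar>b i j - b k j\<bar>)" if "i \<in> C" for i
  proof (rule summable_comparison_test'[where N = 0])
    show "summable (\<lambda>j. \<bar>a i j - a k j\<bar> + (\<bar>b i j - a i j - 1\<bar> + \<bar>b k j - a k j - 1\<bar>))"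
      using that k by (intro summable_add r aC) (auto simp: C_def)
  qed auto
  define p where "p j = Min ((\<lambda>i. a i j) ` C)" for j
  define q where "q j = Max ((\<lambda>i. b i j) ` C)" for j
  \<comment> \<open>A summable majorant for the distance of all blocks of the class from block
    \<open>k\<close>: the hull from \<open>p j\<close> to \<open>q j\<close> exceeds the side of
    block \<open>k\<close> by at most \<open>d j\<close> at either end.\<close>
  define d where "d j = (\<Sum>i\<in>C. \<bar>a i j - a k j\<bar> + \<bar>b i j - b k j\<bar>)" for j
  have sd: "summable d" unfolding d_def by (intro summable_sum summable_add aC bC)
  have le_d: "\<bar>a i j - a k j\<bar> + \<bar>b i j - b k j\<bar> \<le> d j" if "i \<in> C" for i j
    unfolding d_def using that C
    by (intro member_le_sum[of _ _ "\<lambda>i. \<bar>a i j - a k j\<bar> + \<bar>b i j - b k j\<bar>"]) auto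
  have pd: "a k j - d j \<le> p j" for j
    unfolding p_def using C le_d[of _ j] by (subst Min_ge_iff) (auto, smt (verit))
  have qd: "q j \<le> b k j + d j" for j
    unfolding q_def using C le_d[of _ j] by (subst Max_le_iff) (auto, smt (verit))
  define l where "l i j = measure lborel ({a i j..<b i j} \<inter> {p j..<q j})" for i j
  have l0: "0 \<le> l i j" for i j by (simp add: l_def)
  have lC: "l i j = b i j - a i j" if "i \<in> C" for i j
  proof -
    have "p j \<le> a i j" "b i j \<le> q j" using that C by (auto simp: p_def q_def)
    then show ?thesis using ab[of i j] that
      unfolding l_def measure_Ico_Int by (auto simp: max_def min_def C_def)
  qed
  have l_le: "l i j \<le> b i j - a i j" if "i < n" for i j
    using ab[OF that, of j] unfolding l_def measure_Ico_Int by auto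

  obtain y where y: "\<forall>\<^sub>F M in sequentially. \<forall>i\<in>C. \<forall>j\<ge>M. y \<bullet> e j \<in> {a i j..<b i j}"
  proof (rule common_tail[OF C(1,2), of a b])
    fix i i' assume i: "i \<in> C" "i' \<in> C"
    \<comment> \<open>Three deviations below 1/8, namely of the lower corner, of the upper corner
      and of the side length of block \<open>k\<close> from 1, leave an overlap above 5/8 and hence
      above 1/2.\<close>
    have ev: "\<forall>\<^sub>F j in sequentially. f j < 1/8" if "summable f" for f :: "nat \<Rightarrow> real"
      using summable_LIMSEQ_zero[OF that] by (rule order_tendstoD) simp
    show "\<forall>\<^sub>F j in sequentially. a i j + 1 / 2 < b i' j"
      using ev[OF aC[OF i(1)]] ev[OF bC[OF i(2)]] ev[OF r[OF k]]
    proof eventually_elim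
      case (elim j)
      then show ?case by linarith
    qed
  qed (use ne in \<open>auto simp: C_def\<close>)

  define w where "w M i = (\<Prod>j<M. l i j) * of_bool (\<forall>j\<ge>M. y \<bullet> e j \<in> {a i j..<b i j})" for M i
  have w: "(\<lambda>M. w M i) \<longlonglongrightarrow> (if i \<in> C then block_measure e (a i) (b i) else 0)" if "i < n" for i
  proof (cases "i \<in> C")
    case True
    have "\<forall>\<^sub>F M in sequentially. (\<Prod>j<M. b i j - a i j) = w M i"
      using y by eventually_elim (use True in \<open>auto simp: w_def lC\<close>)
    with block_measure_tendsto(1)[OF meas ne, OF that that] True show ?thesis
      by (auto intro: Lim_transform_eventually)
  next
    case False
    \<comment> \<open>A block outside the class either has measure 0, and then the window only
      shortens its sides, or its corners drift away from the class by a non-summable amount, which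
      drives the product of overlaps to 0.\<close>
    have "(\<lambda>M. \<Prod>j<M. l i j) \<longlonglongrightarrow> 0"
    proof (cases "block_measure e (a i) (b i) = 0")
      case True
      have "(\<Prod>j<M. l i j) \<le> (\<Prod>j<M. b i j - a i j)" for M
        using l0 l_le that by (intro prod_mono) auto
      moreover have "(\<lambda>M. \<Prod>j<M. b i j - a i j) \<longlonglongrightarrow> 0"
        using block_measure_tendsto(1)[OF meas ne, OF that that] True by simp
      ultimately show ?thesis by (rule tendsto_zero_le[rotated]) (auto intro: prod_nonneg l0)
    next
      case pos: False
      define D where "D j = \<bar>a i j - a k j\<bar>" for j
      define s where "s j = \<bar>b i j - a i j - 1\<bar> + \<bar>b k j - a k j - 1\<bar> + 2 * d j" for j
      have pos': "0 < block_measure e (a i) (b i)"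
        using block_measure_tendsto(2)[OF meas ne, OF that that] pos by simp
      have ss: "summable s" unfolding s_def
        by (intro summable_add r summable_mult sd that k pos')
      have "\<not> summable D" using False that pos' unfolding D_def by (simp add: C_def)
      then have D: "filterlim (\<lambda>M. \<Sum>j<M. D j) at_top sequentially"
        by (rule not_summable_sum_at_top) (simp add: D_def)
      have d0: "0 \<le> d j" for j by (auto simp: d_def intro!: sum_nonneg)
      have le: "l i j \<le> exp (s j - D j)" for j
      proof -
        have "min (b i j) (q j) - max (a i j) (p j) \<le> 1 + (s j - D j)"
        proof -
          have m: "min (b i j) (q j) - max (a i j) (p j) \<le> q j - a i j"
            "min (b i j) (q j) - max (a i j) (p j) \<le> b i j - p j" by auto
          \<comment> \<open>The sign of the drift selects the end of the hull that cuts off the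
            overlap: \<open>q j - a i j\<close> if block \<open>i\<close> lies to the right of block
            \<open>k\<close>, \<open>b i j - p j\<close> if it lies to the left. In both cases the
            overlap loses \<open>D j\<close> up to summable terms.\<close>
          have "D j = a i j - a k j \<or> D j = a k j - a i j" by (auto simp: D_def)
          then show ?thesis
            using m pd[of j] qd[of j] d0[of j] abs_ge_self[of "b i j - a i j - 1"]
              abs_ge_self[of "b k j - a k j - 1"] abs_ge_zero[of "b i j - a i j - 1"]
              abs_ge_zero[of "b k j - a k j - 1"] unfolding s_def by linarith
        qed
        then have "l i j \<le> max 0 (1 + (s j - D j))" unfolding l_def measure_Ico_Int by auto
        also have "\<dots> \<le> exp (s j - D j)" using exp_ge_add_one_self[of "s j - D j"] by simp
        finally show ?thesis .
      qed
      have "(\<Prod>j<M. l i j) \<le> exp (suminf s) * exp (- (\<Sum>j<M. D j))" for M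
      proof -
        have "(\<Prod>j<M. l i j) \<le> (\<Prod>j<M. exp (s j - D j))"
          using l0 le by (intro prod_mono) auto
        also have "\<dots> = exp (\<Sum>j<M. s j) * exp (- (\<Sum>j<M. D j))"
          unfolding exp_diff prod_dividef by (simp add: exp_sum exp_minus divide_inverse)
        also have "(\<Sum>j<M. s j) \<le> suminf s"
          by (rule sum_le_suminf[OF ss]) (use d0 in \<open>auto simp: s_def\<close>)
        finally show ?thesis by simp
      qed
      moreover have "(\<lambda>M. exp (suminf s) * exp (- (\<Sum>j<M. D j))) \<longlonglongrightarrow> 0"
        by (intro tendsto_mult_right_zero filterlim_compose[OF exp_at_bot]
            filterlim_compose[OF filterlim_uminus_at_bot_at_top] D)
      ultimately show ?thesis by (rule tendsto_zero_le[rotated]) (auto intro: prod_nonneg l0)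
    qed
    then have "(\<lambda>M. w M i) \<longlonglongrightarrow> 0"
      by (rule tendsto_zero_le[rotated 2]) (auto simp: w_def intro!: prod_nonneg l0)
    then show ?thesis using False by simp
  qed
  have "(\<lambda>M. \<Sum>i<n. c i * w M i)
      \<longlonglongrightarrow> (\<Sum>i<n. c i * (if i \<in> C then block_measure e (a i) (b i) else 0))"
    by (intro tendsto_sum tendsto_mult tendsto_const w) auto
  moreover have "0 \<le> (\<Sum>i<n. c i * w M i)" for M
    using integrate_coordinates[OF nonneg, of p q M y] by (simp add: w_def l_def mult.assoc)
  ultimately have "0 \<le> (\<Sum>i<n. c i * (if i \<in> C then block_measure e (a i) (b i) else 0))"
    by (intro LIMSEQ_le_const) auto
  also have "\<dots> = (\<Sum>i\<in>C. c i * block_measure e (a i) (b i))"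
    by (intro sum.mono_neutral_cong_right) (auto simp: C_def)
  finally show ?thesis .
qed

text \<open>Closeness of lower corners is an equivalence relation, so \<open>cl\<close> can serve as
  the key by which the terms of positive measure are grouped; each group is a class as in
  \<open>class_nonneg\<close>. Terms of measure 0 drop out.\<close>

lemma blocks_nonneg:
  fixes n :: nat and a b :: "nat \<Rightarrow> nat \<Rightarrow> real" and c :: "nat \<Rightarrow> real"
  assumes meas: "\<And>i. i < n \<Longrightarrow> abs_measurable e (a i) (b i)"
    and ne: "\<And>i. i < n \<Longrightarrow> block e (a i) (b i) \<noteq> {}"
    and nonneg: "\<And>x. 0 \<le> (\<Sum>i<n. c i * indicator (block e (a i) (b i)) x)"
  shows "0 \<le> (\<Sum>i<n. c i * block_measure e (a i) (b i))"
proof -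
  let ?m = "\<lambda>i. block_measure e (a i) (b i)"
  define P where "P = {i. i < n \<and> 0 < ?m i}"
  define rel where "rel i k \<longleftrightarrow> summable (\<lambda>j. \<bar>a i j - a k j\<bar>)" for i k
  define cl where "cl k = {i. i < n \<and> 0 < ?m i \<and> rel i k}" for k
  have rel_trans: "rel i l" if "rel i k" "rel k l" for i k l
    unfolding rel_def
    by (rule summable_comparison_test'[where N = 0, OF summable_add[OF that[unfolded rel_def]]]) auto
  have rel_sym: "rel i k \<Longrightarrow> rel k i" for i k
    by (simp add: rel_def abs_minus_commute)
  have rel_refl: "rel i i" for i by (simp add: rel_def)
  have cl_eq: "{i \<in> P. cl i = cl k} = cl k" if "k \<in> P" for k
  proof
    show "{i \<in> P. cl i = cl k} \<subseteq> cl k"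
      using rel_refl by (auto simp: cl_def P_def)
    show "cl k \<subseteq> {i \<in> P. cl i = cl k}"
    proof
      fix i assume "i \<in> cl k"
      then have i: "i < n" "0 < ?m i" "rel i k" by (auto simp: cl_def)
      have "rel x i \<longleftrightarrow> rel x k" for x
        using rel_trans[OF _ i(3), of x] rel_trans[OF _ rel_sym[OF i(3)], of x] by blast
      then show "i \<in> {i \<in> P. cl i = cl k}" using i by (simp add: cl_def P_def)
    qed
  qed
  have "(\<Sum>i<n. c i * ?m i) = (\<Sum>i\<in>P. c i * ?m i)"
    using block_measure_tendsto(2)[OF meas ne]
    by (intro sum.mono_neutral_right) (auto simp: P_def order_less_le)
  also have "\<dots> = (\<Sum>K\<in>cl ` P. \<Sum>i\<in>{i \<in> P. cl i = K}. c i * ?m i)"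
    by (rule sum.image_gen) (simp add: P_def)
  also have "\<dots> \<ge> 0"
  proof (rule sum_nonneg, elim imageE)
    fix K k assume k: "K = cl k" "k \<in> P"
    then have "k < n" "0 < ?m k" by (auto simp: P_def)
    from class_nonneg[OF meas ne nonneg this] show "0 \<le> (\<Sum>i\<in>{i \<in> P. cl i = K}. c i * ?m i)"
      unfolding k(1) cl_eq[OF k(2)] by (simp add: cl_def rel_def)
  qed
  finally show ?thesis .
qed

subsection \<open>Existence and uniqueness of the measure on the ring\<close>

text \<open>The intended linear functional on the span of the block indicators, given as its graph:
  the value travels along with the function, because single-valuedness is precisely what has to be
  proved.\<close>

inductive block_comb :: "('a \<Rightarrow> real) \<Rightarrow> real \<Rightarrow> bool" where
  zero: "block_comb (\<lambda>x. 0) 0"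
| step: "abs_measurable e a b \<Longrightarrow> block_comb f l \<Longrightarrow>
    block_comb (\<lambda>x. f x + c * indicator (block e a b) x) (l + c * block_measure e a b)"

lemma block_comb_family:
  "block_comb f l \<Longrightarrow> \<exists>(n::nat) c a b. (\<forall>i<n. abs_measurable e (a i) (b i) \<and> block e (a i) (b i) \<noteq> {}) \<and>
     f = (\<lambda>x. \<Sum>i<n. c i * indicator (block e (a i) (b i)) x) \<and>
     l = (\<Sum>i<n. c i * block_measure e (a i) (b i))"
proof (induction rule: block_comb.induct)
  case zero
  then show ?case by (intro exI[of _ 0]) auto
next
  case (step a b f l c)
  from step.IH obtain n :: nat and c' a' b' where *: "\<forall>i<n. abs_measurable e (a' i) (b' i) \<and> block e (a' i) (b' i) \<noteq> {}"
     "f = (\<lambda>x. \<Sum>i<n. c' i * indicator (block e (a' i) (b' i)) x)"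
     "l = (\<Sum>i<n. c' i * block_measure e (a' i) (b' i))"
    by (elim exE conjE) (rule that)
  show ?case
  \<comment> \<open>Empty blocks have measure 0 by convention, whatever the product of their side
    lengths. They are discarded so that the limit formula holds for every block that
    remains.\<close>
  proof (cases "block e a b = {}")
    case True
    then have "block_measure e a b = 0" by (simp add: block_measure_def)
    then show ?thesis using True * by (intro exI[of _ n] exI[of _ c'] exI[of _ a'] exI[of _ b']) auto
  next
    case False
    let ?c = "c'(n := c)" and ?a = "a'(n := a)" and ?b = "b'(n := b)"
    have "\<forall>i<Suc n. abs_measurable e (?a i) (?b i) \<and> block e (?a i) (?b i) \<noteq> {}"
      using False * step by (auto simp: less_Suc_eq)
    moreover have "(\<lambda>x. f x + c * indicator (block e a b) x)
       = (\<lambda>x. \<Sum>i<Suc n. ?c i * indicator (block e (?a i) (?b i)) x)"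
      unfolding * by (rule ext) simp
    moreover have "l + c * block_measure e a b = (\<Sum>i<Suc n. ?c i * block_measure e (?a i) (?b i))"
      unfolding * by simp
    ultimately show ?thesis by blast
  qed
qed

lemma block_comb_nonneg:
  assumes "block_comb f l" "\<And>x. 0 \<le> f x"
  shows "0 \<le> l"
proof -
  obtain n :: nat and c a b where *: "\<forall>i<n. abs_measurable e (a i) (b i) \<and> block e (a i) (b i) \<noteq> {}"
     "f = (\<lambda>x. \<Sum>i<n. c i * indicator (block e (a i) (b i)) x)"
     "l = (\<Sum>i<n. c i * block_measure e (a i) (b i))"
    using block_comb_family[OF assms(1)] by blast
  then show ?thesis using blocks_nonneg[of n a b c] assms(2) by auto
qed

lemma block_comb_add:
  assumes "block_comb f l" "block_comb g l'"
  shows "block_comb (\<lambda>x. f x + g x) (l + l')"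
  using assms
proof (induction rule: block_comb.induct)
  case (step a b f l c)
  from block_comb.step[OF step(1) step.IH[OF step.prems], of c] show ?case by (simp add: ac_simps)
qed simp

lemma block_comb_scale: "block_comb f l \<Longrightarrow> block_comb (\<lambda>x. r * f x) (r * l)"
proof (induction rule: block_comb.induct)
  case zero
  show ?case using block_comb.zero by simp
next
  case (step a b f l c)
  from block_comb.step[OF step(1) step.IH, of "r * c"] show ?case by (simp add: algebra_simps)
qed

lemma block_comb_diff:
  "block_comb f l \<Longrightarrow> block_comb g l' \<Longrightarrow> block_comb (\<lambda>x. f x - g x) (l - l')"
  using block_comb_add[of f l "\<lambda>x. (- 1) * g x" "(- 1) * l'"] block_comb_scale[of g l' "- 1"] by simp

lemma block_comb_block:
  "abs_measurable e a b \<Longrightarrow> block_comb (indicator (block e a b)) (block_measure e a b)"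
  using block_comb.step[OF _ block_comb.zero, of a b 1] by simp

text \<open>The difference of two representations of \<open>f\<close> represents the zero function.
  Positivity applied to it in both orders gives the two inequalities.\<close>

lemma block_comb_unique: "block_comb f l \<Longrightarrow> block_comb f l' \<Longrightarrow> l = l'"
  using block_comb_nonneg[OF block_comb_diff[of f l f l']]
    block_comb_nonneg[OF block_comb_diff[of f l' f l]] by simp

lemma block_comb_mult_block:
  assumes "abs_measurable e a b" "block_comb f l"
  shows "\<exists>l'. block_comb (\<lambda>x. f x * indicator (block e a b) x) l'"
  using assms(2)
proof (induction rule: block_comb.induct)
  case zero
  show ?case using block_comb.zero by auto
next
  case (step a' b' f l c)
  then obtain l' where l': "block_comb (\<lambda>x. f x * indicator (block e a b) x) l'" by blast
  have eq: "(\<lambda>x. (f x + c * indicator (block e a' b') x) * indicator (block e a b) x)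
    = (\<lambda>x. f x * indicator (block e a b) x + c * indicator (block e a' b' \<inter> block e a b) x)"
    by (auto simp: indicator_def)
  show ?case
  proof (cases "block e a' b' \<inter> block e a b = {}")
    case True
    then show ?thesis using l' unfolding eq by auto
  next
    case False
    with block_Int[OF step(1), of a b] obtain a'' b'' where
      "abs_measurable e a'' b''" "block e a' b' \<inter> block e a b = block e a'' b''" by blast
    then show ?thesis unfolding eq using block_comb.step l' by metis
  qed
qed

text \<open>Intersections of blocks are blocks or empty, so the combinations form an algebra. This
  brings the indicators of unions and differences, and hence of all sets of the ring, into the
  domain of the functional.\<close>

lemma block_comb_mult:
  assumes "block_comb f l" "block_comb g l'"
  shows "\<exists>k. block_comb (\<lambda>x. f x * g x) k"
  using assms(2)
proof (induction rule: block_comb.induct)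
  case zero
  show ?case using block_comb.zero by auto
next
  case (step a b g l' c)
  then obtain k where k: "block_comb (\<lambda>x. f x * g x) k" by blast
  obtain k' where k': "block_comb (\<lambda>x. f x * indicator (block e a b) x) k'"
    using block_comb_mult_block[OF step(1) assms(1)] by blast
  from block_comb_add[OF k block_comb_scale[OF k', of c]] show ?case
    by (auto simp: algebra_simps)
qed

lemma block_comb_shift: "block_comb f l \<Longrightarrow> block_comb (\<lambda>x. f (x - v)) l"
proof (induction rule: block_comb.induct)
  case zero
  show ?case by (rule block_comb.zero)
next
  case (step a b f l c)
  have "indicator (block e a b) (x - v)
      = (indicator (block e (\<lambda>j. a j + v \<bullet> e j) (\<lambda>j. b j + v \<bullet> e j)) x :: real)" for x
    by (auto simp: block_def indicator_def inner_diff_left algebra_simps)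
  then show ?case
    using block_comb.step[OF abs_measurable_shift(1)[OF step(1), of v] step.IH, of c]
      abs_measurable_shift(2)[OF step(1)] by simp
qed

section \<open>The generated ring and the charge on it\<close>

lemma ring_of_sets_block_ring: "ring_of_sets UNIV (block_ring e)"
  unfolding block_ring_def
proof (rule hull_in)
  fix T :: "'a set set set" assume T: "Ball T (ring_of_sets UNIV)"
  show "ring_of_sets UNIV (\<Inter> T)"
  proof (rule ring_of_setsI)
    have R: "ring_of_sets UNIV M" if "M \<in> T" for M using T that by blast
    show "{} \<in> \<Inter> T"
      using R ring_of_sets.axioms(1) semiring_of_sets.empty_sets by blast
    fix a b assume "a \<in> \<Inter> T" "b \<in> \<Inter> T"
    then show "a \<union> b \<in> \<Inter> T" "a - b \<in> \<Inter> T"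
      using ring_of_sets.Un[OF R] ring_of_sets.Diff[OF R] by auto
  qed simp
qed

lemma block_in_ring: "abs_measurable e a b \<Longrightarrow> block e a b \<in> block_ring e"
  unfolding block_ring_def by (rule hull_inc) blast

text \<open>The induction principle for the generated ring: \<open>S\<close> is taken to be the
  family of all sets with the property in question.\<close>

lemma block_ring_subset:
  assumes "ring_of_sets UNIV S" "\<And>a b. abs_measurable e a b \<Longrightarrow> block e a b \<in> S"
  shows "block_ring e \<subseteq> S"
  unfolding block_ring_def using assms by (intro hull_minimal) auto

lemma block_ring_comb:
  assumes "A \<in> block_ring e"
  obtains l where "block_comb (indicator A) l"
proof -
  have "block_ring e \<subseteq> {A. \<exists>l. block_comb (indicator A) l}"
  proof (rule block_ring_subset[OF ring_of_setsI])
    fix A B assume "A \<in> {A. \<exists>l. block_comb (indicator A) l}" "B \<in> {A. \<exists>l. block_comb (indicator A) l}"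
    then obtain l l' where l: "block_comb (indicator A) l" and l': "block_comb (indicator B) l'" by blast
    obtain k where k: "block_comb (\<lambda>x. indicator A x * indicator B x) k"
      using block_comb_mult[OF l l'] by blast
    have "(\<lambda>x. indicator A x + indicator B x - indicator A x * indicator B x)
        = (indicator (A \<union> B) :: _ \<Rightarrow> real)" by (auto simp: indicator_def)
    then show "A \<union> B \<in> {A. \<exists>l. block_comb (indicator A) l}"
      using block_comb_diff[OF block_comb_add[OF l l'] k] by auto
    have "(\<lambda>x. indicator A x - indicator A x * indicator B x)
        = (indicator (A - B) :: _ \<Rightarrow> real)" by (auto simp: indicator_def)
    then show "A - B \<in> {A. \<exists>l. block_comb (indicator A) l}"
      using block_comb_diff[OF l k] by auto
  next
    have "indicator {} = (\<lambda>x::'a. 0::real)" by auto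
    then show "{} \<in> {A. \<exists>l. block_comb (indicator A) l}" using block_comb.zero by auto
  qed (use block_comb_block in auto)
  then show ?thesis using assms that by blast
qed

lemma shift_in_block_ring:
  assumes "A \<in> block_ring e"
  shows "(+) v ` A \<in> block_ring e"
proof -
  interpret R: ring_of_sets UNIV "block_ring e" by (rule ring_of_sets_block_ring)
  have "block_ring e \<subseteq> {A. (+) v ` A \<in> block_ring e}"
  proof (rule block_ring_subset[OF ring_of_setsI])
    fix A B assume "A \<in> {A. (+) v ` A \<in> block_ring e}" "B \<in> {A. (+) v ` A \<in> block_ring e}"
    then show "A - B \<in> {A. (+) v ` A \<in> block_ring e}"
      by (simp add: image_set_diff R.Diff)
  qed (auto simp: image_Un block_shift intro: block_in_ring abs_measurable_shift(1))
  then show ?thesis using assms by blast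
qed

definition block_charge :: "'a set \<Rightarrow> real" where
  "block_charge = restrict (\<lambda>A. THE l. block_comb (indicator A) l) (block_ring e)"

lemma block_charge_eq:
  "A \<in> block_ring e \<Longrightarrow> block_comb (indicator A) l \<Longrightarrow> block_charge A = l"
  by (auto simp: block_charge_def intro: block_comb_unique)

lemma fin_add_block_charge: "fin_add (block_ring e) block_charge"
proof -
  interpret R: ring_of_sets UNIV "block_ring e" by (rule ring_of_sets_block_ring)
  show ?thesis
  proof
    fix A assume A: "A \<in> block_ring e"
    then obtain l where l: "block_comb (indicator A) l" by (rule block_ring_comb)
    then show "0 \<le> block_charge A"
      using block_comb_nonneg[OF l] block_charge_eq[OF A l] by simp
  next
    fix A B assume A: "A \<in> block_ring e" and B: "B \<in> block_ring e" and "A \<inter> B = {}"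
    obtain l where l: "block_comb (indicator A) l" using A by (rule block_ring_comb)
    obtain l' where l': "block_comb (indicator B) l'" using B by (rule block_ring_comb)
    have "(\<lambda>x. indicator A x + indicator B x) = (indicator (A \<union> B) :: _ \<Rightarrow> real)"
      using \<open>A \<inter> B = {}\<close> by (intro ext) (auto simp: indicator_def)
    with block_comb_add[OF l l'] have "block_comb (indicator (A \<union> B)) (l + l')" by simp
    then show "block_charge (A \<union> B) = block_charge A + block_charge B"
      using block_charge_eq[OF R.Un[OF A B]] block_charge_eq[OF A l] block_charge_eq[OF B l'] by simp
  qed
qed

text \<open>Meant for uniqueness: a competing charge with the right values on blocks integrates the
  indicator of a ring set to its own value on that set, and also to the number prescribed by any
  block combination.\<close>

lemma block_comb_intg:
  assumes "fin_add (block_ring e) m" "\<And>a b. abs_measurable e a b \<Longrightarrow> m (block e a b) = block_measure e a b"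
    and "block_comb f l"
  shows "fin_add.smp (block_ring e) f \<and> fin_add.intg m f = l"
proof -
  interpret M: fin_add "block_ring e" m by (rule assms)
  show ?thesis using assms(3)
  proof (induction rule: block_comb.induct)
    case zero
    show ?case by (simp add: M.smp_zero M.intg_def)
  next
    case (step a b f l c)
    note B = block_in_ring[OF step(1)]
    have s: "M.smp (\<lambda>x. c * indicat_real (block e a b) x)"
      using M.smp_indicator[OF B, of c] by (simp add: mult.commute)
    have "M.intg (\<lambda>x. c * indicat_real (block e a b) x) = c * block_measure e a b"
      using M.intg_linear[OF M.smp_indicat_real[OF B] linear_times, of c]
      by (simp add: M.intg_indicat_real[OF B] assms(2)[OF step(1)])
    then show ?case using step.IH s by (simp add: M.smp_add M.intg_add)
  qed
qed

lemma ring_measure_eq: "ring_measure e = block_charge"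
  unfolding ring_measure_def
proof (rule the_equality)
  interpret M: fin_add "block_ring e" block_charge by (rule fin_add_block_charge)
  have "block_charge ((+) v ` A) = block_charge A" if A: "A \<in> block_ring e" for A v
  proof -
    obtain l where l: "block_comb (indicator A) l" using A by (rule block_ring_comb)
    have "(\<lambda>x. indicator A (x - v)) = (indicator ((+) v ` A) :: _ \<Rightarrow> real)"
    proof
      fix x
      have "x - v \<in> A \<longleftrightarrow> x \<in> (+) v ` A"
        by (metis (no_types, lifting) add.commute add_diff_cancel diff_add_cancel imageE imageI)
      then show "indicator A (x - v) = (indicator ((+) v ` A) x :: real)" by (simp add: indicator_def)
    qed
    with block_comb_shift[OF l, of v] have "block_comb (indicator ((+) v ` A)) l" by simp
    then show ?thesis using block_charge_eq shift_in_block_ring A l by metis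
  qed
  then show "block_charge \<in> extensional (block_ring e) \<and>
     (\<forall>A \<in> block_ring e. 0 \<le> block_charge A) \<and>
     (\<forall>A \<in> block_ring e. \<forall>B \<in> block_ring e. A \<inter> B = {} \<longrightarrow>
       block_charge (A \<union> B) = block_charge A + block_charge B) \<and>
     (\<forall>A \<in> block_ring e. \<forall>v. block_charge ((+) v ` A) = block_charge A) \<and>
     (\<forall>a b. abs_measurable e a b \<longrightarrow> block_charge (block e a b) = block_measure e a b)"
    using block_charge_eq block_in_ring block_comb_block
    by (auto intro: M.m_nonneg M.m_Un) (simp add: block_charge_def)
next
  fix m assume m: "m \<in> extensional (block_ring e) \<and>
     (\<forall>A \<in> block_ring e. 0 \<le> m A) \<and>
     (\<forall>A \<in> block_ring e. \<forall>B \<in> block_ring e. A \<inter> B = {} \<longrightarrow> m (A \<union> B) = m A + m B) \<and>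
     (\<forall>A \<in> block_ring e. \<forall>v. m ((+) v ` A) = m A) \<and>
     (\<forall>a b. abs_measurable e a b \<longrightarrow> m (block e a b) = block_measure e a b)"
  have M: "fin_add (block_ring e) m"
    using m ring_of_sets_block_ring by (auto simp: fin_add_def fin_add_axioms_def)
  show "m = block_charge"
  proof (rule extensionalityI)
    fix A assume A: "A \<in> block_ring e"
    obtain l where l: "block_comb (indicator A) l" using A by (rule block_ring_comb)
    have "m A = l"
      using block_comb_intg[OF M _ l] m fin_add.intg_indicat_real[OF M A] by simp
    then show "m A = block_charge A" using block_charge_eq[OF A l] by simp
  qed (use m in \<open>auto simp: block_charge_def\<close>)
qed

lemma fin_add_ring_measure: "fin_add (block_ring e) (ring_measure e)"
  unfolding ring_measure_eq by (rule fin_add_block_charge)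

sublocale R: fin_add "block_ring e" "ring_measure e"
  by (rule fin_add_ring_measure)

lemma complete_ring_eq: "complete_ring e = R.completion"
  by (simp add: complete_ring_def R.completion_def inner_lambda_def R.inner_m_def outer_lambda_def
      R.outer_def)

lemma lambda_eq: "lambda e = R.outer"
  by (rule ext) (simp add: lambda_def outer_lambda_def R.outer_def)

sublocale C: fin_add "complete_ring e" "lambda e"
  unfolding complete_ring_eq lambda_eq by (rule R.fin_add_completion)

section \<open>The Hilbert space\<close>

text \<open>A disjoint representation is recovered from the level sets of the nonzero values. It
  moves the whole theory of \<open>smp\<close> functions over the completed ring to the functions in
  \<open>simple\<close>.\<close>

lemma simple_iff: "f \<in> simple e \<longleftrightarrow> C.smp f"
proof
  assume "f \<in> simple e"
  then obtain n :: nat and c B where B: "\<And>k. k < n \<Longrightarrow> B k \<in> complete_ring e"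
    and f: "f = (\<lambda>x. \<Sum>k<n. c k * indicator (B k) x)"
    by (auto simp: simple_def)
  have "(\<lambda>x. c k * indicator (B k) x) = (\<lambda>x. indicat_real (B k) x *\<^sub>R c k)" for k
    by (rule ext) (simp add: indicator_def)
  then show "C.smp f" unfolding f using B
    by (intro C.smp_sum) (auto intro!: C.smp_indicator)
next
  assume f: "C.smp f"
  then have fin: "finite (range f - {0})" by (simp add: C.smp_def)
  obtain c and n :: nat where c: "bij_betw c {..<n} (range f - {0})"
    using ex_bij_betw_nat_finite[OF fin] by (auto simp: atLeast0LessThan)
  define B where "B k = f -` {c k}" for k
  have ck: "c k \<in> range f - {0}" if "k < n" for k using c that by (auto simp: bij_betw_def)
  have "\<forall>k<n. B k \<in> complete_ring e" using f ck by (auto simp: C.smp_def B_def)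
  moreover have "disjoint_family_on B {..<n}"
    using c by (auto simp: disjoint_family_on_def B_def bij_betw_def inj_on_def)
  moreover have "f x = (\<Sum>k<n. c k * indicator (B k) x)" for x
  proof -
    have "(\<Sum>k<n. c k * indicator (B k) x) = (\<Sum>k<n. (\<lambda>z. z * indicator (f -` {z}) x) (c k))"
      by (simp add: B_def)
    also have "\<dots> = (\<Sum>z\<in>range f - {0}. z * indicator (f -` {z}) x)"
      by (rule sum.reindex_bij_betw[OF c])
    also have "\<dots> = (\<Sum>z\<in>range f - {0}. if z = f x then z else 0)"
      by (intro sum.cong) (auto simp: indicator_def)
    also have "\<dots> = f x" using fin by simp
    finally show ?thesis by simp
  qed
  ultimately show "f \<in> simple e" unfolding simple_def by blast
qed

lemma simple_norm_eq: "simple_norm e = C.nrm"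
  by (rule ext) (simp add: simple_norm_def C.nrm_def)

lemma simple_inner_eq: "simple_inner e = C.inn"
  by (intro ext) (simp add: simple_inner_def C.inn_def)

section \<open>Cauchy sequences of simple functions and their classes\<close>

abbreviation cauchy where "cauchy \<equiv> cauchy_simple e"

lemma cauchy_smp: "s \<in> cauchy \<Longrightarrow> C.smp (s n)"
  by (simp add: cauchy_simple_def simple_iff)

lemma cauchyD:
  assumes "s \<in> cauchy" "0 < \<epsilon>"
  obtains N where "\<And>m n. N \<le> m \<Longrightarrow> N \<le> n \<Longrightarrow> C.nrm (\<lambda>x. s m x - s n x) < \<epsilon>"
  using assms unfolding cauchy_simple_def simple_norm_eq by blast

lemma cauchyI:
  assumes "\<And>n. C.smp (s n)"
    "\<And>\<epsilon>. 0 < \<epsilon> \<Longrightarrow> \<exists>N. \<forall>m\<ge>N. \<forall>n\<ge>N. C.nrm (\<lambda>x. s m x - s n x) < \<epsilon>"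
  shows "s \<in> cauchy"
  using assms by (simp add: cauchy_simple_def simple_iff simple_norm_eq)

lemma cauchy_nrm_convergent:
  assumes "s \<in> cauchy"
  shows "convergent (\<lambda>n. C.nrm (s n))"
proof (rule Cauchy_convergent, rule CauchyI)
  fix \<epsilon> :: real assume "0 < \<epsilon>"
  then obtain N where N: "\<And>m n. N \<le> m \<Longrightarrow> N \<le> n \<Longrightarrow> C.nrm (\<lambda>x. s m x - s n x) < \<epsilon>"
    using cauchyD[OF assms] by metis
  have "norm (C.nrm (s m) - C.nrm (s n)) < \<epsilon>" if "N \<le> m" "N \<le> n" for m n
    using C.nrm_diff_le[OF cauchy_smp[OF assms] cauchy_smp[OF assms], of m n] N[OF that] by simp
  then show "\<exists>M. \<forall>m\<ge>M. \<forall>n\<ge>M. norm (C.nrm (s m) - C.nrm (s n)) < \<epsilon>" by blast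
qed

lemma cauchy_add:
  assumes s: "s \<in> cauchy" and r: "r \<in> cauchy"
  shows "(\<lambda>n x. s n x + r n x) \<in> cauchy"
proof (rule cauchyI)
  fix \<epsilon> :: real assume "0 < \<epsilon>"
  obtain N where N: "\<And>m n. N \<le> m \<Longrightarrow> N \<le> n \<Longrightarrow> C.nrm (\<lambda>x. s m x - s n x) < \<epsilon> / 2"
    using cauchyD[OF s, of "\<epsilon> / 2"] \<open>0 < \<epsilon>\<close> by (metis half_gt_zero)
  obtain M where M: "\<And>m n. M \<le> m \<Longrightarrow> M \<le> n \<Longrightarrow> C.nrm (\<lambda>x. r m x - r n x) < \<epsilon> / 2"
    using cauchyD[OF r, of "\<epsilon> / 2"] \<open>0 < \<epsilon>\<close> by (metis half_gt_zero)
  have "C.nrm (\<lambda>x. s m x + r m x - (s n x + r n x)) < \<epsilon>" if "max N M \<le> m" "max N M \<le> n" for m n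
  proof -
    have "(\<lambda>x. s m x + r m x - (s n x + r n x)) = (\<lambda>x. (s m x - s n x) + (r m x - r n x))" by auto
    then show ?thesis
      using C.nrm_triangle[OF C.smp_diff[OF cauchy_smp[OF s, of m] cauchy_smp[OF s, of n]]
          C.smp_diff[OF cauchy_smp[OF r, of m] cauchy_smp[OF r, of n]]]
        N[of m n] M[of m n] that by simp
  qed
  then show "\<exists>N. \<forall>m\<ge>N. \<forall>n\<ge>N. C.nrm (\<lambda>x. s m x + r m x - (s n x + r n x)) < \<epsilon>" by blast
qed (intro C.smp_add cauchy_smp s r)

lemma cauchy_scale:
  assumes s: "s \<in> cauchy"
  shows "(\<lambda>n x. c * s n x) \<in> cauchy"
proof (rule cauchyI)
  fix \<epsilon> :: real assume "0 < \<epsilon>"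
  have pos: "0 < cmod c + 1" by (simp add: add_nonneg_pos)
  with \<open>0 < \<epsilon>\<close> have "0 < \<epsilon> / (cmod c + 1)" by simp
  then obtain N where N: "\<And>m n. N \<le> m \<Longrightarrow> N \<le> n \<Longrightarrow> C.nrm (\<lambda>x. s m x - s n x) < \<epsilon> / (cmod c + 1)"
    using cauchyD[OF s] by metis
  have "C.nrm (\<lambda>x. c * s m x - c * s n x) < \<epsilon>" if "N \<le> m" "N \<le> n" for m n
  proof -
    note d = C.smp_diff[OF cauchy_smp[OF s, of m] cauchy_smp[OF s, of n]]
    have "C.nrm (\<lambda>x. c * s m x - c * s n x) = cmod c * C.nrm (\<lambda>x. s m x - s n x)"
      using C.nrm_mult_left[OF d, of c] by (simp add: right_diff_distrib)
    also have "\<dots> \<le> (cmod c + 1) * C.nrm (\<lambda>x. s m x - s n x)"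
      using C.nrm_nonneg[OF d] by (intro mult_right_mono) auto
    also have "\<dots> < \<epsilon>" using N[OF that] pos by (simp only: pos_less_divide_eq mult.commute)
    finally show ?thesis .
  qed
  then show "\<exists>N. \<forall>m\<ge>N. \<forall>n\<ge>N. C.nrm (\<lambda>x. c * s m x - c * s n x) < \<epsilon>" by blast
qed (intro C.smp_mult_left cauchy_smp s)

lemma cauchy_diff: "s \<in> cauchy \<Longrightarrow> r \<in> cauchy \<Longrightarrow> (\<lambda>n x. s n x - r n x) \<in> cauchy"
  using cauchy_add[OF _ cauchy_scale, of s r "- 1"] by simp

lemma null_rel_iff:
  "(s, r) \<in> null_rel e \<longleftrightarrow> s \<in> cauchy \<and> r \<in> cauchy \<and> (\<lambda>n. C.nrm (\<lambda>x. s n x - r n x)) \<longlonglongrightarrow> 0"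
  by (simp add: null_rel_def simple_norm_eq)

lemma equiv_null_rel: "equiv cauchy (null_rel e)"
proof (rule equivI)
  show "null_rel e \<subseteq> cauchy \<times> cauchy" by (auto simp: null_rel_iff)
  show "refl_on cauchy (null_rel e)" by (simp add: refl_on_def null_rel_iff C.nrm_zero)
  show "sym (null_rel e)"
  proof (rule symI)
    fix s r assume "(s, r) \<in> null_rel e"
    then show "(r, s) \<in> null_rel e"
      using C.nrm_minus_commute[OF cauchy_smp cauchy_smp, of s r] by (simp add: null_rel_iff)
  qed
  show "trans (null_rel e)"
  proof (rule transI)
    fix s r q assume sr: "(s, r) \<in> null_rel e" and rq: "(r, q) \<in> null_rel e"
    then have sm: "C.smp (s n)" "C.smp (r n)" "C.smp (q n)" for n
      by (auto simp: null_rel_iff cauchy_smp)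
    have "(\<lambda>n. C.nrm (\<lambda>x. s n x - r n x) + C.nrm (\<lambda>x. r n x - q n x)) \<longlonglongrightarrow> 0"
      using sr rq by (intro tendsto_add_zero) (auto simp: null_rel_iff)
    then have "(\<lambda>n. C.nrm (\<lambda>x. s n x - q n x)) \<longlonglongrightarrow> 0"
      by (rule tendsto_zero_le[rotated 2]) (auto intro!: C.nrm_nonneg C.smp_diff C.nrm_triangle_diff sm)
    then show "(s, q) \<in> null_rel e" using sr rq by (auto simp: null_rel_iff)
  qed
qed

abbreviation cls where "cls s \<equiv> null_rel e `` {s}"

lemma cls_HE: "s \<in> cauchy \<Longrightarrow> cls s \<in> HE e"
  by (auto simp: HE_def quotientI)

lemma self_cls: "s \<in> cauchy \<Longrightarrow> s \<in> cls s"
  by (rule equiv_class_self[OF equiv_null_rel])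

lemma HE_cauchy: "F \<in> HE e \<Longrightarrow> s \<in> F \<Longrightarrow> s \<in> cauchy"
  using in_quotient_imp_subset[OF equiv_null_rel] by (auto simp: HE_def)

lemma rep_in: "F \<in> HE e \<Longrightarrow> rep F \<in> F"
  using in_quotient_imp_non_empty[OF equiv_null_rel, of F] by (auto simp: HE_def rep_def some_in_eq)

lemma HE_eq_iff:
  assumes "F \<in> HE e" "G \<in> HE e" "s \<in> F" "r \<in> G"
  shows "F = G \<longleftrightarrow> (\<lambda>n. C.nrm (\<lambda>x. s n x - r n x)) \<longlonglongrightarrow> 0"
  using quotient_eq_iff[OF equiv_null_rel _ _ assms(3,4)] assms HE_cauchy
  by (auto simp: HE_def null_rel_iff)

lemma HE_cls: "F \<in> HE e \<Longrightarrow> s \<in> F \<Longrightarrow> F = cls s"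
  using HE_eq_iff[of F "cls s" s s] cls_HE[of s] self_cls[of s] HE_cauchy[of F s]
  by (simp add: C.nrm_zero)

lemma h_add_HE: "F \<in> HE e \<Longrightarrow> G \<in> HE e \<Longrightarrow> h_add e F G \<in> HE e"
  unfolding h_add_def by (intro cls_HE cauchy_add HE_cauchy[OF _ rep_in])

lemma h_scale_HE: "F \<in> HE e \<Longrightarrow> h_scale e c F \<in> HE e"
  unfolding h_scale_def by (intro cls_HE cauchy_scale HE_cauchy[OF _ rep_in])

lemma HE_mem_iff:
  assumes "F \<in> HE e" "s \<in> F"
  shows "r \<in> F \<longleftrightarrow> r \<in> cauchy \<and> (\<lambda>n. C.nrm (\<lambda>x. s n x - r n x)) \<longlonglongrightarrow> 0"
  using HE_cls[OF assms] HE_cauchy[OF assms] by (auto simp: null_rel_iff)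

text \<open>\<open>h_add\<close> is defined through the representatives picked by
  \<open>rep\<close>. The triangle inequality shows that any other representatives lead to the same
  class, so that the choice can be forgotten afterwards.\<close>

lemma in_h_add:
  assumes F: "F \<in> HE e" "s \<in> F" and G: "G \<in> HE e" "r \<in> G"
  shows "(\<lambda>n x. s n x + r n x) \<in> h_add e F G"
proof -
  let ?s = "rep F" and ?r = "rep G"
  note cs = HE_cauchy[OF F] HE_cauchy[OF G] HE_cauchy[OF F(1) rep_in[OF F(1)]]
    HE_cauchy[OF G(1) rep_in[OF G(1)]]
  have "(\<lambda>n. C.nrm (\<lambda>x. ?s n x - s n x) + C.nrm (\<lambda>x. ?r n x - r n x)) \<longlonglongrightarrow> 0"
    using HE_mem_iff[OF F(1) rep_in[OF F(1)]] HE_mem_iff[OF G(1) rep_in[OF G(1)]] F G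
    by (intro tendsto_add_zero) auto
  then have "(\<lambda>n. C.nrm (\<lambda>x. (?s n x + ?r n x) - (s n x + r n x))) \<longlonglongrightarrow> 0"
  proof (rule tendsto_zero_le[rotated 2])
    fix n
    show "0 \<le> C.nrm (\<lambda>x. (?s n x + ?r n x) - (s n x + r n x))"
      using cs by (intro C.nrm_nonneg C.smp_diff C.smp_add cauchy_smp)
    have "(\<lambda>x. (?s n x + ?r n x) - (s n x + r n x)) = (\<lambda>x. (?s n x - s n x) + (?r n x - r n x))" by auto
    then show "C.nrm (\<lambda>x. (?s n x + ?r n x) - (s n x + r n x))
        \<le> C.nrm (\<lambda>x. ?s n x - s n x) + C.nrm (\<lambda>x. ?r n x - r n x)"
      using cs C.nrm_triangle[of "\<lambda>x. ?s n x - s n x" "\<lambda>x. ?r n x - r n x"]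
      by (simp add: C.smp_diff cauchy_smp)
  qed
  then show ?thesis unfolding h_add_def using cs by (simp add: null_rel_iff cauchy_add)
qed

lemma in_h_scale:
  assumes F: "F \<in> HE e" "s \<in> F"
  shows "(\<lambda>n x. c * s n x) \<in> h_scale e c F"
proof -
  let ?s = "rep F"
  note cs = HE_cauchy[OF F] HE_cauchy[OF F(1) rep_in[OF F(1)]]
  have "(\<lambda>n. cmod c * C.nrm (\<lambda>x. ?s n x - s n x)) \<longlonglongrightarrow> 0"
    using HE_mem_iff[OF F(1) rep_in[OF F(1)]] F by (intro tendsto_mult_right_zero) auto
  moreover have "cmod c * C.nrm (\<lambda>x. ?s n x - s n x) = C.nrm (\<lambda>x. c * ?s n x - c * s n x)" for n
    using C.nrm_mult_left[OF C.smp_diff[OF cauchy_smp[OF cs(2)] cauchy_smp[OF cs(1)]], of c n n]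
    by (simp add: right_diff_distrib)
  ultimately show ?thesis unfolding h_scale_def using cs by (simp add: null_rel_iff cauchy_scale)
qed

lemma h_diff_HE: "F \<in> HE e \<Longrightarrow> G \<in> HE e \<Longrightarrow> h_diff e F G \<in> HE e"
  by (simp add: h_diff_def h_add_HE h_scale_HE)

lemma in_h_diff:
  assumes "F \<in> HE e" "s \<in> F" "G \<in> HE e" "r \<in> G"
  shows "(\<lambda>n x. s n x - r n x) \<in> h_diff e F G"
  using in_h_add[OF assms(1,2) h_scale_HE[OF assms(3)] in_h_scale[OF assms(3,4)], of "- 1"]
  by (simp add: h_diff_def)

lemma h_norm_tendsto:
  assumes F: "F \<in> HE e" "s \<in> F"
  shows "(\<lambda>n. C.nrm (s n)) \<longlonglongrightarrow> h_norm e F"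
proof -
  let ?s = "rep F"
  note cs = HE_cauchy[OF F] HE_cauchy[OF F(1) rep_in[OF F(1)]]
  have lim: "(\<lambda>n. C.nrm (?s n)) \<longlonglongrightarrow> h_norm e F"
    using cauchy_nrm_convergent[OF cs(2)] by (simp add: h_norm_def simple_norm_eq convergent_LIMSEQ_iff)
  have "(\<lambda>n. C.nrm (\<lambda>x. ?s n x - s n x)) \<longlonglongrightarrow> 0"
    using HE_mem_iff[OF F(1) rep_in[OF F(1)]] F by blast
  then have "(\<lambda>n. C.nrm (?s n) - C.nrm (s n)) \<longlonglongrightarrow> 0"
    by (rule Lim_null_comparison[rotated])
      (auto intro!: always_eventually C.nrm_diff_le cauchy_smp cs)
  from tendsto_diff[OF lim this] show ?thesis by simp
qed

text \<open>The limits in \<open>S_hat\<close> and \<open>strongly_continuous\<close> and the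
  supremum in the theorem all have this form; naming it lets them be treated as statements about a
  metric.\<close>

definition hdist where "hdist F G = h_norm e (h_diff e F G)"

lemma hdist_tendsto:
  assumes "F \<in> HE e" "s \<in> F" "G \<in> HE e" "r \<in> G"
  shows "(\<lambda>n. C.nrm (\<lambda>x. s n x - r n x)) \<longlonglongrightarrow> hdist F G"
  unfolding hdist_def using assms by (intro h_norm_tendsto h_diff_HE in_h_diff)

lemma hdist_nonneg: "F \<in> HE e \<Longrightarrow> G \<in> HE e \<Longrightarrow> 0 \<le> hdist F G"
  by (rule LIMSEQ_le_const[OF hdist_tendsto[OF _ rep_in _ rep_in]])
    (auto intro!: C.nrm_nonneg C.smp_diff cauchy_smp HE_cauchy[OF _ rep_in])

lemma hdist_triangle:
  assumes "F \<in> HE e" "G \<in> HE e" "H \<in> HE e"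
  shows "hdist G H \<le> hdist F G + hdist F H"
proof (rule LIMSEQ_le)
  note cs = cauchy_smp[OF HE_cauchy[OF assms(1) rep_in[OF assms(1)]]]
    cauchy_smp[OF HE_cauchy[OF assms(2) rep_in[OF assms(2)]]]
    cauchy_smp[OF HE_cauchy[OF assms(3) rep_in[OF assms(3)]]]
  show "(\<lambda>n. C.nrm (\<lambda>x. rep G n x - rep H n x)) \<longlonglongrightarrow> hdist G H"
    using assms by (intro hdist_tendsto rep_in)
  show "(\<lambda>n. C.nrm (\<lambda>x. rep F n x - rep G n x) + C.nrm (\<lambda>x. rep F n x - rep H n x))
      \<longlonglongrightarrow> hdist F G + hdist F H"
    using assms by (intro tendsto_add hdist_tendsto rep_in)
  have "C.nrm (\<lambda>x. rep G n x - rep H n x)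
      \<le> C.nrm (\<lambda>x. rep F n x - rep G n x) + C.nrm (\<lambda>x. rep F n x - rep H n x)" for n
    using C.nrm_triangle_diff[OF cs(2)[of n] cs(1)[of n] cs(3)[of n]]
      C.nrm_minus_commute[OF cs(1)[of n] cs(2)[of n]] by simp
  then show "\<exists>N. \<forall>n\<ge>N. C.nrm (\<lambda>x. rep G n x - rep H n x)
      \<le> C.nrm (\<lambda>x. rep F n x - rep G n x) + C.nrm (\<lambda>x. rep F n x - rep H n x)" by blast
qed

lemma hdist_eq_0:
  assumes F: "F \<in> HE e" and G: "G \<in> HE e" and "hdist F G = 0"
  shows "F = G"
  using HE_eq_iff[OF F G rep_in[OF F] rep_in[OF G]]
    hdist_tendsto[OF F rep_in[OF F] G rep_in[OF G]] assms(3) by simp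

section \<open>Multiplication operators\<close>

text \<open>Convergence of the upper seminorm to 0 in terms of explicit majorants, which avoids
  computing with infima in \<open>ennreal\<close>. The functions \<open>g n\<close> are not assumed
  simple.\<close>

definition vanishing :: "(nat \<Rightarrow> 'a \<Rightarrow> complex) \<Rightarrow> bool" where
  "vanishing g \<longleftrightarrow> (\<forall>\<epsilon>>0. \<forall>\<^sub>F n in sequentially.
     \<exists>q. C.smp q \<and> (\<forall>x. cmod (g n x) \<le> cmod (q x)) \<and> C.nrm q < \<epsilon>)"

lemma upper_norm_tendsto_0_iff: "(\<lambda>n. upper_norm e (g n)) \<longlonglongrightarrow> 0 \<longleftrightarrow> vanishing g"
proof -
  have iff: "upper_norm e (g n) < ennreal \<epsilon> \<longleftrightarrow>
     (\<exists>q. C.smp q \<and> (\<forall>x. cmod (g n x) \<le> cmod (q x)) \<and> C.nrm q < \<epsilon>)" if "0 < \<epsilon>" for n \<epsilon>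
  proof -
    have "ennreal (C.nrm q) < ennreal \<epsilon> \<longleftrightarrow> C.nrm q < \<epsilon>" for q
      using that by (meson ennreal_lessI ennreal_leI not_le)
    then show ?thesis
      unfolding upper_norm_def INF_less_iff simple_norm_eq simple_iff by auto
  qed
  show ?thesis
  proof
    assume lim: "(\<lambda>n. upper_norm e (g n)) \<longlonglongrightarrow> 0"
    show "vanishing g" unfolding vanishing_def
    proof (intro allI impI)
      fix \<epsilon> :: real assume "0 < \<epsilon>"
      then have "\<forall>\<^sub>F n in sequentially. upper_norm e (g n) < ennreal \<epsilon>"
        using lim by (intro order_tendstoD) auto
      then show "\<forall>\<^sub>F n in sequentially.
         \<exists>q. C.smp q \<and> (\<forall>x. cmod (g n x) \<le> cmod (q x)) \<and> C.nrm q < \<epsilon>"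
        using iff[OF \<open>0 < \<epsilon>\<close>] by simp
    qed
  next
    assume v: "vanishing g"
    show "(\<lambda>n. upper_norm e (g n)) \<longlonglongrightarrow> 0"
    proof (rule order_tendstoI)
      fix a :: ennreal assume "0 < a"
      then obtain b where b: "0 < b" "b < a" using dense by blast
      then obtain \<epsilon> where \<epsilon>: "b = ennreal \<epsilon>" "0 \<le> \<epsilon>" by (cases b) auto
      have "0 < \<epsilon>" using b \<epsilon> by simp
      with v have "\<forall>\<^sub>F n in sequentially. upper_norm e (g n) < ennreal \<epsilon>"
        by (simp add: vanishing_def iff)
      then show "\<forall>\<^sub>F n in sequentially. upper_norm e (g n) < a"
        by eventually_elim (use b \<epsilon> in auto)
    qed simp
  qed
qed

lemma vanishing_dom:
  assumes "vanishing g" "\<And>n x. cmod (h n x) \<le> cmod (g n x)"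
  shows "vanishing h"
  unfolding vanishing_def
proof (intro allI impI)
  fix \<epsilon> :: real assume "0 < \<epsilon>"
  then have "\<forall>\<^sub>F n in sequentially. \<exists>q. C.smp q \<and> (\<forall>x. cmod (g n x) \<le> cmod (q x)) \<and> C.nrm q < \<epsilon>"
    using assms(1) by (simp add: vanishing_def)
  then show "\<forall>\<^sub>F n in sequentially. \<exists>q. C.smp q \<and> (\<forall>x. cmod (h n x) \<le> cmod (q x)) \<and> C.nrm q < \<epsilon>"
    by eventually_elim (meson assms(2) order_trans)
qed

lemma vanishing_add:
  assumes "vanishing g" "vanishing h"
  shows "vanishing (\<lambda>n x. g n x + h n x)"
  unfolding vanishing_def
proof (intro allI impI)
  fix \<epsilon> :: real assume "0 < \<epsilon>"
  then have "\<forall>\<^sub>F n in sequentially. \<exists>q. C.smp q \<and> (\<forall>x. cmod (g n x) \<le> cmod (q x)) \<and> C.nrm q < \<epsilon> / 2"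
    "\<forall>\<^sub>F n in sequentially. \<exists>q. C.smp q \<and> (\<forall>x. cmod (h n x) \<le> cmod (q x)) \<and> C.nrm q < \<epsilon> / 2"
    using assms[unfolded vanishing_def] half_gt_zero[OF \<open>0 < \<epsilon>\<close>] by blast+
  then show "\<forall>\<^sub>F n in sequentially.
      \<exists>q. C.smp q \<and> (\<forall>x. cmod (g n x + h n x) \<le> cmod (q x)) \<and> C.nrm q < \<epsilon>"
  proof eventually_elim
    case (elim n)
    then obtain p q where pq: "C.smp p" "\<And>x. cmod (g n x) \<le> cmod (p x)" "C.nrm p < \<epsilon> / 2"
      "C.smp q" "\<And>x. cmod (h n x) \<le> cmod (q x)" "C.nrm q < \<epsilon> / 2" by blast
    obtain f where f: "C.smp f" "\<And>x. cmod (f x) = cmod (p x) + cmod (q x)" "C.nrm f \<le> C.nrm p + C.nrm q"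
      using C.majorant_add[OF pq(1,4)] by blast
    have "cmod (g n x + h n x) \<le> cmod (f x)" for x
      using norm_triangle_ineq[of "g n x" "h n x"] pq(2,5)[of x] f(2)[of x] by linarith
    then show ?case using f(1,3) pq(3,6) by (intro exI[of _ f]) auto
  qed
qed

text \<open>By monotonicity of \<open>nrm\<close>, a simple function is its own best
  majorant.\<close>

lemma vanishing_smp_iff:
  assumes "\<And>n. C.smp (g n)"
  shows "vanishing g \<longleftrightarrow> (\<lambda>n. C.nrm (g n)) \<longlonglongrightarrow> 0"
proof
  assume v: "vanishing g"
  show "(\<lambda>n. C.nrm (g n)) \<longlonglongrightarrow> 0"
  proof (rule order_tendstoI)
    fix \<epsilon> :: real assume "0 < \<epsilon>"
    then have "\<forall>\<^sub>F n in sequentially. \<exists>q. C.smp q \<and> (\<forall>x. cmod (g n x) \<le> cmod (q x)) \<and> C.nrm q < \<epsilon>"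
      using v by (simp add: vanishing_def)
    then show "\<forall>\<^sub>F n in sequentially. C.nrm (g n) < \<epsilon>"
      by eventually_elim (meson assms C.nrm_mono le_less_trans)
  next
    fix a :: real assume "a < 0"
    then show "\<forall>\<^sub>F n in sequentially. a < C.nrm (g n)"
      using C.nrm_nonneg[OF assms] by (intro always_eventually allI) (auto intro: less_le_trans)
  qed
next
  assume lim: "(\<lambda>n. C.nrm (g n)) \<longlonglongrightarrow> 0"
  show "vanishing g" unfolding vanishing_def
  proof (intro allI impI)
    fix \<epsilon> :: real assume "0 < \<epsilon>"
    then have "\<forall>\<^sub>F n in sequentially. C.nrm (g n) < \<epsilon>" using lim by (rule order_tendstoD(2)[rotated])
    then show "\<forall>\<^sub>F n in sequentially. \<exists>q. C.smp q \<and> (\<forall>x. cmod (g n x) \<le> cmod (q x)) \<and> C.nrm q < \<epsilon>"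
      by eventually_elim (use assms in blast)
  qed
qed

lemma vanishing_diff: "vanishing g \<Longrightarrow> vanishing h \<Longrightarrow> vanishing (\<lambda>n x. g n x - h n x)"
  using vanishing_add[of g "\<lambda>n x. - h n x"] vanishing_dom[of h "\<lambda>n x. - h n x"] by simp

lemma vanishing_zero: "vanishing (\<lambda>n x. 0)"
  by (subst vanishing_smp_iff) (auto intro: C.smp_zero simp: C.nrm_zero)

lemma vanishing_scale:
  assumes "vanishing g"
  shows "vanishing (\<lambda>n x. c * g n x)"
  unfolding vanishing_def
proof (intro allI impI)
  fix \<epsilon> :: real assume "0 < \<epsilon>"
  have pos: "0 < cmod c + 1" by (simp add: add_nonneg_pos)
  with \<open>0 < \<epsilon>\<close> have "0 < \<epsilon> / (cmod c + 1)" by simp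
  then have "\<forall>\<^sub>F n in sequentially.
      \<exists>q. C.smp q \<and> (\<forall>x. cmod (g n x) \<le> cmod (q x)) \<and> C.nrm q < \<epsilon> / (cmod c + 1)"
    using assms by (simp add: vanishing_def)
  then show "\<forall>\<^sub>F n in sequentially. \<exists>q. C.smp q \<and> (\<forall>x. cmod (c * g n x) \<le> cmod (q x)) \<and> C.nrm q < \<epsilon>"
  proof eventually_elim
    case (elim n)
    then obtain q where q: "C.smp q" "\<And>x. cmod (g n x) \<le> cmod (q x)" "C.nrm q < \<epsilon> / (cmod c + 1)"
      by blast
    have "C.nrm (\<lambda>x. c * q x) = cmod c * C.nrm q" using q(1) by (rule C.nrm_mult_left)
    also have "\<dots> \<le> (cmod c + 1) * C.nrm q"
      using C.nrm_nonneg[OF q(1)] by (intro mult_right_mono) auto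
    also have "\<dots> < \<epsilon>" using q(3) pos by (simp only: pos_less_divide_eq mult.commute)
    finally show ?case using q
      by (intro exI[of _ "\<lambda>x. c * q x"]) (auto simp: norm_mult C.smp_mult_left intro: mult_left_mono)
  qed
qed

section \<open>Multiplication as a relation between representing sequences\<close>

definition mult_rel where
  "mult_rel u s r \<longleftrightarrow> vanishing (\<lambda>n x. r n x - u x * s n x)"

lemma mult_rel_add:
  assumes "mult_rel u s r" "mult_rel u s' r'"
  shows "mult_rel u (\<lambda>n x. s n x + s' n x) (\<lambda>n x. r n x + r' n x)"
  using vanishing_add[OF assms[unfolded mult_rel_def]] by (simp add: mult_rel_def algebra_simps)

lemma mult_rel_scale:
  assumes "mult_rel u s r"
  shows "mult_rel u (\<lambda>n x. c * s n x) (\<lambda>n x. c * r n x)"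
  using vanishing_scale[OF assms[unfolded mult_rel_def], of c] by (simp add: mult_rel_def algebra_simps)

text \<open>The total error is \<open>(q - v r) + v (r - u s)\<close>, and the factor
  \<open>v\<close> of modulus 1 does not enlarge the second part.\<close>

lemma mult_rel_comp:
  assumes "mult_rel u s r" "mult_rel v r q" "\<forall>x. cmod (v x) = 1"
  shows "mult_rel (\<lambda>x. v x * u x) s q"
proof -
  have "vanishing (\<lambda>n x. v x * (r n x - u x * s n x))"
    by (rule vanishing_dom[OF assms(1)[unfolded mult_rel_def]]) (simp add: norm_mult assms(3))
  from vanishing_add[OF assms(2)[unfolded mult_rel_def] this] show ?thesis
    by (simp add: mult_rel_def algebra_simps)
qed

lemma mult_rel_cong:
  assumes u: "\<forall>x. cmod (u x) = 1" and F: "F \<in> HE e" "s \<in> F" "s' \<in> F"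
    and G: "G \<in> HE e" "r \<in> G" "r' \<in> G" and rel: "mult_rel u s r"
  shows "mult_rel u s' r'"
proof -
  have s: "vanishing (\<lambda>n x. s n x - s' n x)"
    using HE_eq_iff[OF F(1,1) F(2,3)] HE_cauchy[OF F(1)] F
    by (subst vanishing_smp_iff) (auto intro!: cauchy_diff cauchy_smp)
  have r: "vanishing (\<lambda>n x. r n x - r' n x)"
    using HE_eq_iff[OF G(1,1) G(2,3)] HE_cauchy[OF G(1)] G
    by (subst vanishing_smp_iff) (auto intro!: cauchy_diff cauchy_smp)
  have "vanishing (\<lambda>n x. u x * (s n x - s' n x))"
    by (rule vanishing_dom[OF s]) (simp add: norm_mult u)
  from vanishing_add[OF vanishing_diff[OF rel[unfolded mult_rel_def] r] this] show ?thesis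
    by (simp add: mult_rel_def algebra_simps)
qed

text \<open>Since |u| = 1, exchanging representatives of \<open>F\<close> or of the product changes
  the error by a vanishing term. Two candidates for the product therefore differ by a null sequence,
  which is what the definite description in \<open>mult_op\<close> requires.\<close>

lemma mult_rel_unique:
  assumes u: "\<forall>x. cmod (u x) = 1" and F: "F \<in> HE e" "s \<in> F" "s' \<in> F"
    and G: "G \<in> HE e" "r \<in> G" and G': "G' \<in> HE e" "r' \<in> G'"
    and rel: "mult_rel u s r" "mult_rel u s' r'"
  shows "G = G'"
proof -
  have "mult_rel u s' r" using mult_rel_cong[OF u F G(1,2,2) rel(1)] .
  from vanishing_diff[OF this[unfolded mult_rel_def] rel(2)[unfolded mult_rel_def]]
  have "vanishing (\<lambda>n x. r n x - r' n x)" by simp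
  then have "(\<lambda>n. C.nrm (\<lambda>x. r n x - r' n x)) \<longlonglongrightarrow> 0"
    using HE_cauchy[OF G] HE_cauchy[OF G']
    by (subst (asm) vanishing_smp_iff) (auto intro!: cauchy_diff cauchy_smp)
  then show ?thesis using HE_eq_iff[OF G(1) G'(1) G(2) G'(2)] by simp
qed

lemma mult_op_eqI:
  assumes "\<forall>x. cmod (u x) = 1" "F \<in> HE e" "s \<in> F" "G \<in> HE e" "r \<in> G" "mult_rel u s r"
  shows "mult_op e u F = G"
  unfolding mult_op_def upper_norm_tendsto_0_iff mult_rel_def[symmetric]
proof (rule the_equality)
  show "G \<in> HE e \<and> (\<exists>s\<in>F. \<exists>r\<in>G. mult_rel u s r)" using assms by blast
  fix G' assume "G' \<in> HE e \<and> (\<exists>s\<in>F. \<exists>r\<in>G'. mult_rel u s r)"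
  then obtain s' r' where *: "G' \<in> HE e" "s' \<in> F" "r' \<in> G'" "mult_rel u s' r'" by blast
  show "G' = G"
    by (rule mult_rel_unique[OF assms(1,2) *(2) assms(3) *(1,3) assms(4,5) *(4) assms(6)])
qed

text \<open>Up to the approximation errors at \<open>m\<close> and \<open>n\<close>, the difference
  \<open>r m - r n\<close> is \<open>u (s m - s n)\<close>, which has the same modulus as
  \<open>s m - s n\<close>. Simple functions close to the products are thus automatically
  Cauchy.\<close>

lemma mult_rel_smp_cauchy:
  assumes u: "\<forall>x. cmod (u x) = 1" and s: "s \<in> cauchy" and r: "\<And>n. C.smp (r n)" and rel: "mult_rel u s r"
  shows "r \<in> cauchy"
proof (rule cauchyI[OF r])
  fix \<epsilon> :: real assume "0 < \<epsilon>"
  then have \<epsilon>3: "0 < \<epsilon> / 3" by simp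
  obtain N where N: "\<And>m n. N \<le> m \<Longrightarrow> N \<le> n \<Longrightarrow> C.nrm (\<lambda>x. s m x - s n x) < \<epsilon> / 3"
    by (rule cauchyD[OF s \<epsilon>3]) blast
  obtain M where M: "\<And>n. M \<le> n \<Longrightarrow>
      \<exists>q. C.smp q \<and> (\<forall>x. cmod (r n x - u x * s n x) \<le> cmod (q x)) \<and> C.nrm q < \<epsilon> / 3"
    using rel[unfolded mult_rel_def vanishing_def, rule_format, OF \<epsilon>3]
    unfolding eventually_sequentially by blast
  have "C.nrm (\<lambda>x. r m x - r n x) < \<epsilon>" if mn: "max N M \<le> m" "max N M \<le> n" for m n
  proof -
    obtain p where p: "C.smp p" "\<And>x. cmod (r m x - u x * s m x) \<le> cmod (p x)" "C.nrm p < \<epsilon> / 3"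
      using M[of m] mn by auto
    obtain q where q: "C.smp q" "\<And>x. cmod (r n x - u x * s n x) \<le> cmod (q x)" "C.nrm q < \<epsilon> / 3"
      using M[of n] mn by auto
    have d: "C.smp (\<lambda>x. s m x - s n x)" by (intro C.smp_diff cauchy_smp s)
    obtain f where f: "C.smp f" "\<And>x. cmod (f x) = cmod (p x) + cmod (q x)" "C.nrm f \<le> C.nrm p + C.nrm q"
      using C.majorant_add[OF p(1) q(1)] by blast
    obtain g where g: "C.smp g" "\<And>x. cmod (g x) = cmod (f x) + cmod (s m x - s n x)"
      "C.nrm g \<le> C.nrm f + C.nrm (\<lambda>x. s m x - s n x)"
      using C.majorant_add[OF f(1) d] by blast
    have "cmod (r m x - r n x) \<le> cmod (g x)" for x
    proof -
      have "r m x - r n x = (r m x - u x * s m x) - (r n x - u x * s n x) + u x * (s m x - s n x)"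
        by (simp add: algebra_simps)
      also have "cmod \<dots> \<le> cmod (r m x - u x * s m x) + cmod (r n x - u x * s n x) + cmod (s m x - s n x)"
        using norm_triangle_ineq[of "(r m x - u x * s m x) - (r n x - u x * s n x)" "u x * (s m x - s n x)"]
          norm_triangle_ineq4[of "r m x - u x * s m x" "r n x - u x * s n x"]
        by (simp add: norm_mult u)
      finally show ?thesis using p(2)[of x] q(2)[of x] f(2)[of x] g(2)[of x] by linarith
    qed
    then have "C.nrm (\<lambda>x. r m x - r n x) \<le> C.nrm g" using r g by (intro C.nrm_mono C.smp_diff) auto
    also have "\<dots> < \<epsilon>" using g f p q N[of m n] mn by simp
    finally show ?thesis .
  qed
  then show "\<exists>N. \<forall>m\<ge>N. \<forall>n\<ge>N. C.nrm (\<lambda>x. r m x - r n x) < \<epsilon>" by blast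
qed

text \<open>The isometry behind unitarity: as |u s| = |s|, the moduli of \<open>r n\<close> and
  \<open>s n\<close> differ pointwise by at most the approximation error.\<close>

lemma mult_rel_nrm:
  assumes u: "\<forall>x. cmod (u x) = 1" and s: "\<And>n. C.smp (s n)" and r: "\<And>n. C.smp (r n)"
    and rel: "mult_rel u s r"
  shows "(\<lambda>n. C.nrm (r n) - C.nrm (s n)) \<longlonglongrightarrow> 0"
proof (rule LIMSEQ_I)
  fix \<epsilon> :: real assume "0 < \<epsilon>"
  from rel[unfolded mult_rel_def vanishing_def, rule_format, OF this] obtain M
    where M: "\<And>n. M \<le> n \<Longrightarrow>
      \<exists>q. C.smp q \<and> (\<forall>x. cmod (r n x - u x * s n x) \<le> cmod (q x)) \<and> C.nrm q < \<epsilon>"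
    unfolding eventually_sequentially by blast
  have "norm (C.nrm (r n) - C.nrm (s n) - 0) < \<epsilon>" if n: "M \<le> n" for n
  proof -
    obtain q where q: "C.smp q" "\<And>x. cmod (r n x - u x * s n x) \<le> cmod (q x)" "C.nrm q < \<epsilon>"
      using M[OF n] by blast
    obtain f where f: "C.smp f" "\<And>x. cmod (f x) = cmod (s n x) + cmod (q x)" "C.nrm f \<le> C.nrm (s n) + C.nrm q"
      using C.majorant_add[OF s q(1)] by blast
    obtain g where g: "C.smp g" "\<And>x. cmod (g x) = cmod (r n x) + cmod (q x)" "C.nrm g \<le> C.nrm (r n) + C.nrm q"
      using C.majorant_add[OF r q(1)] by blast
    have "\<bar>cmod (r n x) - cmod (s n x)\<bar> \<le> cmod (q x)" for x
      using norm_triangle_ineq3[of "r n x" "u x * s n x"] q(2)[of x] by (simp add: norm_mult u)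
    then have "cmod (r n x) \<le> cmod (f x)" "cmod (s n x) \<le> cmod (g x)" for x
      unfolding f g by (smt (verit))+
    then have "C.nrm (r n) \<le> C.nrm f" "C.nrm (s n) \<le> C.nrm g"
      using r s f g by (auto intro!: C.nrm_mono)
    then show ?thesis using f(3) g(3) q(3) by simp
  qed
  then show "\<exists>N. \<forall>n\<ge>N. norm (C.nrm (r n) - C.nrm (s n) - 0) < \<epsilon>" by blast
qed

text \<open>The error is relative to the modulus of \<open>s x\<close>. This forces approximants to
  vanish off the support of \<open>s\<close>, bounds the error in seminorm by
  \<open>\<epsilon>\<close> times that of \<open>s\<close>, and lets approximations be iterated for
  products of multipliers.\<close>

definition admissible :: "('a \<Rightarrow> complex) \<Rightarrow> bool" where
  "admissible u \<longleftrightarrow> (\<forall>x. cmod (u x) = 1) \<and>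
     (\<forall>s \<epsilon>. C.smp s \<longrightarrow> 0 < \<epsilon> \<longrightarrow> (\<exists>r. C.smp r \<and> (\<forall>x. cmod (r x - u x * s x) \<le> \<epsilon> * cmod (s x))))"

lemma admissible_norm: "admissible u \<Longrightarrow> \<forall>x. cmod (u x) = 1"
  by (simp add: admissible_def)

lemma admissible_approx:
  assumes "admissible u" "C.smp s" "0 < \<epsilon>"
  obtains r where "C.smp r" "\<And>x. cmod (r x - u x * s x) \<le> \<epsilon> * cmod (s x)"
  using assms unfolding admissible_def by blast

lemma admissible_mult_rel:
  assumes u: "admissible u" and s: "s \<in> cauchy"
  obtains r where "r \<in> cauchy" "mult_rel u s r"
proof -
  \<comment> \<open>Relative accuracy \<open>1 / (n + 1)\<close> is enough, because the seminorms of
    a Cauchy sequence converge and so the absolute errors tend to 0.\<close>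
  have "\<forall>n. \<exists>r. C.smp r \<and> (\<forall>x. cmod (r x - u x * s n x) \<le> inverse (Suc n) * cmod (s n x))"
    using admissible_approx[OF u cauchy_smp[OF s]] by (metis inverse_positive_iff_positive of_nat_0_less_iff zero_less_Suc)
  then obtain r where r: "\<And>n. C.smp (r n)"
    "\<And>n x. cmod (r n x - u x * s n x) \<le> inverse (Suc n) * cmod (s n x)" by metis
  let ?q = "\<lambda>n x. complex_of_real (inverse (Suc n)) * s n x"
  obtain L where "(\<lambda>n. C.nrm (s n)) \<longlonglongrightarrow> L"
    using cauchy_nrm_convergent[OF s] by (auto simp: convergent_def)
  then have "(\<lambda>n. inverse (real (Suc n)) * C.nrm (s n)) \<longlonglongrightarrow> 0 * L"
    by (intro tendsto_mult LIMSEQ_inverse_real_of_nat)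
  moreover have "C.nrm (?q n) = inverse (real (Suc n)) * C.nrm (s n)" for n
    using C.nrm_mult_left[OF cauchy_smp[OF s, of n], of "complex_of_real (inverse (Suc n))"]
    by (simp only: norm_of_real) simp
  ultimately have "vanishing ?q"
    by (subst vanishing_smp_iff) (auto intro!: C.smp_mult_left cauchy_smp[OF s])
  then have "mult_rel u s r" unfolding mult_rel_def
  proof (rule vanishing_dom)
    fix n x
    have "cmod (?q n x) = inverse (Suc n) * cmod (s n x)"
      by (simp only: norm_mult norm_of_real) simp
    then show "cmod (r n x - u x * s n x) \<le> cmod (?q n x)" using r(2)[of n x] by simp
  qed
  moreover from this have "r \<in> cauchy" by (intro mult_rel_smp_cauchy[OF admissible_norm[OF u] s] r(1))
  ultimately show ?thesis using that by blast
qed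

lemma mult_op_HE_rel:
  assumes u: "admissible u" and F: "F \<in> HE e"
  shows "mult_op e u F \<in> HE e"
    and "s \<in> F \<Longrightarrow> r \<in> mult_op e u F \<Longrightarrow> mult_rel u s r"
proof -
  obtain q where q: "q \<in> cauchy" "mult_rel u (rep F) q"
    using admissible_mult_rel[OF u HE_cauchy[OF F rep_in[OF F]]] by blast
  have eq: "mult_op e u F = cls q"
    using mult_op_eqI[OF admissible_norm[OF u] F rep_in[OF F] cls_HE self_cls] q by blast
  then show "mult_op e u F \<in> HE e" using cls_HE q by simp
  assume "s \<in> F" "r \<in> mult_op e u F"
  then show "mult_rel u s r"
    using mult_rel_cong[OF admissible_norm[OF u] F rep_in[OF F] _ cls_HE self_cls _ q(2)] q(1) eq
    by simp
qed

text \<open>Conjugating an approximant of \<open>u\<close> times the conjugate of \<open>s\<close>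
  does it. The conjugate multiplier provides the inverse operator, and hence bijectivity.\<close>

lemma admissible_cnj:
  assumes u: "admissible u"
  shows "admissible (\<lambda>x. cnj (u x))"
  unfolding admissible_def
proof (intro conjI allI impI)
  fix s :: "'a \<Rightarrow> complex" and \<epsilon> :: real assume s: "C.smp s" and "0 < \<epsilon>"
  have "C.smp (\<lambda>x. cnj (s x))" using s by (rule C.smp_comp) simp
  from admissible_approx[OF u this \<open>0 < \<epsilon>\<close>] obtain r where r: "C.smp r"
    "\<And>x. cmod (r x - u x * cnj (s x)) \<le> \<epsilon> * cmod (cnj (s x))" by blast
  have "C.smp (\<lambda>x. cnj (r x))" using r(1) by (rule C.smp_comp) simp
  moreover have "cmod (cnj (r x) - cnj (u x) * s x) \<le> \<epsilon> * cmod (s x)" for x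
  proof -
    have "cnj (r x) - cnj (u x) * s x = cnj (r x - u x * cnj (s x))" by simp
    then show ?thesis using r(2)[of x] by (simp only: complex_mod_cnj)
  qed
  ultimately show "\<exists>r. C.smp r \<and> (\<forall>x. cmod (r x - cnj (u x) * s x) \<le> \<epsilon> * cmod (s x))" by blast
qed (simp add: admissible_norm[OF u])

lemma admissible_mult:
  assumes u: "admissible u" and v: "admissible v"
  shows "admissible (\<lambda>x. u x * v x)"
  unfolding admissible_def
proof (intro conjI allI impI)
  fix s :: "'a \<Rightarrow> complex" and \<epsilon> :: real assume s: "C.smp s" and "0 < \<epsilon>"
  \<comment> \<open>With \<open>\<delta> \<le> 1\<close> the modulus of \<open>r\<close> is at most
    twice that of \<open>s\<close>. The second approximation then costs \<open>2 * \<delta>\<close>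
    and the first \<open>\<delta>\<close>, which explains the 3.\<close>
  define \<delta> where "\<delta> = min 1 (\<epsilon> / 3)"
  have \<delta>: "0 < \<delta>" "\<delta> \<le> 1" "3 * \<delta> \<le> \<epsilon>" using \<open>0 < \<epsilon>\<close> by (auto simp: \<delta>_def)
  obtain r where r: "C.smp r" "\<And>x. cmod (r x - v x * s x) \<le> \<delta> * cmod (s x)"
    by (rule admissible_approx[OF v s \<delta>(1)]) blast
  obtain q where q: "C.smp q" "\<And>x. cmod (q x - u x * r x) \<le> \<delta> * cmod (r x)"
    by (rule admissible_approx[OF u r(1) \<delta>(1)]) blast
  have "cmod (q x - u x * v x * s x) \<le> \<epsilon> * cmod (s x)" for x
  proof -
    have "cmod (r x) \<le> cmod (r x - v x * s x) + cmod (v x * s x)"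
      using norm_triangle_ineq[of "r x - v x * s x" "v x * s x"] by simp
    also have "\<dots> \<le> \<delta> * cmod (s x) + cmod (s x)"
      using r(2)[of x] by (simp add: norm_mult admissible_norm[OF v])
    also have "\<dots> \<le> 2 * cmod (s x)" using mult_right_mono[OF \<delta>(2), of "cmod (s x)"] by simp
    finally have rs: "\<delta> * cmod (r x) \<le> \<delta> * (2 * cmod (s x))" using \<delta>(1) by (intro mult_left_mono) auto
    have "q x - u x * v x * s x = (q x - u x * r x) + u x * (r x - v x * s x)" by (simp add: algebra_simps)
    also have "cmod \<dots> \<le> cmod (q x - u x * r x) + cmod (r x - v x * s x)"
      using norm_triangle_ineq[of "q x - u x * r x" "u x * (r x - v x * s x)"]
      by (simp add: norm_mult admissible_norm[OF u])
    also have "\<dots> \<le> 3 * \<delta> * cmod (s x)" using q(2)[of x] r(2)[of x] rs by simp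
    also have "\<dots> \<le> \<epsilon> * cmod (s x)" using \<delta>(3) by (intro mult_right_mono) auto
    finally show ?thesis .
  qed
  then show "\<exists>r. C.smp r \<and> (\<forall>x. cmod (r x - u x * v x * s x) \<le> \<epsilon> * cmod (s x))" using q(1) by blast
qed (simp add: norm_mult admissible_norm[OF u] admissible_norm[OF v])

text \<open>\<open>L\<close> is fixed before \<open>u\<close>, so the limit of inner products is the
  same for all unimodular multipliers, including the constant 1. Invariance of the inner product is
  the comparison of these two cases.\<close>

lemma inn_tendsto:
  assumes s: "s \<in> cauchy" and s': "s' \<in> cauchy"
  obtains L where "\<And>u r r'. \<forall>x. cmod (u x) = 1 \<Longrightarrow> r \<in> cauchy \<Longrightarrow> r' \<in> cauchy \<Longrightarrow>
     mult_rel u s r \<Longrightarrow> mult_rel u s' r' \<Longrightarrow> (\<lambda>n. C.inn (r n) (r' n)) \<longlonglongrightarrow> L"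
proof -
  define K where "K c = lim (\<lambda>n. C.nrm (\<lambda>x. s n x + c * s' n x))" for c
  have K: "(\<lambda>n. C.nrm (\<lambda>x. s n x + c * s' n x)) \<longlonglongrightarrow> K c" for c
    unfolding K_def convergent_LIMSEQ_iff[symmetric]
    by (intro cauchy_nrm_convergent cauchy_add cauchy_scale s s')
  have "(\<lambda>n. C.inn (r n) (r' n)) \<longlonglongrightarrow>
      (of_real ((K 1)\<^sup>2) - of_real ((K (- 1))\<^sup>2) + \<i> * of_real ((K \<i>)\<^sup>2) - \<i> * of_real ((K (- \<i>))\<^sup>2)) / 4"
    if u: "\<forall>x. cmod (u x) = 1" and r: "r \<in> cauchy" "r' \<in> cauchy" and rel: "mult_rel u s r" "mult_rel u s' r'"
    for u r r'
  proof -
    have lim: "(\<lambda>n. C.nrm (\<lambda>x. r n x + c * r' n x)) \<longlonglongrightarrow> K c" for c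
    proof -
      have "(\<lambda>n. C.nrm (\<lambda>x. r n x + c * r' n x) - C.nrm (\<lambda>x. s n x + c * s' n x)) \<longlonglongrightarrow> 0"
        by (rule mult_rel_nrm[OF u])
          (auto intro!: cauchy_smp cauchy_add cauchy_scale s s' r mult_rel_add mult_rel_scale rel)
      from tendsto_add[OF this K[of c]] show ?thesis by simp
    qed
    have "C.inn (r n) (r' n) = (of_real ((C.nrm (\<lambda>x. r n x + 1 * r' n x))\<^sup>2)
       - of_real ((C.nrm (\<lambda>x. r n x + (- 1) * r' n x))\<^sup>2)
       + \<i> * of_real ((C.nrm (\<lambda>x. r n x + \<i> * r' n x))\<^sup>2)
       - \<i> * of_real ((C.nrm (\<lambda>x. r n x + (- \<i>) * r' n x))\<^sup>2)) / 4" for n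
      using C.inn_polarization[OF cauchy_smp[OF r(1)] cauchy_smp[OF r(2)], of n n]
      by (simp add: mult.commute[of _ 4])
    then show ?thesis by (simp only:) (intro tendsto_intros lim, simp)
  qed
  then show ?thesis using that by blast
qed

lemma mult_rel_one: "mult_rel (\<lambda>x. 1) s s"
  by (simp add: mult_rel_def vanishing_zero)

lemma mult_op_inner:
  assumes u: "admissible u" and F: "F \<in> HE e" and G: "G \<in> HE e"
  shows "h_inner e (mult_op e u F) (mult_op e u G) = h_inner e F G"
proof -
  note cF = HE_cauchy[OF F rep_in[OF F]] and cG = HE_cauchy[OF G rep_in[OF G]]
  note UF = mult_op_HE_rel[OF u F] and UG = mult_op_HE_rel[OF u G]
  obtain L where L: "\<And>u r r'. \<forall>x. cmod (u x) = 1 \<Longrightarrow> r \<in> cauchy \<Longrightarrow> r' \<in> cauchy \<Longrightarrow>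
     mult_rel u (rep F) r \<Longrightarrow> mult_rel u (rep G) r' \<Longrightarrow> (\<lambda>n. C.inn (r n) (r' n)) \<longlonglongrightarrow> L"
    using inn_tendsto[OF cF cG] by blast
  have "(\<lambda>n. C.inn (rep F n) (rep G n)) \<longlonglongrightarrow> L"
    by (rule L[OF _ cF cG mult_rel_one mult_rel_one]) simp
  moreover have "(\<lambda>n. C.inn (rep (mult_op e u F) n) (rep (mult_op e u G) n)) \<longlonglongrightarrow> L"
    using UF UG F G by (intro L[OF admissible_norm[OF u]] HE_cauchy[OF _ rep_in] UF(2) UG(2) rep_in)
  ultimately show ?thesis unfolding h_inner_def simple_inner_eq by (metis limI)
qed

lemma mult_op_mult_op:
  assumes u: "admissible u" and v: "admissible v" and F: "F \<in> HE e"
  shows "mult_op e v (mult_op e u F) = mult_op e (\<lambda>x. v x * u x) F"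
proof -
  note uF = mult_op_HE_rel[OF u F]
  note vuF = mult_op_HE_rel[OF v uF(1)]
  have "mult_rel (\<lambda>x. v x * u x) (rep F) (rep (mult_op e v (mult_op e u F)))"
    by (rule mult_rel_comp[OF uF(2) vuF(2) admissible_norm[OF v]])
      (auto intro: rep_in F uF(1) vuF(1))
  then show ?thesis
    using mult_op_eqI[OF admissible_norm[OF admissible_mult[OF v u]] F rep_in[OF F] vuF(1) rep_in[OF vuF(1)]]
    by simp
qed

lemma mult_op_one: "F \<in> HE e \<Longrightarrow> mult_op e (\<lambda>x. 1) F = F"
  by (rule mult_op_eqI[OF _ _ rep_in _ rep_in mult_rel_one]) auto

lemma cnj_mult_unimodular: "cmod z = 1 \<Longrightarrow> cnj z * z = 1"
  using complex_norm_square[of z] by (simp add: mult.commute)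

lemma h_unitary_mult_op:
  assumes u: "admissible u"
  shows "h_unitary e (mult_op e u)"
  unfolding h_unitary_def
proof (intro conjI ballI allI)
  note u' = admissible_cnj[OF u]
  have c: "cnj (u x) * u x = 1" "u x * cnj (u x) = 1" for x
    using cnj_mult_unimodular[OF admissible_norm[OF u, rule_format, of x]] by (auto simp: mult.commute)
  show "bij_betw (mult_op e u) (HE e) (HE e)"
  proof (rule bij_betw_byWitness[where f' = "mult_op e (\<lambda>x. cnj (u x))"])
    show "\<forall>F\<in>HE e. mult_op e (\<lambda>x. cnj (u x)) (mult_op e u F) = F"
      using mult_op_mult_op[OF u u'] by (simp add: c mult_op_one)
    show "\<forall>F\<in>HE e. mult_op e u (mult_op e (\<lambda>x. cnj (u x)) F) = F"
      using mult_op_mult_op[OF u' u] by (simp add: c mult_op_one)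
  qed (use mult_op_HE_rel[OF u] mult_op_HE_rel[OF u'] in auto)
next
  fix F G assume F: "F \<in> HE e" and G: "G \<in> HE e"
  note uF = mult_op_HE_rel[OF u F] and uG = mult_op_HE_rel[OF u G]
  show "mult_op e u (h_add e F G) = h_add e (mult_op e u F) (mult_op e u G)"
    by (rule mult_op_eqI[OF admissible_norm[OF u] h_add_HE[OF F G]
        in_h_add[OF F rep_in[OF F] G rep_in[OF G]] h_add_HE[OF uF(1) uG(1)]
        in_h_add[OF uF(1) rep_in[OF uF(1)] uG(1) rep_in[OF uG(1)]]])
      (intro mult_rel_add uF(2) uG(2) rep_in F G uF(1) uG(1))
next
  fix c F assume F: "F \<in> HE e"
  note uF = mult_op_HE_rel[OF u F]
  show "mult_op e u (h_scale e c F) = h_scale e c (mult_op e u F)"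
    by (rule mult_op_eqI[OF admissible_norm[OF u] h_scale_HE[OF F]
        in_h_scale[OF F rep_in[OF F]] h_scale_HE[OF uF(1)] in_h_scale[OF uF(1) rep_in[OF uF(1)]]])
      (intro mult_rel_scale uF(2) rep_in F uF(1))
next
  fix F G assume F: "F \<in> HE e" and G: "G \<in> HE e"
  show "h_inner e (mult_op e u F) (mult_op e u G) = h_inner e F G"
    by (rule mult_op_inner[OF u F G])
qed

section \<open>Characters of absolutely summable vectors\<close>

text \<open>Corners of blocks are bounded sequences, and a bound uniform in the coordinates survives
  finite unions and differences. A set of the completion inherits it from a covering ring set. This
  uniformity is what pairs with absolute summability of \<open>h\<close>.\<close>

lemma bounded_coordinates:
  assumes "A \<in> complete_ring e"
  obtains K where "0 \<le> K" "\<And>x k. x \<in> A \<Longrightarrow> \<bar>x \<bullet> e k\<bar> \<le> K"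
proof -
  have "block_ring e \<subseteq> {A. \<exists>K. \<forall>x\<in>A. \<forall>k. \<bar>x \<bullet> e k\<bar> \<le> K}"
  proof (rule block_ring_subset[OF ring_of_setsI])
    fix A B assume "A \<in> {A. \<exists>K. \<forall>x\<in>A. \<forall>k. \<bar>x \<bullet> e k\<bar> \<le> K}" "B \<in> {A. \<exists>K. \<forall>x\<in>A. \<forall>k. \<bar>x \<bullet> e k\<bar> \<le> K}"
    then obtain K L where KL: "\<forall>x\<in>A. \<forall>k. \<bar>x \<bullet> e k\<bar> \<le> K" "\<forall>x\<in>B. \<forall>k. \<bar>x \<bullet> e k\<bar> \<le> L" by blast
    then have "\<forall>x\<in>A \<union> B. \<forall>k. \<bar>x \<bullet> e k\<bar> \<le> max K L" by (auto simp: le_max_iff_disj)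
    then show "A \<union> B \<in> {A. \<exists>K. \<forall>x\<in>A. \<forall>k. \<bar>x \<bullet> e k\<bar> \<le> K}" by blast
    show "A - B \<in> {A. \<exists>K. \<forall>x\<in>A. \<forall>k. \<bar>x \<bullet> e k\<bar> \<le> K}" using KL(1) by blast
  next
    fix a b assume "abs_measurable e a b"
    then have "bounded (range a)" "bounded (range b)"
      by (auto simp: abs_measurable_def block_bounds_def)
    then obtain K L where KL: "\<And>j. \<bar>a j\<bar> \<le> K" "\<And>j. \<bar>b j\<bar> \<le> L" unfolding bounded_iff by auto
    have "\<bar>x \<bullet> e k\<bar> \<le> K + L" if "x \<in> block e a b" for x k
    proof -
      have "a k \<le> x \<bullet> e k" "x \<bullet> e k < b k" using that by (auto simp: block_def)
      then show ?thesis using KL(1)[of k] KL(2)[of k] by linarith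
    qed
    then show "block e a b \<in> {A. \<exists>K. \<forall>x\<in>A. \<forall>k. \<bar>x \<bullet> e k\<bar> \<le> K}" by blast
  qed auto
  note bd = this
  obtain C where C: "C \<in> block_ring e" "A \<subseteq> C" using assms by (auto simp: complete_ring_def)
  from subsetD[OF bd C(1)] obtain K where K: "\<And>x k. x \<in> C \<Longrightarrow> \<bar>x \<bullet> e k\<bar> \<le> K" by auto
  show ?thesis
  proof (rule that)
    show "0 \<le> max 0 K" by simp
    show "\<bar>x \<bullet> e k\<bar> \<le> max 0 K" if "x \<in> A" for x k
      using K[OF subsetD[OF C(2) that], of k] by simp
  qed
qed

lemma smp_bounded_coordinates:
  assumes "C.smp s"
  obtains K where "0 \<le> K" "\<And>x k. s x \<noteq> 0 \<Longrightarrow> \<bar>x \<bullet> e k\<bar> \<le> K"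
proof (rule bounded_coordinates[OF C.smp_support[OF assms]])
  fix K :: real
  assume K: "0 \<le> K" "\<And>x k. x \<in> {x. s x \<noteq> 0} \<Longrightarrow> \<bar>x \<bullet> e k\<bar> \<le> K"
  show thesis by (rule that[OF K(1)]) (use K(2) in auto)
qed

lemma strip_Int:
  assumes "A \<in> complete_ring e"
  shows "A \<inter> {x. p \<le> x \<bullet> e k \<and> x \<bullet> e k < q} \<in> complete_ring e"
proof -
  let ?H = "{x. p \<le> x \<bullet> e k \<and> x \<bullet> e k < q}"
  have "block_ring e \<subseteq> {A. A \<inter> ?H \<in> block_ring e}"
  proof (rule block_ring_subset[OF ring_of_setsI])
    fix A B assume *: "A \<in> {A. A \<inter> ?H \<in> block_ring e}" "B \<in> {A. A \<inter> ?H \<in> block_ring e}"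
    have eq: "(A \<union> B) \<inter> ?H = (A \<inter> ?H) \<union> (B \<inter> ?H)" "(A - B) \<inter> ?H = (A \<inter> ?H) - (B \<inter> ?H)" by auto
    show "A \<union> B \<in> {A. A \<inter> ?H \<in> block_ring e}" "A - B \<in> {A. A \<inter> ?H \<in> block_ring e}"
      using * unfolding mem_Collect_eq eq by (blast intro: R.Un R.Diff)+
  next
    fix a b assume ab: "abs_measurable e a b"
    \<comment> \<open>The strip alone is not in the ring, but inside the block it acts like the
      block with its sides in direction \<open>k\<close> replaced by \<open>p\<close> and
      \<open>q\<close>.\<close>
    have "block e a b \<inter> ?H = block e a b \<inter> block e (a(k := p)) (b(k := q))"
      by (auto simp: block_def)
    then have "block e a b \<inter> ?H \<in> block_ring e"
      using block_Int[OF ab, of "a(k := p)" "b(k := q)"] block_in_ring by (metis R.empty_sets)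
    then show "block e a b \<in> {A. A \<inter> ?H \<in> block_ring e}" by simp
  qed auto
  then show ?thesis using assms unfolding complete_ring_eq by (intro R.completion_Int) auto
qed

definition chr :: "'a \<Rightarrow> 'a \<Rightarrow> complex" where
  "chr h = (\<lambda>x. exp (\<i> * of_real (h \<bullet> x)))"

lemma cmod_chr: "cmod (chr h x) = 1"
  by (simp add: chr_def)

lemma chr_add: "chr (h + h') = (\<lambda>x. chr h x * chr h' x)"
  by (rule ext) (simp add: chr_def inner_add_left exp_add algebra_simps)

lemma chr_zero: "chr 0 = (\<lambda>x. 1)"
  by (simp add: chr_def)

lemma admissible_one: "admissible (\<lambda>x. 1)"
  unfolding admissible_def
proof (intro conjI allI impI)
  fix s :: "'a \<Rightarrow> complex" and \<epsilon> :: real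
  assume "C.smp s" "0 < \<epsilon>"
  then show "\<exists>r. C.smp r \<and> (\<forall>x. cmod (r x - 1 * s x) \<le> \<epsilon> * cmod (s x))"
    by (intro exI[of _ s]) auto
qed simp

text \<open>
  On the support of a simple function the coordinate is bounded, so rounding it to multiples of
  \<open>1 / N\<close> leaves only finitely many values, each attained on a strip.
\<close>

lemma admissible_coordinate: "admissible (chr (c *\<^sub>R e k))"
  unfolding admissible_def
proof (intro conjI allI impI)
  fix s :: "'a \<Rightarrow> complex" and \<epsilon> :: real assume s: "C.smp s" and "0 < \<epsilon>"
  obtain K where K: "0 \<le> K" "\<And>x k. s x \<noteq> 0 \<Longrightarrow> \<bar>x \<bullet> e k\<bar> \<le> K"
    using smp_bounded_coordinates[OF s] by blast
  obtain n :: nat where n: "\<bar>c\<bar> / \<epsilon> < real n" using reals_Archimedean2 by blast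
  define N where "N = real n + 1"
  have N: "0 < N" "\<bar>c\<bar> / N \<le> \<epsilon>"
    using n \<open>0 < \<epsilon>\<close> by (auto simp: N_def field_simps)
  define M where "M = \<lceil>N * K\<rceil> + 1"
  define H where "H p = {x. of_int p / N \<le> x \<bullet> e k \<and> x \<bullet> e k < (of_int p + 1) / N}" for p :: int
  define w where "w p = exp (\<i> * of_real (c * (of_int p / N)))" for p :: int
  define r where "r x = (\<Sum>p\<in>{-M..M}. of_bool (x \<in> H p) * (w p * s x))" for x
  have "C.smp r" unfolding r_def
    by (intro C.smp_sum C.smp_restrict C.smp_mult_left s) (auto simp: H_def intro: strip_Int)
  moreover have "cmod (r x - chr (c *\<^sub>R e k) x * s x) \<le> \<epsilon> * cmod (s x)" for x
  proof (cases "s x = 0")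
    case True
    then show ?thesis by (simp add: r_def)
  next
    case False
    let ?t = "x \<bullet> e k"
    let ?p = "\<lfloor>N * ?t\<rfloor>"
    have H: "x \<in> H p \<longleftrightarrow> p = ?p" for p
      using N(1) floor_eq_iff[of "N * ?t" p] by (auto simp: H_def field_simps)
    have "\<bar>N * ?t\<bar> \<le> N * K" using K(2)[OF False, of k] N(1) by (simp add: abs_mult)
    then have "?p \<in> {-M..M}" unfolding M_def atLeastAtMost_iff by linarith
    then have r: "r x = w ?p * s x"
      unfolding r_def H by (subst sum.remove[of _ ?p]) (auto intro!: sum.neutral)
    have "\<bar>of_int ?p / N - ?t\<bar> \<le> 1 / N"
    proof -
      have "of_int ?p / N - ?t = (of_int ?p - N * ?t) / N" using N(1) by (simp add: field_simps)
      moreover have "\<bar>of_int ?p - N * ?t\<bar> \<le> 1" by linarith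
      ultimately show ?thesis using N(1) by (simp add: abs_divide divide_right_mono)
    qed
    then have "\<bar>c\<bar> * \<bar>of_int ?p / N - ?t\<bar> \<le> \<bar>c\<bar> * (1 / N)" by (intro mult_left_mono) auto
    then have c: "\<bar>c * (of_int ?p / N) - c * ?t\<bar> \<le> \<epsilon>"
      using N(2) by (simp only: right_diff_distrib[symmetric] abs_mult) simp
    have "r x - chr (c *\<^sub>R e k) x * s x
        = (exp (\<i> * of_real (c * (of_int ?p / N))) - exp (\<i> * of_real (c * ?t))) * s x"
      unfolding r w_def chr_def by (simp add: inner_commute left_diff_distrib)
    then have "cmod (r x - chr (c *\<^sub>R e k) x * s x)
        = cmod (exp (\<i> * of_real (c * (of_int ?p / N))) - exp (\<i> * of_real (c * ?t))) * cmod (s x)"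
      by (simp only: norm_mult)
    also have "\<dots> \<le> \<bar>c * (of_int ?p / N) - c * ?t\<bar> * cmod (s x)"
      by (rule mult_right_mono[OF cmod_exp_i_diff_le]) simp
    also have "\<dots> \<le> \<epsilon> * cmod (s x)" using c by (intro mult_right_mono) auto
    finally show ?thesis .
  qed
  ultimately show "\<exists>r. C.smp r \<and> (\<forall>x. cmod (r x - chr (c *\<^sub>R e k) x * s x) \<le> \<epsilon> * cmod (s x))" by blast
qed (simp add: cmod_chr)

text \<open>A simple function lives where all coordinates are bounded by some \<open>K\<close>, so
  closeness of the multipliers on that set suffices. The approximating \<open>v\<close> may depend
  on \<open>K\<close>.\<close>

lemma admissible_limit:
  assumes u: "\<forall>x. cmod (u x) = 1"
    and lim: "\<And>K \<eta>. 0 \<le> K \<Longrightarrow> 0 < \<eta> \<Longrightarrow>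
      \<exists>v. admissible v \<and> (\<forall>x. (\<forall>k. \<bar>x \<bullet> e k\<bar> \<le> K) \<longrightarrow> cmod (u x - v x) \<le> \<eta>)"
  shows "admissible u"
  unfolding admissible_def
proof (intro conjI allI impI)
  fix s :: "'a \<Rightarrow> complex" and \<epsilon> :: real assume s: "C.smp s" and "0 < \<epsilon>"
  then have \<epsilon>2: "0 < \<epsilon> / 2" by simp
  obtain K where K: "0 \<le> K" "\<And>x k. s x \<noteq> 0 \<Longrightarrow> \<bar>x \<bullet> e k\<bar> \<le> K"
    using smp_bounded_coordinates[OF s] by blast
  obtain v where v: "admissible v" "\<And>x. (\<forall>k. \<bar>x \<bullet> e k\<bar> \<le> K) \<Longrightarrow> cmod (u x - v x) \<le> \<epsilon> / 2"
    using lim[OF K(1) \<epsilon>2] by blast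
  obtain r where r: "C.smp r" "\<And>x. cmod (r x - v x * s x) \<le> \<epsilon> / 2 * cmod (s x)"
    using admissible_approx[OF v(1) s \<epsilon>2] by blast
  have "cmod (r x - u x * s x) \<le> \<epsilon> * cmod (s x)" for x
  proof -
    have "cmod (r x - u x * s x) = cmod ((r x - v x * s x) - (u x - v x) * s x)"
      by (simp add: algebra_simps)
    also have "\<dots> \<le> cmod (r x - v x * s x) + cmod (u x - v x) * cmod (s x)"
      unfolding norm_mult[symmetric] by (rule norm_triangle_ineq4)
    also have "cmod (u x - v x) * cmod (s x) \<le> \<epsilon> / 2 * cmod (s x)"
      using v(2)[of x] K(2)[of x] by (cases "s x = 0") (auto intro!: mult_right_mono)
    finally show ?thesis using r(2)[of x] by simp
  qed
  then show "\<exists>r. C.smp r \<and> (\<forall>x. cmod (r x - u x * s x) \<le> \<epsilon> * cmod (s x))" using r(1) by blast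
qed (use u in simp)

section \<open>Basis expansions, projections and the summability norm\<close>

lemma eq_0_coordinates:
  assumes "\<And>j. d \<bullet> e j = 0"
  shows "d = 0"
proof -
  have "span (range e) \<subseteq> {y. d \<bullet> y = 0}"
    using assms by (intro span_minimal) (auto simp: subspace_hyperplane)
  then have "closure (span (range e)) \<subseteq> {y. d \<bullet> y = 0}"
    by (intro closure_minimal closed_hyperplane)
  moreover have "closure (span (range e)) = UNIV" using onb by (simp add: orthonormal_basis_def)
  ultimately have "d \<bullet> d = 0" by blast
  then show ?thesis by simp
qed

lemma expansion: "(\<lambda>n. \<Sum>k<n. (g \<bullet> e k) *\<^sub>R e k) \<longlonglongrightarrow> g"
proof -
  obtain y where y: "(\<lambda>n. \<Sum>k<n. (g \<bullet> e k) *\<^sub>R e k) \<longlonglongrightarrow> y" "\<And>j. y \<bullet> e j = g \<bullet> e j"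
    using Riesz_Fischer[OF Bessel] by blast
  have "y - g = 0" by (intro eq_0_coordinates) (simp add: inner_diff_left y(2))
  then show ?thesis using y(1) by simp
qed

definition l1norm :: "'a \<Rightarrow> real" where
  "l1norm g = (\<Sum>k. \<bar>g \<bullet> e k\<bar>)"

lemma l1norm_nonneg: "g \<in> L1 e \<Longrightarrow> 0 \<le> l1norm g"
  unfolding l1norm_def L1_def by (intro suminf_nonneg) auto

text \<open>The pairing of a summable with a bounded coordinate sequence, proved for the partial
  expansions of \<open>g\<close> and passed to the limit. The bound involves only \<open>K\<close>,
  not the norm of \<open>x\<close>, which is unbounded on blocks in general.\<close>

lemma inner_le_l1norm:
  assumes g: "g \<in> L1 e" and "0 \<le> K" and K: "\<And>k. \<bar>x \<bullet> e k\<bar> \<le> K"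
  shows "\<bar>g \<bullet> x\<bar> \<le> K * l1norm g"
proof (rule LIMSEQ_le_const2)
  show "(\<lambda>n. \<bar>(\<Sum>k<n. (g \<bullet> e k) *\<^sub>R e k) \<bullet> x\<bar>) \<longlonglongrightarrow> \<bar>g \<bullet> x\<bar>"
    by (intro tendsto_intros expansion)
  have sg: "summable (\<lambda>k. \<bar>g \<bullet> e k\<bar>)" using g by (simp add: L1_def)
  have "\<bar>(\<Sum>k<n. (g \<bullet> e k) *\<^sub>R e k) \<bullet> x\<bar> \<le> K * l1norm g" for n
  proof -
    have "\<bar>(\<Sum>k<n. (g \<bullet> e k) *\<^sub>R e k) \<bullet> x\<bar> \<le> (\<Sum>k<n. \<bar>(g \<bullet> e k) * (x \<bullet> e k)\<bar>)"
      by (simp add: inner_sum_left inner_commute[of x] sum_abs)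
    also have "\<dots> \<le> (\<Sum>k<n. K * \<bar>g \<bullet> e k\<bar>)"
      using K by (intro sum_mono) (simp add: abs_mult mult.commute[of K] mult_left_mono)
    also have "\<dots> = K * (\<Sum>k<n. \<bar>g \<bullet> e k\<bar>)" by (simp add: sum_distrib_left)
    also have "\<dots> \<le> K * l1norm g" unfolding l1norm_def
      using \<open>0 \<le> K\<close> by (intro mult_left_mono sum_le_suminf sg) auto
    finally show ?thesis .
  qed
  then show "\<exists>N. \<forall>n\<ge>N. \<bar>(\<Sum>k<n. (g \<bullet> e k) *\<^sub>R e k) \<bullet> x\<bar> \<le> K * l1norm g" by blast
qed

lemma proj_eq: "proj e n h = (\<Sum>k<n. (h \<bullet> e k) *\<^sub>R e k)"
  unfolding proj_def
proof (rule the_equality)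
  let ?P = "\<Sum>k<n. (h \<bullet> e k) *\<^sub>R e k"
  have in_span: "?P \<in> span (e ` {..<n})"
    by (intro span_sum span_scale span_base) auto
  have orth: "orthogonal (h - ?P) z" if "z \<in> span (e ` {..<n})" for z
    using that by (rule orthogonal_to_span)
      (auto simp: orthogonal_def inner_diff_left inner_sum_e)
  then show "?P \<in> span (e ` {..<n}) \<and> (\<forall>z\<in>span (e ` {..<n}). orthogonal (h - ?P) z)"
    using in_span by blast
  fix y assume y: "y \<in> span (e ` {..<n}) \<and> (\<forall>z\<in>span (e ` {..<n}). orthogonal (h - y) z)"
  then have d: "y - ?P \<in> span (e ` {..<n})" using in_span by (intro span_diff) auto
  \<comment> \<open>Subtracting the two relations shows that the difference of two candidates is
    orthogonal to itself.\<close>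
  then have "orthogonal (h - ?P) (y - ?P)" "orthogonal (h - y) (y - ?P)" using orth y by auto
  then have "(y - ?P) \<bullet> (y - ?P) = 0" by (simp add: orthogonal_def inner_diff_left)
  then show "y = ?P" by simp
qed

lemma proj_inner: "proj e n h \<bullet> e k = (if k < n then h \<bullet> e k else 0)"
  by (simp add: proj_eq inner_sum_e)

lemma L1_scaleR: "h \<in> L1 e \<Longrightarrow> t *\<^sub>R h \<in> L1 e"
  by (simp add: L1_def abs_mult summable_mult)

lemma l1norm_scaleR: "h \<in> L1 e \<Longrightarrow> l1norm (t *\<^sub>R h) = \<bar>t\<bar> * l1norm h"
  by (simp add: l1norm_def L1_def abs_mult suminf_mult)

lemma L1_proj: "proj e n h \<in> L1 e"
  unfolding L1_def mem_Collect_eq proj_inner by (rule summable_finite[of "{..<n}"]) auto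

lemma L1_diff:
  assumes "g \<in> L1 e" "h \<in> L1 e"
  shows "g - h \<in> L1 e"
proof -
  have "summable (\<lambda>k. \<bar>g \<bullet> e k\<bar> + \<bar>h \<bullet> e k\<bar>)" using assms by (intro summable_add) (auto simp: L1_def)
  then show ?thesis unfolding L1_def mem_Collect_eq
    by (rule summable_comparison_test'[where N = 0]) (simp add: inner_diff_left)
qed

lemma l1norm_proj_tendsto:
  assumes h: "h \<in> L1 e"
  shows "(\<lambda>n. l1norm (h - proj e n h)) \<longlonglongrightarrow> 0"
proof -
  have sh: "summable (\<lambda>k. \<bar>h \<bullet> e k\<bar>)" using h by (simp add: L1_def)
  have "l1norm (h - proj e n h) = l1norm h - (\<Sum>k<n. \<bar>h \<bullet> e k\<bar>)" for n
  proof -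
    have "l1norm h = l1norm (h - proj e n h) + (\<Sum>k. \<bar>proj e n h \<bullet> e k\<bar>)"
      unfolding l1norm_def
      using L1_diff[OF h L1_proj] L1_proj
      by (subst suminf_add) (auto simp: L1_def inner_diff_left proj_inner intro!: suminf_cong)
    moreover have "(\<Sum>k. \<bar>proj e n h \<bullet> e k\<bar>) = (\<Sum>k<n. \<bar>h \<bullet> e k\<bar>)"
      by (subst suminf_finite[of "{..<n}"]) (auto simp: proj_inner)
    ultimately show ?thesis by simp
  qed
  moreover have "(\<lambda>n. l1norm h - (\<Sum>k<n. \<bar>h \<bullet> e k\<bar>)) \<longlonglongrightarrow> l1norm h - l1norm h"
    unfolding l1norm_def by (intro tendsto_intros summable_LIMSEQ sh)
  ultimately show ?thesis by simp
qed

lemma chr_diff_le: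
  assumes "g \<in> L1 e" "h \<in> L1 e" "0 \<le> K" "\<And>k. \<bar>x \<bullet> e k\<bar> \<le> K"
  shows "cmod (chr g x - chr h x) \<le> K * l1norm (g - h)"
proof -
  have "cmod (chr g x - chr h x) \<le> \<bar>(g - h) \<bullet> x\<bar>"
    unfolding chr_def using cmod_exp_i_diff_le by (simp add: inner_diff_left)
  also have "\<dots> \<le> K * l1norm (g - h)" using assms by (intro inner_le_l1norm L1_diff)
  finally show ?thesis .
qed

lemma admissible_chr:
  assumes h: "h \<in> L1 e"
  shows "admissible (chr h)"
proof (rule admissible_limit)
  have fin: "admissible (chr (\<Sum>k<n. c k *\<^sub>R e k))" for n :: nat and c
    by (induction n) (auto simp: chr_zero chr_add intro: admissible_one admissible_mult admissible_coordinate)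
  fix K \<eta> :: real assume "0 \<le> K" "0 < \<eta>"
  have "(\<lambda>n. K * l1norm (h - proj e n h)) \<longlonglongrightarrow> 0"
    by (intro tendsto_mult_right_zero l1norm_proj_tendsto h)
  from order_tendstoD(2)[OF this \<open>0 < \<eta>\<close>] obtain n where n: "K * l1norm (h - proj e n h) < \<eta>"
    by (auto simp: eventually_sequentially)
  have close: "cmod (chr h x - chr (proj e n h) x) \<le> \<eta>" if "\<forall>k. \<bar>x \<bullet> e k\<bar> \<le> K" for x
    using chr_diff_le[OF h L1_proj \<open>0 \<le> K\<close>, of x n h] that n by fastforce
  have adm: "admissible (chr (proj e n h))" unfolding proj_eq by (rule fin)
  show "\<exists>v. admissible v \<and> (\<forall>x. (\<forall>k. \<bar>x \<bullet> e k\<bar> \<le> K) \<longrightarrow> cmod (chr h x - v x) \<le> \<eta>)"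
    by (intro exI[of _ "chr (proj e n h)"] conjI allI impI adm close) blast
qed (simp add: cmod_chr)

text \<open>
  Up to \<open>\<eta>\<close>, replace \<open>F\<close> by a single simple function; its support is bounded in all coordinates.
\<close>

lemma mult_op_close:
  assumes F: "F \<in> HE e" and "0 < \<eta>"
  obtains K L where "0 \<le> K" "0 \<le> L"
    "\<And>u v \<delta>. admissible u \<Longrightarrow> admissible v \<Longrightarrow>
      \<forall>x. (\<forall>k. \<bar>x \<bullet> e k\<bar> \<le> K) \<longrightarrow> cmod (u x - v x) \<le> \<delta> \<Longrightarrow>
      0 \<le> \<delta> \<Longrightarrow> hdist (mult_op e u F) (mult_op e v F) \<le> \<eta> + \<delta> * L"
proof -
  let ?s = "rep F"
  note cs = HE_cauchy[OF F rep_in[OF F]]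
  \<comment> \<open>Half of \<open>\<eta>\<close>, because the distance from \<open>?s n\<close> to
    the fixed simple function is multiplied by |u - v|, which is at most 2.\<close>
  have "0 < \<eta> / 2" using \<open>0 < \<eta>\<close> by simp
  then obtain M where M: "\<And>m n. M \<le> m \<Longrightarrow> M \<le> n \<Longrightarrow> C.nrm (\<lambda>x. ?s m x - ?s n x) < \<eta> / 2"
    using cauchyD[OF cs] by metis
  define f where "f = ?s M"
  have f: "C.smp f" unfolding f_def by (rule cauchy_smp[OF cs])
  obtain K where K: "0 \<le> K" "\<And>x k. f x \<noteq> 0 \<Longrightarrow> \<bar>x \<bullet> e k\<bar> \<le> K"
    using smp_bounded_coordinates[OF f] by blast
  have main: "hdist (mult_op e u F) (mult_op e v F) \<le> \<eta> + \<delta> * C.nrm f"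
    if u: "admissible u" and v: "admissible v"
      and uv: "\<forall>x. (\<forall>k. \<bar>x \<bullet> e k\<bar> \<le> K) \<longrightarrow> cmod (u x - v x) \<le> \<delta>" and "0 \<le> \<delta>" for u v \<delta>
  proof (rule field_le_epsilon)
    fix \<epsilon> :: real assume "0 < \<epsilon>"
    then have \<epsilon>2: "0 < \<epsilon> / 2" by simp
    note uF = mult_op_HE_rel[OF u F] and vF = mult_op_HE_rel[OF v F]
    let ?r = "rep (mult_op e u F)" and ?q = "rep (mult_op e v F)"
    have smr: "C.smp (?r n)" "C.smp (?q n)" for n
      by (intro cauchy_smp HE_cauchy[OF uF(1) rep_in] HE_cauchy[OF vF(1) rep_in] uF(1) vF(1))+
    have "\<forall>\<^sub>F n in sequentially. C.nrm (\<lambda>x. ?r n x - ?q n x) \<le> \<eta> + \<delta> * C.nrm f + \<epsilon>"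
      using uF(2)[OF rep_in[OF F] rep_in[OF uF(1)], unfolded mult_rel_def vanishing_def, rule_format, OF \<epsilon>2]
        vF(2)[OF rep_in[OF F] rep_in[OF vF(1)], unfolded mult_rel_def vanishing_def, rule_format, OF \<epsilon>2]
        eventually_ge_at_top[of M]
    proof eventually_elim
      case (elim n)
      obtain a where a: "C.smp a" "\<And>x. cmod (?r n x - u x * ?s n x) \<le> cmod (a x)" "C.nrm a < \<epsilon> / 2"
        using elim(1) by blast
      obtain b where b: "C.smp b" "\<And>x. cmod (?q n x - v x * ?s n x) \<le> cmod (b x)" "C.nrm b < \<epsilon> / 2"
        using elim(2) by blast
      obtain g where g: "C.smp g" "\<And>x. cmod (g x) = cmod (a x) + cmod (b x)" "C.nrm g \<le> C.nrm a + C.nrm b"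
        using C.majorant_add[OF a(1) b(1)] by blast
      have d: "C.smp (\<lambda>x. ?s n x - f x)" by (intro C.smp_diff cauchy_smp[OF cs] f)
      note d2 = C.smp_mult_left[OF d, of 2] and f2 = C.smp_mult_left[OF f, of "of_real \<delta>"]
      obtain k where k: "C.smp k" "\<And>x. cmod (k x) = cmod (2 * (?s n x - f x)) + cmod (of_real \<delta> * f x)"
        "C.nrm k \<le> C.nrm (\<lambda>x. 2 * (?s n x - f x)) + C.nrm (\<lambda>x. of_real \<delta> * f x)"
        using C.majorant_add[OF d2 f2] by blast
      obtain w where w: "C.smp w" "\<And>x. cmod (w x) = cmod (g x) + cmod (k x)" "C.nrm w \<le> C.nrm g + C.nrm k"
        using C.majorant_add[OF g(1) k(1)] by blast
      have "cmod (?r n x - ?q n x) \<le> cmod (w x)" for x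
      proof -
        have uv2: "cmod (u x - v x) \<le> 2"
          using norm_triangle_ineq4[of "u x" "v x"] admissible_norm[OF u] admissible_norm[OF v] by simp
        have "cmod (u x - v x) * cmod (f x) \<le> \<delta> * cmod (f x)"
          using uv[rule_format, of x] K(2)[of x] by (cases "f x = 0") (auto intro!: mult_right_mono)
        moreover have "cmod (u x - v x) * cmod (?s n x - f x) \<le> 2 * cmod (?s n x - f x)"
          using uv2 by (intro mult_right_mono) auto
        ultimately have uvk: "cmod ((u x - v x) * (?s n x - f x)) + cmod ((u x - v x) * f x) \<le> cmod (k x)"
          using \<open>0 \<le> \<delta>\<close> unfolding k(2) norm_mult by simp
        \<comment> \<open>The supports of the \<open>?s n\<close> have no common coordinate bound.
          Only the part with \<open>f\<close> can use \<open>\<delta>\<close>; the part with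
          \<open>?s n - f\<close> relies on the trivial bound 2 and on its small seminorm.\<close>
        have eq: "?r n x - ?q n x = ((?r n x - u x * ?s n x) - (?q n x - v x * ?s n x))
            + ((u x - v x) * (?s n x - f x) + (u x - v x) * f x)" by (simp add: algebra_simps)
        have "cmod (?r n x - ?q n x) \<le> (cmod (?r n x - u x * ?s n x) + cmod (?q n x - v x * ?s n x))
            + (cmod ((u x - v x) * (?s n x - f x)) + cmod ((u x - v x) * f x))"
          unfolding eq
          by (intro order_trans[OF norm_triangle_ineq] add_mono norm_triangle_ineq norm_triangle_ineq4)
        then show ?thesis using uvk a(2)[of x] b(2)[of x] g(2)[of x] w(2)[of x] by linarith
      qed
      then have "C.nrm (\<lambda>x. ?r n x - ?q n x) \<le> C.nrm w"
        using smr w by (intro C.nrm_mono C.smp_diff) auto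
      also have "\<dots> \<le> \<epsilon> + (2 * C.nrm (\<lambda>x. ?s n x - f x) + \<delta> * C.nrm f)"
        using w(3) g(3) a(3) b(3) k(3) C.nrm_mult_left[OF d, of 2]
          C.nrm_mult_left[OF f, of "of_real \<delta>"] \<open>0 \<le> \<delta>\<close> by simp
      also have "\<dots> \<le> \<eta> + \<delta> * C.nrm f + \<epsilon>"
        using M[OF elim(3) order_refl] by (simp add: f_def)
      finally show ?case .
    qed
    then show "hdist (mult_op e u F) (mult_op e v F) \<le> \<eta> + \<delta> * C.nrm f + \<epsilon>"
      using hdist_tendsto[OF uF(1) rep_in[OF uF(1)] vF(1) rep_in[OF vF(1)]]
      by (intro tendsto_upperbound[OF _ _ sequentially_bot])
  qed
  show ?thesis by (rule that[OF K(1) C.nrm_nonneg[OF f] main])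
qed

text \<open>\<open>\<delta>\<close> depends on \<open>F\<close> and \<open>\<epsilon>\<close> but
  not on \<open>g\<close> and \<open>h\<close>: multiplication by characters is uniformly continuous
  in the summability norm of the exponent. Existence of the limit in \<open>S_hat\<close>, strong
  continuity and uniformity in \<open>t\<close> are three applications.\<close>

lemma chr_close:
  assumes F: "F \<in> HE e" and "0 < \<epsilon>"
  obtains \<delta> where "0 < \<delta>" "\<And>g h. g \<in> L1 e \<Longrightarrow> h \<in> L1 e \<Longrightarrow> l1norm (g - h) \<le> \<delta> \<Longrightarrow>
    hdist (mult_op e (chr g) F) (mult_op e (chr h) F) \<le> \<epsilon>"
proof -
  have "0 < \<epsilon> / 2" using \<open>0 < \<epsilon>\<close> by simp
  obtain K L where KL: "0 \<le> K" "0 \<le> L" "\<And>u v \<delta>. admissible u \<Longrightarrow> admissible v \<Longrightarrow>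
      \<forall>x. (\<forall>k. \<bar>x \<bullet> e k\<bar> \<le> K) \<longrightarrow> cmod (u x - v x) \<le> \<delta> \<Longrightarrow>
      0 \<le> \<delta> \<Longrightarrow> hdist (mult_op e u F) (mult_op e v F) \<le> \<epsilon> / 2 + \<delta> * L"
    by (rule mult_op_close[OF F \<open>0 < \<epsilon> / 2\<close>]) blast
  \<comment> \<open>The added 1 keeps the divisor positive when \<open>K * L = 0\<close>.\<close>
  define D where "D = K * L + 1"
  define \<delta> where "\<delta> = \<epsilon> / 2 / D"
  have D: "0 < D" using KL by (simp add: D_def add_nonneg_pos)
  then have "0 < \<delta>" using \<open>0 < \<epsilon>\<close> by (simp add: \<delta>_def)
  have "hdist (mult_op e (chr g) F) (mult_op e (chr h) F) \<le> \<epsilon>"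
    if g: "g \<in> L1 e" and h: "h \<in> L1 e" and gh: "l1norm (g - h) \<le> \<delta>" for g h
  proof -
    have "cmod (chr g x - chr h x) \<le> K * \<delta>" if "\<forall>k. \<bar>x \<bullet> e k\<bar> \<le> K" for x
      using chr_diff_le[OF g h KL(1) that[rule_format]] mult_left_mono[OF gh KL(1)] by linarith
    then have "hdist (mult_op e (chr g) F) (mult_op e (chr h) F) \<le> \<epsilon> / 2 + K * \<delta> * L"
      using KL(1) \<open>0 < \<delta>\<close> by (intro KL(3) admissible_chr g h) auto
    also have "K * \<delta> * L \<le> \<delta> * D" using \<open>0 < \<delta>\<close> by (simp add: D_def algebra_simps)
    also have "\<delta> * D = \<epsilon> / 2" using D by (simp add: \<delta>_def)
    finally show ?thesis by simp
  qed
  then show ?thesis using that \<open>0 < \<delta>\<close> by blast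
qed

text \<open>The projections of \<open>h\<close> converge to it in the summability norm, so the
  products converge to the product with the full character; the triangle inequality excludes any
  other limit. Properties of \<open>mult_op\<close> thereby transfer to
  \<open>S_hat\<close>.\<close>

lemma S_hat_eq:
  assumes h: "h \<in> L1 e" and F: "F \<in> HE e"
  shows "S_hat e h F = mult_op e (chr h) F"
  unfolding S_hat_def hdist_def[symmetric]
proof (rule the_equality)
  have S: "S_fin e g F = mult_op e (chr g) F" for g by (simp add: S_fin_def chr_def)
  have HEh: "mult_op e (chr g) F \<in> HE e" if "g \<in> L1 e" for g
    using mult_op_HE_rel(1)[OF admissible_chr[OF that] F] .
  note HEn = HEh[OF L1_proj]
  have lim: "(\<lambda>n. hdist (S_fin e (proj e n h) F) (mult_op e (chr h) F)) \<longlonglongrightarrow> 0"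
    unfolding S
  proof (rule LIMSEQ_I)
    fix \<epsilon> :: real assume "0 < \<epsilon>"
    then have "0 < \<epsilon> / 2" by simp
    obtain \<delta> where \<delta>: "0 < \<delta>" "\<And>g h. g \<in> L1 e \<Longrightarrow> h \<in> L1 e \<Longrightarrow> l1norm (g - h) \<le> \<delta> \<Longrightarrow>
        hdist (mult_op e (chr g) F) (mult_op e (chr h) F) \<le> \<epsilon> / 2"
      by (rule chr_close[OF F \<open>0 < \<epsilon> / 2\<close>]) blast
    obtain N where N: "\<And>n. N \<le> n \<Longrightarrow> l1norm (h - proj e n h) < \<delta>"
      using order_tendstoD(2)[OF l1norm_proj_tendsto[OF h] \<delta>(1)] by (auto simp: eventually_sequentially)
    have "norm (hdist (mult_op e (chr (proj e n h)) F) (mult_op e (chr h) F) - 0) < \<epsilon>" if "N \<le> n" for n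
    proof -
      have "l1norm (proj e n h - h) = l1norm (h - proj e n h)"
        by (simp add: l1norm_def inner_diff_left abs_minus_commute)
      then have "hdist (mult_op e (chr (proj e n h)) F) (mult_op e (chr h) F) \<le> \<epsilon> / 2"
        using N[OF that] by (intro \<delta>(2) L1_proj h) simp
      then show ?thesis using hdist_nonneg[OF HEn HEh[OF h], of n h] \<open>0 < \<epsilon>\<close> by simp
    qed
    then show "\<exists>N. \<forall>n\<ge>N. norm (hdist (mult_op e (chr (proj e n h)) F) (mult_op e (chr h) F) - 0) < \<epsilon>"
      by blast
  qed
  then show "mult_op e (chr h) F \<in> HE e \<and>
      (\<lambda>n. hdist (S_fin e (proj e n h) F) (mult_op e (chr h) F)) \<longlonglongrightarrow> 0"
    using HEh[OF h] by blast
  fix G assume G: "G \<in> HE e \<and> (\<lambda>n. hdist (S_fin e (proj e n h) F) G) \<longlonglongrightarrow> 0"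
  have "(\<lambda>n. hdist (S_fin e (proj e n h) F) G + hdist (S_fin e (proj e n h) F) (mult_op e (chr h) F))
      \<longlonglongrightarrow> 0"
    using G lim by (intro tendsto_add_zero) auto
  moreover have "hdist G (mult_op e (chr h) F)
      \<le> hdist (S_fin e (proj e n h) F) G + hdist (S_fin e (proj e n h) F) (mult_op e (chr h) F)" for n
    unfolding S using G HEh[OF h] HEn by (intro hdist_triangle) auto
  ultimately have "hdist G (mult_op e (chr h) F) \<le> 0" by (intro LIMSEQ_le_const) auto
  then show "G = mult_op e (chr h) F"
    using hdist_nonneg[of G "mult_op e (chr h) F"] G HEh[OF h] by (intro hdist_eq_0) auto
qed

text \<open>\<open>S_hat\<close> is identified with a multiplication operator only on
  \<open>HE e\<close>, so unitarity has to be carried over along an equality restricted to that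
  set.\<close>

lemma h_unitary_cong:
  assumes "\<And>F. F \<in> HE e \<Longrightarrow> U F = V F" "h_unitary e V"
  shows "h_unitary e U"
proof -
  have "bij_betw U (HE e) (HE e)"
    using assms by (subst bij_betw_cong[of "HE e" U V]) (auto simp: h_unitary_def)
  then show ?thesis
    using assms by (simp add: h_unitary_def h_add_HE h_scale_HE)
qed

lemma unitary_semigroup_S_hat:
  assumes h: "h \<in> L1 e"
  shows "unitary_semigroup e (\<lambda>t. S_hat e (t *\<^sub>R h))"
  unfolding unitary_semigroup_def
proof (intro conjI allI impI ballI)
  note adm = admissible_chr[OF L1_scaleR[OF h]]
  note S = S_hat_eq[OF L1_scaleR[OF h]]
  fix t :: real
  show "h_unitary e (S_hat e (t *\<^sub>R h))"
    by (rule h_unitary_cong[OF S h_unitary_mult_op[OF adm]])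
  fix F assume F: "F \<in> HE e"
  show "S_hat e (0 *\<^sub>R h) F = F"
    unfolding S[OF F] by (simp add: chr_zero mult_op_one F)
  fix s :: real
  have "mult_op e (chr (s *\<^sub>R h)) (mult_op e (chr (t *\<^sub>R h)) F) = mult_op e (chr ((s + t) *\<^sub>R h)) F"
    unfolding mult_op_mult_op[OF adm adm F] by (simp add: scaleR_add_left chr_add)
  then show "S_hat e ((s + t) *\<^sub>R h) F = S_hat e (s *\<^sub>R h) (S_hat e (t *\<^sub>R h) F)"
    using S F mult_op_HE_rel(1)[OF adm F] by simp
qed

text \<open>The summability norm of \<open>(s - t) h\<close> is |s - t| times that of
  \<open>h\<close>, hence small as \<open>s\<close> approaches \<open>t\<close>.\<close>

lemma strongly_continuous_S_hat:
  assumes h: "h \<in> L1 e"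
  shows "strongly_continuous e (\<lambda>t. S_hat e (t *\<^sub>R h))"
  unfolding strongly_continuous_def hdist_def[symmetric]
proof (intro ballI allI impI)
  note L1t = L1_scaleR[OF h]
  fix F and t :: real assume F: "F \<in> HE e"
  show "((\<lambda>s. hdist (S_hat e (s *\<^sub>R h) F) (S_hat e (t *\<^sub>R h) F)) \<longlongrightarrow> 0) (at t within {0..})"
    unfolding S_hat_eq[OF L1t F]
  proof (rule tendstoI)
    fix \<epsilon> :: real assume "0 < \<epsilon>"
    then have "0 < \<epsilon> / 2" by simp
    obtain \<delta> where \<delta>: "0 < \<delta>" "\<And>g h. g \<in> L1 e \<Longrightarrow> h \<in> L1 e \<Longrightarrow> l1norm (g - h) \<le> \<delta> \<Longrightarrow>
        hdist (mult_op e (chr g) F) (mult_op e (chr h) F) \<le> \<epsilon> / 2"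
      by (rule chr_close[OF F \<open>0 < \<epsilon> / 2\<close>]) blast
    have "((\<lambda>s. \<bar>s - t\<bar> * l1norm h) \<longlongrightarrow> \<bar>t - t\<bar> * l1norm h) (at t within {0..})"
      by (intro tendsto_intros)
    then have "\<forall>\<^sub>F s in at t within {0..}. \<bar>s - t\<bar> * l1norm h < \<delta>"
      using \<delta>(1) by (intro order_tendstoD(2)[of _ 0]) auto
    then show "\<forall>\<^sub>F s in at t within {0..}.
        dist (hdist (mult_op e (chr (s *\<^sub>R h)) F) (mult_op e (chr (t *\<^sub>R h)) F)) 0 < \<epsilon>"
    proof eventually_elim
      case (elim s)
      then have "l1norm (s *\<^sub>R h - t *\<^sub>R h) \<le> \<delta>"
        using l1norm_scaleR[OF h, of "s - t"] by (simp add: scaleR_diff_left)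
      then have "hdist (mult_op e (chr (s *\<^sub>R h)) F) (mult_op e (chr (t *\<^sub>R h)) F) \<le> \<epsilon> / 2"
        by (intro \<delta>(2) L1t)
      then show ?case
        using hdist_nonneg[OF mult_op_HE_rel(1)[OF admissible_chr[OF L1t] F]
            mult_op_HE_rel(1)[OF admissible_chr[OF L1t] F], of s t] \<open>0 < \<epsilon>\<close> by simp
    qed
  qed
qed

text \<open>For all \<open>t\<close> in the interval, the exponents differ in the summability norm
  by at most \<open>T\<close> times the tail of the coordinate series of \<open>h\<close>, so one
  \<open>m\<close> serves every \<open>t\<close>. Taking the supremum in \<open>ennreal\<close>
  makes it meaningful before any bound is known.\<close>

lemma S_hat_proj_uniform:
  assumes h: "h \<in> L1 e" and F: "F \<in> HE e"
  shows "(\<lambda>m. SUP t \<in> {0..T}. ennreal (hdist (S_hat e (t *\<^sub>R h) F) (S_hat e (t *\<^sub>R proj e m h) F)))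
    \<longlonglongrightarrow> 0"
  unfolding S_hat_eq[OF L1_scaleR[OF h] F] S_hat_eq[OF L1_scaleR[OF L1_proj] F]
proof (rule order_tendstoI)
  fix a :: ennreal assume "0 < a"
  then obtain b where b: "0 < b" "b < a" using dense by blast
  then obtain \<epsilon> where \<epsilon>: "b = ennreal \<epsilon>" "0 \<le> \<epsilon>" by (cases b) auto
  then have "0 < \<epsilon>" using b by simp
  obtain \<delta> where \<delta>: "0 < \<delta>" "\<And>g h. g \<in> L1 e \<Longrightarrow> h \<in> L1 e \<Longrightarrow> l1norm (g - h) \<le> \<delta> \<Longrightarrow>
      hdist (mult_op e (chr g) F) (mult_op e (chr h) F) \<le> \<epsilon>"
    by (rule chr_close[OF F \<open>0 < \<epsilon>\<close>]) blast
  have "(\<lambda>m. T * l1norm (h - proj e m h)) \<longlonglongrightarrow> 0"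
    by (intro tendsto_mult_right_zero l1norm_proj_tendsto h)
  then have "\<forall>\<^sub>F m in sequentially. T * l1norm (h - proj e m h) < \<delta>"
    using \<delta>(1) by (rule order_tendstoD(2))
  then show "\<forall>\<^sub>F m in sequentially. (SUP t \<in> {0..T}.
      ennreal (hdist (mult_op e (chr (t *\<^sub>R h)) F) (mult_op e (chr (t *\<^sub>R proj e m h)) F))) < a"
  proof eventually_elim
    case (elim m)
    have "hdist (mult_op e (chr (t *\<^sub>R h)) F) (mult_op e (chr (t *\<^sub>R proj e m h)) F) \<le> \<epsilon>"
      if t: "t \<in> {0..T}" for t
    proof (rule \<delta>(2)[OF L1_scaleR[OF h] L1_scaleR[OF L1_proj]])
      note d = L1_diff[OF h L1_proj, of m h]
      have "l1norm (t *\<^sub>R h - t *\<^sub>R proj e m h) = t * l1norm (h - proj e m h)"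
        using l1norm_scaleR[OF d, of t] t by (simp add: scaleR_diff_right)
      also have "\<dots> \<le> T * l1norm (h - proj e m h)"
        using t l1norm_nonneg[OF d] by (intro mult_right_mono) auto
      finally show "l1norm (t *\<^sub>R h - t *\<^sub>R proj e m h) \<le> \<delta>" using elim by simp
    qed
    then have "(SUP t \<in> {0..T}.
      ennreal (hdist (mult_op e (chr (t *\<^sub>R h)) F) (mult_op e (chr (t *\<^sub>R proj e m h)) F))) \<le> ennreal \<epsilon>"
      by (intro SUP_least ennreal_leI)
    also have "\<dots> < a" using b \<epsilon> by simp
    finally show ?case .
  qed
qed simp

end

theorem theorem4p3:
  fixes e :: "nat \<Rightarrow> 'a::{real_inner, complete_space}" and h :: 'a
  assumes "orthonormal_basis e" and "h \<in> L1 e"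
  shows "unitary_semigroup e (\<lambda>t. S_hat e (t *\<^sub>R h)) \<and>
    strongly_continuous e (\<lambda>t. S_hat e (t *\<^sub>R h)) \<and>
    (\<forall>T>0. \<forall>F \<in> HE e.
      ((\<lambda>m. SUP t \<in> {0..T}.
          ennreal (h_norm e (h_diff e (S_hat e (t *\<^sub>R h) F) (S_hat e (t *\<^sub>R proj e m h) F))))
        \<longlonglongrightarrow> 0))"
proof -
  interpret onb e by unfold_locales (rule assms(1))
  show ?thesis
    using unitary_semigroup_S_hat[OF assms(2)] strongly_continuous_S_hat[OF assms(2)]
      S_hat_proj_uniform[OF assms(2)] by (simp add: hdist_def)
qed

end
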